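(* Let $X$ be a real Banach space and let $M$ be a (closed) subspace of $X$ such that $\mathfrak{F}(M)$ is an ideal in $\mathfrak{F}(X)$. Suppose that $\mathcal{A}$ is an operator ideal such that $\mathcal{A}=\mathcal{A}^d$. If $M$ has the Lip-$\mathcal{A}$-BAP and $\mathfrak{F}(X)/\mathfrak{F}(M)$ has the $\mathcal{A}$-BAP, then $$\beta_X^*\in\overline{\mathcal{A}^\lambda(X^*,\mathfrak{F}(X)^* )}^{w^*}$$ for some $\lambda\ge1$, where $w^*$ is the weak-star topology on $\mathcal{L}(X^*,\mathfrak{F}(X)^* )=(X^*\widehat{\otimes}_\pi\mathfrak{F}(X))^*$.
   Context: All Banach spaces are real. For Banach spaces $X,Y$, $\mathcal{L}(X,Y)$ is the space of bounded linear operators, and $\mathrm{Lip}_0(X,Y)$ is the Banach space of Lipschitz maps $f:X\to Y$ with $f(0)=0$, with norm $\|f\|_{\mathrm{Lip}}=\sup_{x\neq y}\|f(x)-f(y)\|/\|x-y\|$; $\mathrm{Lip}_0(X)=\mathrm{Lip}_0(X,\mathbb{R})$. For $x\in X$ let $\delta_x\in \mathrm{Lip}_0(X)^*$, $\delta_x(f)=f(x)$. The Lipschitz-free space is $\mathfrak{F}(X)=\overline{\mathrm{span}}\{\delta_x: x\in X\}\subseteq \mathrm{Lip}_0(X)^*$, and $\delta_X:X\to\mathfrak{F}(X)$, $\delta_X(x)=\delta_x$. For a subspace $M\subseteq X$, $\mathfrak{F}(M)$ is identified isometrically with the subspace $\overline{\mathrm{span}}\{\delta_x:x\in M\}$ of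 $\mathfrak{F}(X)$. For each $f\in\mathrm{Lip}_0(X,Y)$ there is a unique $L_f\in\mathcal{L}(\mathfrak{F}(X),Y)$ with $L_f\delta_X=f$, and $\|L_f\|=\|f\|_{\mathrm{Lip}}$. The map $\beta_X:\mathfrak{F}(X)\to X$ is the bounded linear quotient map determined by $x^*(\beta_X(\mu))=\langle x^*,\mu\rangle$ for all $x^*\in X^*\subseteq\mathrm{Lip}_0(X)$; so $\beta_X(\delta_x)=x$. Operator ideals are (linear) operator ideals in the usual sense. $\mathcal{A}^d(X,Y)=\{T\in\mathcal{L}(X,Y):T^*\in\mathcal{A}(Y^*,X^* )\}$. For $\lambda\ge 1$: $\mathcal{A}^\lambda(X,Y)=\{T\in\mathcal{A}(X,Y):\|T\|\le\lambda\}$; $\mathrm{Lip}_{\mathcal{A}}(X,Y)=\{f\in\mathrm{Lip}_0(X,Y): L_f\in\mathcal{A}(\mathfrak{F}(X),Y)\}$; $\mathrm{Lip}_{\mathcal{A}}^\lambda(X,Y)=\{f\in\mathrm{Lip}_{\mathcal{A}}(X,Y):\|f\|_{\mathrm{Lip}}\le\lambda\}$. $\tau_c$ denotes the compact-open topology (uniform convergence on compact subsets of the domain). A Banach space $Z$ has the $\mathcal{A}$-BAP if $\mathrm{Id}_Z\in\overline{\mathcal{A}^\lambda(Z,Z)}^{\tau_c}$ for some $\lambda\ge1$, and the Lip-$\mathcal{A}$-BAP if $\mathrm{Id}_Z\in\overline{\mathrm{Lip}_{\mathcal{A}}^\lambda(Z,Z)}^{\tau_c}$ for some $\lambda\ge1$.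 A subspace $N$ of a Banach space $Z$ is an ideal in $Z$ (or locally complemented in $Z$) if $N^\perp$ is the kernel of a norm-one projection on $Z^*$; equivalently, there is a bounded linear $\sigma:N^*\to Z^*$ with $\sigma(y^* )(y)=y^*(y)$ and $\|\sigma(y^* )\|=\|y^*\|$ for all $y^*\in N^*$, $y\in N$. For Banach spaces $E,F$, the weak-star topology on $\mathcal{L}(E,F^* )$ is the one coming from the identification $\mathcal{L}(E,F^* )=(E\widehat{\otimes}_\pi F)^*$, where $\widehat{\otimes}_\pi$ is the projective tensor product and $\langle e\otimes f,T\rangle=(Te)(f)$. *)

theory Defs
  imports "HOL-Analysis.Analysis"
begin

text \<open>An operator ideal assigns a set of operators to every pair of Banach spaces, so the Banach
  spaces have to be values and not types. They are therefore records with an explicit carrier, and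
  the class \<open>banach\<close> is not enough. Maps between them are extensional on the carrier of their
  domain, so that equality of maps is equality in HOL.\<close>

record 'a nspace =
  ncar :: "'a set"
  nzero :: 'a
  nadd :: "'a \<Rightarrow> 'a \<Rightarrow> 'a"
  nscale :: "real \<Rightarrow> 'a \<Rightarrow> 'a"
  nnorm :: "'a \<Rightarrow> real"

locale normed_space =
  fixes E :: "'a nspace"
  assumes zero_closed: "nzero E \<in> ncar E"
    and add_closed: "\<lbrakk>x \<in> ncar E; y \<in> ncar E\<rbrakk> \<Longrightarrow> nadd E x y \<in> ncar E"
    and scale_closed: "x \<in> ncar E \<Longrightarrow> nscale E c x \<in> ncar E"
    and add_assoc: "\<lbrakk>x \<in> ncar E; y \<in> ncar E; z \<in> ncar E\<rbrakk>
      \<Longrightarrow> nadd E (nadd E x y) z = nadd E x (nadd E y z)"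
    and add_commute: "\<lbrakk>x \<in> ncar E; y \<in> ncar E\<rbrakk> \<Longrightarrow> nadd E x y = nadd E y x"
    and add_zero: "x \<in> ncar E \<Longrightarrow> nadd E x (nzero E) = x"
    and add_neg: "x \<in> ncar E \<Longrightarrow> nadd E x (nscale E (-1) x) = nzero E"
    and scale_one: "x \<in> ncar E \<Longrightarrow> nscale E 1 x = x"
    and scale_scale: "x \<in> ncar E \<Longrightarrow> nscale E c (nscale E d x) = nscale E (c * d) x"
    and scale_add_left: "x \<in> ncar E \<Longrightarrow> nscale E (c + d) x = nadd E (nscale E c x) (nscale E d x)"
    and scale_add_right: "\<lbrakk>x \<in> ncar E; y \<in> ncar E\<rbrakk>
      \<Longrightarrow> nscale E c (nadd E x y) = nadd E (nscale E c x) (nscale E c y)"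
    and norm_nonneg: "x \<in> ncar E \<Longrightarrow> 0 \<le> nnorm E x"
    and norm_eq_zero: "x \<in> ncar E \<Longrightarrow> nnorm E x = 0 \<longleftrightarrow> x = nzero E"
    and norm_scale: "x \<in> ncar E \<Longrightarrow> nnorm E (nscale E c x) = \<bar>c\<bar> * nnorm E x"
    and norm_triangle: "\<lbrakk>x \<in> ncar E; y \<in> ncar E\<rbrakk>
      \<Longrightarrow> nnorm E (nadd E x y) \<le> nnorm E x + nnorm E y"

definition nsub :: "'a nspace \<Rightarrow> 'a \<Rightarrow> 'a \<Rightarrow> 'a" where
  "nsub E x y = nadd E x (nscale E (-1) y)"

text \<open>The locale \<open>Metric_space\<close> wants symmetry and nonnegativity off the carrier as well.\<close>

definition ndist :: "'a nspace \<Rightarrow> 'a \<Rightarrow> 'a \<Rightarrow> real" where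
  "ndist E x y = (if x \<in> ncar E \<and> y \<in> ncar E then nnorm E (nsub E x y) else 0)"

definition ntop :: "'a nspace \<Rightarrow> 'a topology" where
  "ntop E = Metric_space.mtopology (ncar E) (ndist E)"

definition banach_space :: "'a nspace \<Rightarrow> bool" where
  "banach_space E \<longleftrightarrow> normed_space E \<and> Metric_space.mcomplete (ncar E) (ndist E)"

definition type_space :: "'a::real_normed_vector nspace" where
  "type_space = \<lparr>ncar = UNIV, nzero = 0, nadd = (+), nscale = scaleR, nnorm = norm\<rparr>"

abbreviation real_line :: "real nspace" where
  "real_line \<equiv> type_space"

lemma Metric_space_ndist:
  assumes "normed_space E"
  shows "Metric_space (ncar E) (ndist E)"
proof
  interpret normed_space E by fact
  have subin: "nsub E x y \<in> ncar E" if "x \<in> ncar E" "y \<in> ncar E" for x y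
    unfolding nsub_def using that by (simp add: scale_closed add_closed)
  have neg_add: "nadd E (nscale E (-1) y) y = nzero E" if "y \<in> ncar E" for y
    using that by (metis add_commute add_neg scale_closed)
  have zero_add: "nadd E (nzero E) y = y" if "y \<in> ncar E" for y
    using that by (metis add_commute add_zero zero_closed)
  show "0 \<le> ndist E x y" for x y
    by (simp add: ndist_def norm_nonneg subin)
  show "ndist E x y = ndist E y x" for x y
  proof -
    have "nscale E (-1) (nsub E x y) = nsub E y x" if "x \<in> ncar E" "y \<in> ncar E"
    proof -
      have "nscale E (-1) (nsub E x y) = nadd E (nscale E (-1) x) y"
        unfolding nsub_def using that
        by (simp add: scale_add_right scale_closed scale_scale scale_one)
      then show ?thesis
        unfolding nsub_def using that by (metis add_commute scale_closed)
    qed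
    then show ?thesis
      unfolding ndist_def using norm_scale[of "nsub E x y" "-1"] subin by auto
  qed
  show "ndist E x y = 0 \<longleftrightarrow> x = y" if "x \<in> ncar E" "y \<in> ncar E" for x y
  proof
    assume "ndist E x y = 0"
    then have 0: "nsub E x y = nzero E"
      using that by (simp add: ndist_def norm_eq_zero subin)
    have "x = nadd E x (nadd E (nscale E (-1) y) y)"
      using that by (simp add: neg_add add_zero)
    also have "\<dots> = nadd E (nsub E x y) y"
      using that by (simp add: nsub_def add_assoc scale_closed)
    also have "\<dots> = y"
      using 0 that by (simp add: zero_add)
    finally show "x = y" .
  next
    assume "x = y"
    then have "nsub E x y = nzero E" using that by (simp add: nsub_def add_neg)
    then show "ndist E x y = 0"
      using that norm_eq_zero[OF zero_closed] by (simp add: ndist_def)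
  qed
  show "ndist E x w \<le> ndist E x y + ndist E y w"
    if "x \<in> ncar E" "y \<in> ncar E" "w \<in> ncar E" for x y w
  proof -
    have "nadd E (nsub E x y) (nsub E y w)
        = nadd E x (nadd E (nadd E (nscale E (-1) y) y) (nscale E (-1) w))"
      using that by (simp add: nsub_def add_assoc scale_closed add_closed)
    also have "\<dots> = nsub E x w"
      using that by (simp add: neg_add zero_add scale_closed nsub_def)
    finally show ?thesis
      using norm_triangle[OF subin[OF that(1,2)] subin[OF that(2,3)]] that
      by (simp add: ndist_def)
  qed
qed

lemma banach_space_type_space: "banach_space (type_space :: 'a::banach nspace)"
proof -
  have d: "(ndist type_space :: 'a \<Rightarrow> 'a \<Rightarrow> real) = dist"
    by (simp add: fun_eq_iff ndist_def nsub_def type_space_def dist_norm)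
  have "normed_space (type_space :: 'a nspace)"
    by unfold_locales (simp_all add: type_space_def algebra_simps norm_triangle_ineq)
  moreover have "Metric_space.mcomplete (ncar (type_space :: 'a nspace)) (ndist type_space)"
    using complete_UNIV by (simp add: d) (simp add: type_space_def)
  ultimately show ?thesis
    by (simp add: banach_space_def)
qed

definition lin_subspace :: "'a nspace \<Rightarrow> 'a set \<Rightarrow> bool" where
  "lin_subspace E S \<longleftrightarrow> S \<subseteq> ncar E \<and> nzero E \<in> S \<and>
     (\<forall>x\<in>S. \<forall>y\<in>S. nadd E x y \<in> S) \<and> (\<forall>c. \<forall>x\<in>S. nscale E c x \<in> S)"

definition sub_space :: "'a nspace \<Rightarrow> 'a set \<Rightarrow> 'a nspace" where
  "sub_space E S = E\<lparr>ncar := S\<rparr>"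

definition closed_span :: "'a nspace \<Rightarrow> 'a set \<Rightarrow> 'a set" where
  "closed_span E S = ntop E closure_of \<Inter>{V. lin_subspace E V \<and> S \<subseteq> V}"

definition coset :: "'a nspace \<Rightarrow> 'a set \<Rightarrow> 'a \<Rightarrow> 'a set" where
  "coset E N x = nadd E x ` N"

definition quotient_space :: "'a nspace \<Rightarrow> 'a set \<Rightarrow> 'a set nspace" where
  "quotient_space E N =
     \<lparr>ncar = coset E N ` ncar E,
      nzero = N,
      nadd = (\<lambda>C D. {nadd E x y | x y. x \<in> C \<and> y \<in> D}),
      nscale = (\<lambda>c C. {nadd E (nscale E c x) n | x n. x \<in> C \<and> n \<in> N}),
      nnorm = (\<lambda>C. Inf (nnorm E ` C))\<rparr>"

text \<open>The space of maps in \<open>S\<close>, defined on the set \<open>D\<close>, with the pointwise operations of \<open>F\<close>.\<close>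

definition map_space :: "'a set \<Rightarrow> 'b nspace \<Rightarrow> ('a \<Rightarrow> 'b) set \<Rightarrow> (('a \<Rightarrow> 'b) \<Rightarrow> real) \<Rightarrow>
    ('a \<Rightarrow> 'b) nspace" where
  "map_space D F S N =
     \<lparr>ncar = S,
      nzero = (\<lambda>x\<in>D. nzero F),
      nadd = (\<lambda>f g. \<lambda>x\<in>D. nadd F (f x) (g x)),
      nscale = (\<lambda>c f. \<lambda>x\<in>D. nscale F c (f x)),
      nnorm = N\<rparr>"

definition linear_maps :: "'a nspace \<Rightarrow> 'b nspace \<Rightarrow> ('a \<Rightarrow> 'b) set" where
  "linear_maps E F = {T \<in> ncar E \<rightarrow>\<^sub>E ncar F.
     (\<forall>x\<in>ncar E. \<forall>y\<in>ncar E. T (nadd E x y) = nadd F (T x) (T y)) \<and>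
     (\<forall>c. \<forall>x\<in>ncar E. T (nscale E c x) = nscale F c (T x))}"

definition op_norm :: "'a nspace \<Rightarrow> 'b nspace \<Rightarrow> ('a \<Rightarrow> 'b) \<Rightarrow> real" where
  "op_norm E F T = Sup {nnorm F (T x) | x. x \<in> ncar E \<and> nnorm E x \<le> 1}"

definition operators :: "'a nspace \<Rightarrow> 'b nspace \<Rightarrow> ('a \<Rightarrow> 'b) nspace" where
  "operators E F = map_space (ncar E) F
     {T \<in> linear_maps E F. \<exists>C. \<forall>x\<in>ncar E. nnorm F (T x) \<le> C * nnorm E x} (op_norm E F)"

definition dual_space :: "'a nspace \<Rightarrow> ('a \<Rightarrow> real) nspace" where
  "dual_space E = operators E real_line"

definition adjoint_op :: "'a nspace \<Rightarrow> 'b nspace \<Rightarrow> ('a \<Rightarrow> 'b) \<Rightarrow> ('b \<Rightarrow> real) \<Rightarrow> ('a \<Rightarrow> real)" where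
  "adjoint_op E F T = (\<lambda>\<phi>\<in>ncar (dual_space F). \<lambda>x\<in>ncar E. \<phi> (T x))"

text \<open>The pairs with \<open>x = y\<close> contribute \<open>0 / 0 = 0\<close>, which also gives the norm \<open>0\<close> on the zero space.\<close>

definition lip_norm :: "'a nspace \<Rightarrow> 'b nspace \<Rightarrow> ('a \<Rightarrow> 'b) \<Rightarrow> real" where
  "lip_norm E F f =
     Sup {nnorm F (nsub F (f x) (f y)) / nnorm E (nsub E x y) | x y. x \<in> ncar E \<and> y \<in> ncar E}"

definition Lip0 :: "'a nspace \<Rightarrow> 'b nspace \<Rightarrow> ('a \<Rightarrow> 'b) nspace" where
  "Lip0 E F = map_space (ncar E) F
     {f \<in> ncar E \<rightarrow>\<^sub>E ncar F. f (nzero E) = nzero F \<and>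
        (\<exists>C. \<forall>x\<in>ncar E. \<forall>y\<in>ncar E. nnorm F (nsub F (f x) (f y)) \<le> C * nnorm E (nsub E x y))}
     (lip_norm E F)"

definition delta :: "'a nspace \<Rightarrow> 'a \<Rightarrow> (('a \<Rightarrow> real) \<Rightarrow> real)" where
  "delta X x = (\<lambda>f\<in>ncar (Lip0 X real_line). f x)"

definition free_space :: "'a nspace \<Rightarrow> (('a \<Rightarrow> real) \<Rightarrow> real) nspace" where
  "free_space X = sub_space (dual_space (Lip0 X real_line))
     (closed_span (dual_space (Lip0 X real_line)) (delta X ` ncar X))"

text \<open>The copy of the free space of the subspace \<open>M\<close> inside the free space of \<open>X\<close>.\<close>

definition free_sub :: "'a nspace \<Rightarrow> 'a set \<Rightarrow> (('a \<Rightarrow> real) \<Rightarrow> real) set" where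
  "free_sub X M = closed_span (free_space X) (delta X ` M)"

definition lin_ext :: "'a nspace \<Rightarrow> 'b nspace \<Rightarrow> ('a \<Rightarrow> 'b) \<Rightarrow> (('a \<Rightarrow> real) \<Rightarrow> real) \<Rightarrow> 'b" where
  "lin_ext X Y f = (THE L. L \<in> ncar (operators (free_space X) Y) \<and> (\<forall>x\<in>ncar X. L (delta X x) = f x))"

text \<open>The map \<open>\<beta>\<^sub>X\<close>; the condition determines it because the functionals separate the points of \<open>X\<close>.\<close>

definition beta :: "'a nspace \<Rightarrow> (('a \<Rightarrow> real) \<Rightarrow> real) \<Rightarrow> 'a" where
  "beta X = (SOME T. T \<in> ncar (operators (free_space X) X) \<and>
     (\<forall>\<mu>\<in>ncar (free_space X). \<forall>\<phi>\<in>ncar (dual_space X). \<phi> (T \<mu>) = \<mu> \<phi>))"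

definition annihilator :: "'a nspace \<Rightarrow> 'a set \<Rightarrow> ('a \<Rightarrow> real) set" where
  "annihilator Z N = {\<phi> \<in> ncar (dual_space Z). \<forall>y\<in>N. \<phi> y = 0}"

text \<open>\<open>N\<close> is an ideal in \<open>Z\<close>. A nonzero projection has norm at least \<open>1\<close>, so that norm at most \<open>1\<close>
  differs from norm one only for \<open>N = 0\<close>, where the projection is \<open>0\<close>; the equivalent
  description by extension operators admits this case.\<close>

definition locally_complemented :: "'a nspace \<Rightarrow> 'a set \<Rightarrow> bool" where
  "locally_complemented Z N \<longleftrightarrow>
     lin_subspace Z N \<and>
     (\<exists>P \<in> ncar (operators (dual_space Z) (dual_space Z)).
        (\<forall>\<phi>\<in>ncar (dual_space Z). P (P \<phi>) = P \<phi>) \<and>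
        op_norm (dual_space Z) (dual_space Z) P \<le> 1 \<and>
        {\<phi> \<in> ncar (dual_space Z). P \<phi> = nzero (dual_space Z)} = annihilator Z N)"

text \<open>No type contains all Banach spaces. An operator ideal is a family of components indexed by the
  Banach spaces whose carrier is a set in an arbitrary type \<open>'u\<close>, which plays the role of a universe:
  any class-sized operator ideal restricts to one over \<open>'u\<close>. A theorem about \<open>X\<close> over \<open>'a\<close> has to assume
  that \<open>'u\<close> is large compared to \<open>'a\<close>; an injection from the type of \<open>\<FF>(X)\<^sup>*\<close> into \<open>'u\<close> says
  this and puts no restriction on \<open>X\<close>.\<close>

type_synonym 'u op_class = "'u nspace \<Rightarrow> 'u nspace \<Rightarrow> ('u \<Rightarrow> 'u) set"

text \<open>Every component is a subspace and contains the operators \<open>\<phi> \<otimes> y\<close>, hence all operators of finite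
  rank.\<close>

definition operator_ideal :: "'u op_class \<Rightarrow> bool" where
  "operator_ideal A \<longleftrightarrow>
     (\<forall>E F. banach_space E \<and> banach_space F \<longrightarrow>
        lin_subspace (operators E F) (A E F) \<and>
        (\<forall>\<phi>\<in>ncar (dual_space E). \<forall>y\<in>ncar F. (\<lambda>x\<in>ncar E. nscale F (\<phi> x) y) \<in> A E F)) \<and>
     (\<forall>E0 E F F0. banach_space E0 \<and> banach_space E \<and> banach_space F \<and> banach_space F0 \<longrightarrow>
        (\<forall>S\<in>ncar (operators E0 E). \<forall>T\<in>A E F. \<forall>R\<in>ncar (operators F F0).
           compose (ncar E0) R (compose (ncar E0) T S) \<in> A E0 F0))"

definition isometric_iso :: "'a nspace \<Rightarrow> 'b nspace \<Rightarrow> ('a \<Rightarrow> 'b) \<Rightarrow> bool" where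
  "isometric_iso E F i \<longleftrightarrow> i \<in> linear_maps E F \<and> i ` ncar E = ncar F \<and>
     (\<forall>x\<in>ncar E. nnorm F (i x) = nnorm E x)"

definition has_copy :: "'u itself \<Rightarrow> 'a nspace \<Rightarrow> bool" where
  "has_copy U E \<longleftrightarrow> (\<exists>(E' :: 'u nspace) i. isometric_iso E E' i \<and> banach_space E')"

text \<open>The components of \<open>A\<close> at Banach spaces over other types, by transport along isometric copies in
  \<open>'u\<close>. For an operator ideal the choice of the copies does not matter, and for spaces over \<open>'u\<close>
  this is \<open>A E F\<close> again.\<close>

definition ideal_ops :: "'u op_class \<Rightarrow> 'a nspace \<Rightarrow> 'b nspace \<Rightarrow> ('a \<Rightarrow> 'b) set" where
  "ideal_ops A E F = {T \<in> ncar (operators E F).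
     \<exists>E' F' i j. banach_space E' \<and> banach_space F' \<and> isometric_iso E' E i \<and> isometric_iso F F' j \<and>
       compose (ncar E') j (compose (ncar E') T i) \<in> A E' F'}"

definition dual_ideal :: "'u op_class \<Rightarrow> 'u op_class" where
  "dual_ideal A E F =
     {T \<in> ncar (operators E F). adjoint_op E F T \<in> ideal_ops A (dual_space F) (dual_space E)}"

text \<open>\<open>A = A\<^sup>d\<close>, at all pairs of Banach spaces for which the universe \<open>'u\<close> has room for both duals, so
  that the component of \<open>A\<close> at the duals is available.\<close>

definition self_dual_ideal :: "'u op_class \<Rightarrow> bool" where
  "self_dual_ideal A \<longleftrightarrow>
     (\<forall>E F. banach_space E \<and> banach_space F \<and>
        has_copy TYPE('u) (dual_space E) \<and> has_copy TYPE('u) (dual_space F) \<longrightarrow>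
        A E F = dual_ideal A E F)"

definition ideal_ops_le :: "'u op_class \<Rightarrow> real \<Rightarrow> 'a nspace \<Rightarrow> 'b nspace \<Rightarrow> ('a \<Rightarrow> 'b) set" where
  "ideal_ops_le A l E F = {T \<in> ideal_ops A E F. op_norm E F T \<le> l}"

definition lip_ideal :: "'u op_class \<Rightarrow> 'a nspace \<Rightarrow> 'b nspace \<Rightarrow> ('a \<Rightarrow> 'b) set" where
  "lip_ideal A X Y = {f \<in> ncar (Lip0 X Y). lin_ext X Y f \<in> ideal_ops A (free_space X) Y}"

definition lip_ideal_le :: "'u op_class \<Rightarrow> real \<Rightarrow> 'a nspace \<Rightarrow> 'b nspace \<Rightarrow> ('a \<Rightarrow> 'b) set" where
  "lip_ideal_le A l X Y = {f \<in> lip_ideal A X Y. lip_norm X Y f \<le> l}"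

definition cont_maps :: "'a nspace \<Rightarrow> 'b nspace \<Rightarrow> ('a \<Rightarrow> 'b) set" where
  "cont_maps E F = {f \<in> extensional (ncar E). continuous_map (ntop E) (ntop F) f}"

definition tau_c_open :: "'a nspace \<Rightarrow> 'b nspace \<Rightarrow> ('a \<Rightarrow> 'b) set \<Rightarrow> bool" where
  "tau_c_open E F U \<longleftrightarrow> U \<subseteq> cont_maps E F \<and>
     (\<forall>f\<in>U. \<exists>K e. compactin (ntop E) K \<and> e > 0 \<and>
        {g \<in> cont_maps E F. \<forall>x\<in>K. ndist F (g x) (f x) < e} \<subseteq> U)"

definition tau_c :: "'a nspace \<Rightarrow> 'b nspace \<Rightarrow> ('a \<Rightarrow> 'b) topology" where
  "tau_c E F = topology (tau_c_open E F)"

lemma istopology_tau_c_open: "istopology (tau_c_open E F)"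
  unfolding istopology_def
proof (intro conjI allI impI)
  fix U V assume U: "tau_c_open E F U" and V: "tau_c_open E F V"
  show "tau_c_open E F (U \<inter> V)"
    unfolding tau_c_open_def
  proof (intro conjI ballI)
    show "U \<inter> V \<subseteq> cont_maps E F" using U by (auto simp: tau_c_open_def)
    fix f assume f: "f \<in> U \<inter> V"
    obtain K d where K: "compactin (ntop E) K" "d > 0"
      "{g \<in> cont_maps E F. \<forall>x\<in>K. ndist F (g x) (f x) < d} \<subseteq> U"
      using U f unfolding tau_c_open_def by blast
    obtain L e where L: "compactin (ntop E) L" "e > 0"
      "{g \<in> cont_maps E F. \<forall>x\<in>L. ndist F (g x) (f x) < e} \<subseteq> V"
      using V f unfolding tau_c_open_def by blast
    have "compactin (ntop E) (K \<union> L)" "min d e > 0"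
      using K L by (auto intro: compactin_Un)
    moreover have "{g \<in> cont_maps E F. \<forall>x\<in>K \<union> L. ndist F (g x) (f x) < min d e} \<subseteq> U \<inter> V"
      using K(3) L(3) by auto
    ultimately show "\<exists>K e. compactin (ntop E) K \<and> e > 0 \<and>
        {g \<in> cont_maps E F. \<forall>x\<in>K. ndist F (g x) (f x) < e} \<subseteq> U \<inter> V" by blast
  qed
next
  fix \<K> assume "\<forall>U\<in>\<K>. tau_c_open E F U"
  then show "tau_c_open E F (\<Union>\<K>)"
    unfolding tau_c_open_def by (meson Sup_least UnionE Union_upper order_trans)
qed

definition BAP :: "'u op_class \<Rightarrow> 'a nspace \<Rightarrow> bool" where
  "BAP A Z \<longleftrightarrow> (\<exists>l\<ge>1. (\<lambda>z\<in>ncar Z. z) \<in> tau_c Z Z closure_of ideal_ops_le A l Z Z)"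

definition Lip_BAP :: "'u op_class \<Rightarrow> 'a nspace \<Rightarrow> bool" where
  "Lip_BAP A Z \<longleftrightarrow> (\<exists>l\<ge>1. (\<lambda>z\<in>ncar Z. z) \<in> tau_c Z Z closure_of lip_ideal_le A l Z Z)"

text \<open>The algebraic tensor product, realized by functionals on the bilinear forms,
  \<open>(e \<otimes> f) B = B (e, f)\<close>, with the projective norm
  \<open>\<pi>(u) = inf {\<Sum>\<^sub>i \<parallel>e\<^sub>i\<parallel> \<parallel>f\<^sub>i\<parallel>. u = \<Sum>\<^sub>i e\<^sub>i \<otimes> f\<^sub>i}\<close>.\<close>

definition bilinear_forms :: "'a nspace \<Rightarrow> 'b nspace \<Rightarrow> ('a \<times> 'b \<Rightarrow> real) set" where
  "bilinear_forms E F = {B \<in> extensional (ncar E \<times> ncar F).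
     (\<forall>e\<in>ncar E. (\<lambda>f\<in>ncar F. B (e, f)) \<in> linear_maps F real_line) \<and>
     (\<forall>f\<in>ncar F. (\<lambda>e\<in>ncar E. B (e, f)) \<in> linear_maps E real_line)}"

definition tensor_sum :: "'a nspace \<Rightarrow> 'b nspace \<Rightarrow> ('a \<times> 'b) list \<Rightarrow> ('a \<times> 'b \<Rightarrow> real) \<Rightarrow> real" where
  "tensor_sum E F ps = (\<lambda>B\<in>bilinear_forms E F. \<Sum>p\<leftarrow>ps. B p)"

definition proj_norm :: "'a nspace \<Rightarrow> 'b nspace \<Rightarrow> (('a \<times> 'b \<Rightarrow> real) \<Rightarrow> real) \<Rightarrow> real" where
  "proj_norm E F u = Inf {(\<Sum>(e, f)\<leftarrow>ps. nnorm E e * nnorm F f) | ps.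
     ps \<in> lists (ncar E \<times> ncar F) \<and> tensor_sum E F ps = u}"

definition alg_tensor :: "'a nspace \<Rightarrow> 'b nspace \<Rightarrow> (('a \<times> 'b \<Rightarrow> real) \<Rightarrow> real) nspace" where
  "alg_tensor E F = map_space (bilinear_forms E F) real_line
     (tensor_sum E F ` lists (ncar E \<times> ncar F)) (proj_norm E F)"

text \<open>The completion of a normed space is the closure of its canonical image in its bidual.\<close>

definition completion_space :: "'a nspace \<Rightarrow> (('a \<Rightarrow> real) \<Rightarrow> real) nspace" where
  "completion_space V = sub_space (dual_space (dual_space V))
     (ntop (dual_space (dual_space V)) closure_of
       ((\<lambda>v. \<lambda>\<phi>\<in>ncar (dual_space V). \<phi> v) ` ncar V))"

definition proj_tensor ::
    "'a nspace \<Rightarrow> 'b nspace \<Rightarrow> (((('a \<times> 'b \<Rightarrow> real) \<Rightarrow> real) \<Rightarrow> real) \<Rightarrow> real) nspace" where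
  "proj_tensor E F = completion_space (alg_tensor E F)"

text \<open>The duality between \<open>T : E \<rightarrow> F\<^sup>*\<close> and the projective tensor product. As a functional on the
  algebraic tensor product, \<open>T\<close> evaluates \<open>u\<close> at the bilinear form \<open>(e, f) \<mapsto> (T e) f\<close>, so
  that \<open>\<langle>e \<otimes> f, T\<rangle> = (T e) f\<close>; an element of the completion acts on this functional.\<close>

definition tensor_functional ::
    "'a nspace \<Rightarrow> 'b nspace \<Rightarrow> ('a \<Rightarrow> 'b \<Rightarrow> real) \<Rightarrow> (('a \<times> 'b \<Rightarrow> real) \<Rightarrow> real) \<Rightarrow> real" where
  "tensor_functional E F T =
     (\<lambda>u\<in>ncar (alg_tensor E F). u (\<lambda>(e, f)\<in>ncar E \<times> ncar F. T e f))"

definition weak_star :: "'a nspace \<Rightarrow> 'b nspace \<Rightarrow> ('a \<Rightarrow> 'b \<Rightarrow> real) topology" where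
  "weak_star E F = pullback_topology (ncar (operators E (dual_space F)))
     (\<lambda>T. \<lambda>w\<in>ncar (proj_tensor E F). w (tensor_functional E F T))
     (product_topology (\<lambda>_. euclideanreal) (ncar (proj_tensor E F)))"

end

theory Submission
  imports Defs
begin

text \<open>Write \<open>Z = \<FF>(X)\<close>, \<open>N = \<FF>(M)\<close> and \<open>Q = Z/N\<close>. The operator \<open>\<beta>\<^sub>X\<^sup>*\<close> sends \<open>\<phi> \<in> X\<^sup>*\<close> to the evaluation
  \<open>\<mu> \<mapsto> \<mu> \<phi>\<close>. It is approximated in two steps, one for each of the approximation properties.

  Let \<open>f\<close> run through Lipschitz maps in the ideal, of constant at most \<open>l\<^sub>1\<close>, that converge to the identity
  of \<open>M\<close>. As \<open>A = A\<^sup>d\<close>, the adjoints \<open>L\<^sub>f\<^sup>* : M\<^sup>* \<rightarrow> \<FF>(M)\<^sup>*\<close> belong to \<open>A\<close>. Composed with the restriction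
  \<open>X\<^sup>* \<rightarrow> M\<^sup>*\<close> and with an extension operator \<open>\<FF>(M)\<^sup>* \<rightarrow> Z\<^sup>*\<close> of norm at most \<open>1\<close>, which exists because \<open>N\<close> is locally
  complemented, they give operators \<open>R\<^sub>f : X\<^sup>* \<rightarrow> Z\<^sup>*\<close> in \<open>A\<close> of norm at most \<open>l\<^sub>1\<close>
  (\<open>extension_operator\<close>, \<open>lipschitz_approximant\<close>). The extension operator need not be weak-star
  continuous, so \<open>R\<^sub>f \<rightarrow> \<beta>\<^sub>X\<^sup>*\<close> can be expected at the points of \<open>N\<close> only. But balls of operators into
  a dual space are weak-star compact (\<open>operators_into_dual_compactness\<close>), hence \<open>R\<^sub>f\<close> converges to some
  \<open>U : X\<^sup>* \<rightarrow> Z\<^sup>*\<close> along a finer filter, and \<open>U \<phi>\<close> agrees with \<open>\<beta>\<^sub>X\<^sup>* \<phi>\<close> on \<open>N\<close>.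

  The point is that the unknown error \<open>\<beta>\<^sub>X\<^sup>* - U\<close> therefore takes values in \<open>N\<^sup>\<bottom> = Q\<^sup>*\<close>. If \<open>S\<close> runs through
  operators in \<open>A\<close> that converge to the identity of \<open>Q\<close>, then \<open>S\<^sup>*\<close> is in \<open>A\<close> by duality, and \<open>S\<^sup>* (\<beta>\<^sub>X\<^sup>* - U)\<close>
  converges to \<open>\<beta>\<^sub>X\<^sup>* - U\<close> (\<open>quotient_approximant\<close>). So \<open>\<beta>\<^sub>X\<^sup>*\<close> is the pointwise limit of the operators
  \<open>R\<^sub>f + S\<^sup>* (\<beta>\<^sub>X\<^sup>* - U)\<close>, which belong to \<open>A\<close> and are bounded by \<open>l\<^sub>1 + l\<^sub>2 (1 + l\<^sub>1)\<close>, and on bounded sets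
  pointwise convergence implies weak-star convergence (\<open>weak_star_closure\<close>).

  The Hahn-Banach theorem enters through the existence of \<open>L\<^sub>f\<close> and \<open>\<beta>\<^sub>X\<close> (\<open>linearization_exists\<close>): a norm
  on \<open>\<FF>(X)\<close> that is defined by Lipschitz functions has to control vectors of the target space. Limits
  are taken along filters, which play the role of nets. Compositions and adjoints of members of \<open>A\<close>
  between spaces over different types are handled by \<open>ideal_ops_compose\<close> and \<open>ideal_ops_adjoint\<close>.\<close>


section \<open>Normed spaces, dual spaces and closures\<close>

text \<open>Properties of a norm that make the dual a Banach space. \<open>Lip0\<close> and the algebraic tensor product
  enter the proof through their duals, so these properties are what is established for them.\<close>

locale pre_normed =
  fixes E :: "'a nspace"
  assumes zero_closed: "nzero E \<in> ncar E"
    and add_closed: "\<lbrakk>x \<in> ncar E; y \<in> ncar E\<rbrakk> \<Longrightarrow> nadd E x y \<in> ncar E"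
    and scale_closed: "x \<in> ncar E \<Longrightarrow> nscale E c x \<in> ncar E"
    and norm_nonneg: "x \<in> ncar E \<Longrightarrow> 0 \<le> nnorm E x"
    and norm_zero: "nnorm E (nzero E) = 0"
    and norm_scale_le: "x \<in> ncar E \<Longrightarrow> nnorm E (nscale E c x) \<le> \<bar>c\<bar> * nnorm E x"

context normed_space
begin

lemma norm_zero: "nnorm E (nzero E) = 0"
  using norm_eq_zero zero_closed by blast

lemma pre_normed: "pre_normed E"
  by unfold_locales (auto simp: zero_closed add_closed scale_closed norm_nonneg norm_scale norm_zero)

lemma sub_closed: "\<lbrakk>x \<in> ncar E; y \<in> ncar E\<rbrakk> \<Longrightarrow> nsub E x y \<in> ncar E"
  by (simp add: nsub_def add_closed scale_closed)

lemma zero_add: "x \<in> ncar E \<Longrightarrow> nadd E (nzero E) x = x"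
  by (metis add_commute add_zero zero_closed)

lemma scale_zero_left: "x \<in> ncar E \<Longrightarrow> nscale E 0 x = nzero E"
  using scale_add_left[of x 1 "-1"] by (simp add: scale_one add_neg)

lemma scale_zero_right: "nscale E c (nzero E) = nzero E"
  by (metis mult_zero_right scale_scale scale_zero_left zero_closed)

lemma sub_self: "x \<in> ncar E \<Longrightarrow> nsub E x x = nzero E"
  by (simp add: nsub_def add_neg)

lemma sub_zero: "x \<in> ncar E \<Longrightarrow> nsub E x (nzero E) = x"
  by (simp add: nsub_def scale_zero_right add_zero)

lemma sub_add_cancel: "\<lbrakk>x \<in> ncar E; y \<in> ncar E\<rbrakk> \<Longrightarrow> nadd E (nsub E x y) y = x"
  by (metis add_assoc add_commute add_neg add_zero nsub_def scale_closed)

lemma add_left_commute: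
  "\<lbrakk>x \<in> ncar E; y \<in> ncar E; z \<in> ncar E\<rbrakk> \<Longrightarrow> nadd E x (nadd E y z) = nadd E y (nadd E x z)"
  by (metis add_assoc add_commute)

lemma metric: "Metric_space (ncar E) (ndist E)"
  by (simp add: Metric_space_ndist normed_space_axioms)

lemma ndist_eq: "\<lbrakk>x \<in> ncar E; y \<in> ncar E\<rbrakk> \<Longrightarrow> ndist E x y = nnorm E (nsub E x y)"
  by (simp add: ndist_def)

lemma norm_sub_commute: "\<lbrakk>x \<in> ncar E; y \<in> ncar E\<rbrakk> \<Longrightarrow> nnorm E (nsub E x y) = nnorm E (nsub E y x)"
  using Metric_space.commute[OF metric, of x y] by (simp add: ndist_eq)

lemma norm_sub_triangle:
  "\<lbrakk>x \<in> ncar E; y \<in> ncar E; z \<in> ncar E\<rbrakk>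
    \<Longrightarrow> nnorm E (nsub E x z) \<le> nnorm E (nsub E x y) + nnorm E (nsub E y z)"
  using Metric_space.triangle[OF metric, of x y z] by (simp add: ndist_eq)

lemma sub_eq_zero_iff: "\<lbrakk>x \<in> ncar E; y \<in> ncar E\<rbrakk> \<Longrightarrow> nsub E x y = nzero E \<longleftrightarrow> x = y"
  using Metric_space.zero[OF metric, of x y] norm_eq_zero[OF sub_closed, of x y]
  by (simp add: ndist_eq)

lemma norm_sub_eq_zero_iff: "\<lbrakk>x \<in> ncar E; y \<in> ncar E\<rbrakk> \<Longrightarrow> nnorm E (nsub E x y) = 0 \<longleftrightarrow> x = y"
  by (simp add: norm_eq_zero sub_closed sub_eq_zero_iff)

lemma sub_add_sub:
  assumes "x \<in> ncar E" "y \<in> ncar E" "a \<in> ncar E" "b \<in> ncar E"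
  shows "nsub E (nadd E x y) (nadd E a b) = nadd E (nsub E x a) (nsub E y b)"
  using assms
  by (simp add: nsub_def scale_add_right add_assoc add_closed scale_closed add_left_commute)

lemma sub_scale: "\<lbrakk>x \<in> ncar E; y \<in> ncar E\<rbrakk> \<Longrightarrow> nsub E (nscale E c x) (nscale E c y) = nscale E c (nsub E x y)"
  by (simp add: nsub_def scale_add_right scale_closed scale_scale)

lemma topspace_ntop: "topspace (ntop E) = ncar E"
  by (simp add: ntop_def Metric_space.topspace_mtopology[OF metric])

lemma in_closure_iff:
  "x \<in> ntop E closure_of S \<longleftrightarrow>
     x \<in> ncar E \<and> (\<forall>e>0. \<exists>y\<in>S. y \<in> ncar E \<and> nnorm E (nsub E x y) < e)"
proof -
  interpret Metric_space "ncar E" "ndist E" by (rule metric)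
  show ?thesis
    unfolding ntop_def metric_closure_of in_mball
    by (safe; metis ndist_eq mem_Collect_eq)
qed

lemma closedin_iff:
  assumes "S \<subseteq> ncar E"
  shows "closedin (ntop E) S \<longleftrightarrow>
    (\<forall>x\<in>ncar E. (\<forall>e>0. \<exists>y\<in>S. nnorm E (nsub E x y) < e) \<longrightarrow> x \<in> S)"
proof -
  have "closedin (ntop E) S \<longleftrightarrow> ntop E closure_of S \<subseteq> S"
    using assms closure_of_subset_eq topspace_ntop by metis
  then show ?thesis
    using assms unfolding subset_iff in_closure_iff by blast
qed

lemma limit_iff:
  "limitin (ntop E) f x F \<longleftrightarrow>
     x \<in> ncar E \<and> (\<forall>e>0. eventually (\<lambda>i. f i \<in> ncar E \<and> nnorm E (nsub E (f i) x) < e) F)"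
proof -
  interpret Metric_space "ncar E" "ndist E" by (rule metric)
  show ?thesis
    unfolding ntop_def limitin_metric
    by (auto simp: ndist_eq elim!: eventually_mono; meson eventually_mono ndist_eq)
qed

lemma sub_space_normed:
  assumes "lin_subspace E S"
  shows "normed_space (sub_space E S)"
  using assms unfolding lin_subspace_def sub_space_def
  by unfold_locales
    (auto simp: subset_iff add_assoc add_zero add_neg scale_one scale_scale
      scale_add_left scale_add_right norm_nonneg norm_eq_zero norm_scale norm_triangle
      intro: add_commute)

lemma lin_subspace_carrier: "lin_subspace E (ncar E)"
  by (simp add: lin_subspace_def zero_closed add_closed scale_closed)

lemma lin_subspace_closure:
  assumes S: "lin_subspace E S"
  shows "lin_subspace E (ntop E closure_of S)"
  unfolding lin_subspace_def
proof (intro conjI ballI allI)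
  have SE: "S \<subseteq> ncar E" using S by (simp add: lin_subspace_def)
  show "ntop E closure_of S \<subseteq> ncar E" by (auto simp: in_closure_iff)
  have "S \<subseteq> ntop E closure_of S"
    by (simp add: SE closure_of_subset topspace_ntop)
  then show "nzero E \<in> ntop E closure_of S" using S by (auto simp: lin_subspace_def)
next
  fix x y assume xy: "x \<in> ntop E closure_of S" "y \<in> ntop E closure_of S"
  then have car: "x \<in> ncar E" "y \<in> ncar E" by (auto simp: in_closure_iff)
  show "nadd E x y \<in> ntop E closure_of S"
    unfolding in_closure_iff
  proof (intro conjI allI impI)
    fix e :: real assume "e > 0"
    then obtain a b where a: "a \<in> S" "a \<in> ncar E" "nnorm E (nsub E x a) < e/2"
      and b: "b \<in> S" "b \<in> ncar E" "nnorm E (nsub E y b) < e/2"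
      using xy unfolding in_closure_iff by (meson half_gt_zero)
    have "nnorm E (nsub E (nadd E x y) (nadd E a b)) < e"
      using norm_triangle[of "nsub E x a" "nsub E y b"] a b car
      by (simp add: sub_add_sub sub_closed)
    then show "\<exists>z\<in>S. z \<in> ncar E \<and> nnorm E (nsub E (nadd E x y) z) < e"
      using a b S by (auto simp: lin_subspace_def)
  qed (simp add: car add_closed)
next
  fix c x assume x: "x \<in> ntop E closure_of S"
  then have car: "x \<in> ncar E" by (auto simp: in_closure_iff)
  show "nscale E c x \<in> ntop E closure_of S"
    unfolding in_closure_iff
  proof (intro conjI allI impI)
    fix e :: real assume "e > 0"
    then have "e / (\<bar>c\<bar> + 1) > 0" by simp
    then obtain a where a: "a \<in> S" "a \<in> ncar E" "nnorm E (nsub E x a) < e / (\<bar>c\<bar> + 1)"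
      using x unfolding in_closure_iff by meson
    have "nnorm E (nsub E (nscale E c x) (nscale E c a)) = \<bar>c\<bar> * nnorm E (nsub E x a)"
      using a car by (simp add: sub_scale norm_scale sub_closed)
    also have "\<dots> \<le> (\<bar>c\<bar> + 1) * nnorm E (nsub E x a)"
      using norm_nonneg[OF sub_closed, OF car a(2)] by (simp add: mult_right_mono)
    also have "\<dots> < e" using a(3) by (simp add: pos_less_divide_eq mult.commute)
    finally show "\<exists>z\<in>S. z \<in> ncar E \<and> nnorm E (nsub E (nscale E c x) z) < e"
      using a S by (metis lin_subspace_def scale_closed)
  qed (simp add: car scale_closed)
qed

lemma lin_subspace_closed_span:
  assumes "S \<subseteq> ncar E"
  shows "lin_subspace E (closed_span E S)"
  unfolding closed_span_def
proof (rule lin_subspace_closure)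
  have "\<Inter>{V. lin_subspace E V \<and> S \<subseteq> V} \<subseteq> ncar E"
    using lin_subspace_carrier assms by blast
  then show "lin_subspace E (\<Inter>{V. lin_subspace E V \<and> S \<subseteq> V})"
    unfolding lin_subspace_def by blast
qed

lemma closedin_closed_span: "closedin (ntop E) (closed_span E S)"
  by (simp add: closed_span_def)

lemma closed_span_superset:
  assumes "S \<subseteq> ncar E"
  shows "S \<subseteq> closed_span E S"
proof -
  have "\<Inter>{V. lin_subspace E V \<and> S \<subseteq> V} \<subseteq> ncar E"
    using lin_subspace_carrier assms by blast
  then have "\<Inter>{V. lin_subspace E V \<and> S \<subseteq> V} \<subseteq> closed_span E S"
    by (simp add: closed_span_def closure_of_subset topspace_ntop)
  then show ?thesis by blast
qed

lemma closed_span_minimal: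
  assumes "lin_subspace E K" "closedin (ntop E) K" "S \<subseteq> K"
  shows "closed_span E S \<subseteq> K"
  unfolding closed_span_def using assms by (intro closure_of_minimal) blast+

end

lemma ncar_sub_space [simp]: "ncar (sub_space E S) = S"
  and nzero_sub_space [simp]: "nzero (sub_space E S) = nzero E"
  and nadd_sub_space [simp]: "nadd (sub_space E S) = nadd E"
  and nscale_sub_space [simp]: "nscale (sub_space E S) = nscale E"
  and nnorm_sub_space [simp]: "nnorm (sub_space E S) = nnorm E"
  by (simp_all add: sub_space_def)

lemma nsub_sub_space [simp]: "nsub (sub_space E S) = nsub E"
  by (simp add: nsub_def fun_eq_iff)

lemma closed_sub_space_banach:
  assumes E: "banach_space E" and S: "lin_subspace E S" and cl: "closedin (ntop E) S"
  shows "banach_space (sub_space E S)"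
proof -
  interpret normed_space E using E by (simp add: banach_space_def)
  interpret Z: normed_space "sub_space E S" by (rule sub_space_normed[OF S])
  have sub: "S \<subseteq> ncar E" using S by (simp add: lin_subspace_def)
  interpret Submetric "ncar E" "ndist E" S
    by (simp add: Submetric_def Submetric_axioms_def metric sub)
  have eq: "ndist (sub_space E S) x y = ndist E x y" if "x \<in> S" "y \<in> S" for x y
    using that sub by (auto simp: ndist_def)
  interpret M: Metric_space S "ndist (sub_space E S)" using Z.metric by simp
  have sc: "sub.mcomplete"
    using closedin_mcomplete_imp_mcomplete cl E by (auto simp: ntop_def banach_space_def)
  have "M.mcomplete"
    unfolding M.mcomplete_def
  proof (intro allI impI)
    fix s assume s: "M.MCauchy s"
    then have r: "range s \<subseteq> S" by (simp add: M.MCauchy_def)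
    have "sub.MCauchy s"
      using s r unfolding M.MCauchy_def sub.MCauchy_def by (metis eq range_subsetD)
    then obtain l where l: "limitin sub.mtopology s l sequentially"
      using sc unfolding sub.mcomplete_def by blast
    then have "limitin M.mtopology s l sequentially"
      unfolding M.limit_metric_sequentially sub.limit_metric_sequentially by (metis eq)
    then show "\<exists>l. limitin M.mtopology s l sequentially" ..
  qed
  then show ?thesis
    using Z.normed_space_axioms by (simp add: banach_space_def)
qed

section \<open>Bounded operators and functionals\<close>

lemma real_line_simps [simp]:
  "ncar real_line = UNIV" "nzero real_line = 0" "nadd real_line = (+)"
  "nscale real_line = (*)" "nnorm real_line = abs" "nsub real_line = (-)"
  by (auto simp: type_space_def nsub_def fun_eq_iff)

lemma real_line_banach: "banach_space real_line"
  by (rule banach_space_type_space)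

lemma real_line_normed: "normed_space real_line"
  using real_line_banach by (simp add: banach_space_def)

abbreviation ops :: "'a nspace \<Rightarrow> 'b nspace \<Rightarrow> ('a \<Rightarrow> 'b) set" where
  "ops E F \<equiv> ncar (operators E F)"

abbreviation dual :: "'a nspace \<Rightarrow> ('a \<Rightarrow> real) set" where
  "dual E \<equiv> ncar (dual_space E)"

lemma operators_simps:
  "nzero (operators E F) = (\<lambda>x\<in>ncar E. nzero F)"
  "nadd (operators E F) S T = (\<lambda>x\<in>ncar E. nadd F (S x) (T x))"
  "nscale (operators E F) c T = (\<lambda>x\<in>ncar E. nscale F c (T x))"
  "nnorm (operators E F) = op_norm E F"
  by (simp_all add: operators_def map_space_def)

lemma operatorsI:
  assumes "T \<in> extensional (ncar E)"
    and "\<And>x. x \<in> ncar E \<Longrightarrow> T x \<in> ncar F"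
    and "\<And>x y. \<lbrakk>x \<in> ncar E; y \<in> ncar E\<rbrakk> \<Longrightarrow> T (nadd E x y) = nadd F (T x) (T y)"
    and "\<And>c x. x \<in> ncar E \<Longrightarrow> T (nscale E c x) = nscale F c (T x)"
    and "\<And>x. x \<in> ncar E \<Longrightarrow> nnorm F (T x) \<le> C * nnorm E x"
  shows "T \<in> ops E F"
  using assms unfolding operators_def map_space_def linear_maps_def by (auto simp: PiE_def intro!: exI[of _ C])

lemma operatorsD:
  assumes "T \<in> ops E F"
  shows operators_ext: "T \<in> extensional (ncar E)"
    and operators_closed: "\<And>x. x \<in> ncar E \<Longrightarrow> T x \<in> ncar F"
    and operators_add: "\<And>x y. \<lbrakk>x \<in> ncar E; y \<in> ncar E\<rbrakk> \<Longrightarrow> T (nadd E x y) = nadd F (T x) (T y)"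
    and operators_scale: "\<And>c x. x \<in> ncar E \<Longrightarrow> T (nscale E c x) = nscale F c (T x)"
    and operators_bound: "\<exists>C. \<forall>x\<in>ncar E. nnorm F (T x) \<le> C * nnorm E x"
  using assms unfolding operators_def map_space_def linear_maps_def by (auto simp: PiE_def)

lemma operators_sub:
  assumes "T \<in> ops E F" "x \<in> ncar E" "y \<in> ncar E" "pre_normed E"
  shows "T (nsub E x y) = nsub F (T x) (T y)"
  using assms by (simp add: nsub_def operators_add operators_scale pre_normed.scale_closed)

lemma operators_zero:
  assumes T: "T \<in> ops E F" and E: "normed_space E" and F: "normed_space F"
  shows "T (nzero E) = nzero F"
proof -
  have "T (nscale E 0 (nzero E)) = nscale F 0 (T (nzero E))"
    using operators_scale[OF T] normed_space.zero_closed[OF E] .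
  then show ?thesis
    using normed_space.scale_zero_left[OF F] operators_closed[OF T] normed_space.scale_zero_right[OF E]
      normed_space.zero_closed[OF E] by metis
qed

lemma op_norm_le:
  assumes "pre_normed E" and C: "0 \<le> C"
    and le: "\<And>x. x \<in> ncar E \<Longrightarrow> nnorm F (T x) \<le> C * nnorm E x"
  shows "op_norm E F T \<le> C"
  unfolding op_norm_def
proof (rule cSup_least)
  interpret pre_normed E by fact
  show "{nnorm F (T x) |x. x \<in> ncar E \<and> nnorm E x \<le> 1} \<noteq> {}"
    using zero_closed norm_zero by force
  fix r assume "r \<in> {nnorm F (T x) |x. x \<in> ncar E \<and> nnorm E x \<le> 1}"
  then obtain x where "x \<in> ncar E" "nnorm E x \<le> 1" "r = nnorm F (T x)" by blast
  then show "r \<le> C" using le[of x] C mult_left_le by fastforce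
qed

lemma op_norm_bdd:
  assumes E: "pre_normed E" and T: "T \<in> ops E F"
  shows "bdd_above {nnorm F (T x) |x. x \<in> ncar E \<and> nnorm E x \<le> 1}"
proof -
  interpret pre_normed E by fact
  obtain C where C: "\<And>x. x \<in> ncar E \<Longrightarrow> nnorm F (T x) \<le> C * nnorm E x"
    using operators_bound[OF T] by blast
  show ?thesis
  proof (rule bdd_aboveI[of _ "\<bar>C\<bar>"])
    fix r assume "r \<in> {nnorm F (T x) |x. x \<in> ncar E \<and> nnorm E x \<le> 1}"
    then obtain z where z: "z \<in> ncar E" "nnorm E z \<le> 1" "r = nnorm F (T z)" by blast
    have "C * nnorm E z \<le> \<bar>C\<bar> * nnorm E z"
      using norm_nonneg[OF z(1)] by (intro mult_right_mono) auto
    also have "\<dots> \<le> \<bar>C\<bar>" using z(2) by (simp add: mult_left_le)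
    finally show "r \<le> \<bar>C\<bar>" using C[OF z(1)] z(3) by simp
  qed
qed

text \<open>Vectors of norm \<open>0\<close> cannot be normalized; for them the claim comes from the constant \<open>C\<close> in the
  definition of boundedness.\<close>

lemma op_norm_bound:
  assumes E: "pre_normed E" and F: "normed_space F" and T: "T \<in> ops E F" and x: "x \<in> ncar E"
  shows "nnorm F (T x) \<le> op_norm E F T * nnorm E x"
proof -
  interpret pre_normed E by fact
  interpret F: normed_space F by fact
  obtain C where C: "\<And>x. x \<in> ncar E \<Longrightarrow> nnorm F (T x) \<le> C * nnorm E x"
    using operators_bound[OF T] by blast
  show ?thesis
  proof (cases "nnorm E x = 0")
    case True
    then show ?thesis using C[OF x] by simp
  next
    case False
    then have pos: "nnorm E x > 0" using norm_nonneg[OF x] by simp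
    let ?r = "inverse (nnorm E x)"
    let ?y = "nscale E ?r x"
    have y: "?y \<in> ncar E" "nnorm E ?y \<le> 1"
      using scale_closed[OF x] norm_scale_le[OF x, of ?r] pos by auto
    have "nnorm F (T ?y) \<le> op_norm E F T"
      unfolding op_norm_def by (rule cSup_upper[OF _ op_norm_bdd[OF E T]]) (use y in blast)
    moreover have "nnorm F (T ?y) = ?r * nnorm F (T x)"
      using pos unfolding operators_scale[OF T x] F.norm_scale[OF operators_closed[OF T x]] by simp
    ultimately have "?r * nnorm F (T x) \<le> op_norm E F T" by simp
    then show ?thesis using pos by (simp add: field_simps)
  qed
qed

lemma op_norm_nonneg:
  assumes E: "pre_normed E" and F: "normed_space F" and T: "T \<in> ops E F"
  shows "0 \<le> op_norm E F T"
proof -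
  interpret pre_normed E by fact
  have "nnorm F (T (nzero E)) \<le> op_norm E F T"
    unfolding op_norm_def by (rule cSup_upper[OF _ op_norm_bdd[OF E T]]) (use zero_closed norm_zero in force)
  then show ?thesis
    using normed_space.norm_nonneg[OF F operators_closed[OF T zero_closed]] by linarith
qed

lemma compose_operators:
  assumes E: "pre_normed E" and F: "pre_normed F" and G: "normed_space G"
    and S: "S \<in> ops E F" and T: "T \<in> ops F G"
  shows "compose (ncar E) T S \<in> ops E G"
proof -
  obtain C where C: "\<And>x. x \<in> ncar E \<Longrightarrow> nnorm F (S x) \<le> C * nnorm E x"
    using operators_bound[OF S] by blast
  show ?thesis
  proof (rule operatorsI)
    show "compose (ncar E) T S \<in> extensional (ncar E)" by simp
    show "nnorm G (compose (ncar E) T S x) \<le> (op_norm F G T * C) * nnorm E x"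
      if "x \<in> ncar E" for x
    proof -
      have "nnorm G (T (S x)) \<le> op_norm F G T * nnorm F (S x)"
        using op_norm_bound[OF F G T] operators_closed[OF S that] .
      also have "\<dots> \<le> op_norm F G T * (C * nnorm E x)"
        by (intro mult_left_mono C that op_norm_nonneg[OF F G T])
      finally show ?thesis using that by (simp add: compose_def mult.assoc)
    qed
  qed (use E in \<open>auto simp: compose_def operators_closed[OF S] operators_closed[OF T] operators_add[OF S] operators_add[OF T]
      operators_scale[OF S] operators_scale[OF T] pre_normed.add_closed pre_normed.scale_closed\<close>)
qed

lemma dual_simps:
  "nzero (dual_space E) = (\<lambda>x\<in>ncar E. 0)"
  "nadd (dual_space E) \<phi> \<psi> = (\<lambda>x\<in>ncar E. \<phi> x + \<psi> x)"
  "nscale (dual_space E) c \<phi> = (\<lambda>x\<in>ncar E. c * \<phi> x)"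
  "nnorm (dual_space E) = op_norm E real_line"
  by (simp_all add: dual_space_def operators_simps)

lemma dual_nsub:
  "pre_normed E \<Longrightarrow> nsub (dual_space E) \<phi> \<psi> = (\<lambda>x\<in>ncar E. \<phi> x - \<psi> x)"
  by (auto simp: nsub_def dual_simps fun_eq_iff)

lemma dualI:
  assumes "\<phi> \<in> extensional (ncar E)"
    and "\<And>x y. \<lbrakk>x \<in> ncar E; y \<in> ncar E\<rbrakk> \<Longrightarrow> \<phi> (nadd E x y) = \<phi> x + \<phi> y"
    and "\<And>c x. x \<in> ncar E \<Longrightarrow> \<phi> (nscale E c x) = c * \<phi> x"
    and "\<And>x. x \<in> ncar E \<Longrightarrow> \<bar>\<phi> x\<bar> \<le> C * nnorm E x"
  shows "\<phi> \<in> dual E"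
  unfolding dual_space_def by (rule operatorsI[where C = C]) (use assms in auto)

lemma dualD:
  assumes "\<phi> \<in> dual E"
  shows dual_ext: "\<phi> \<in> extensional (ncar E)"
    and dual_add: "\<And>x y. \<lbrakk>x \<in> ncar E; y \<in> ncar E\<rbrakk> \<Longrightarrow> \<phi> (nadd E x y) = \<phi> x + \<phi> y"
    and dual_scale: "\<And>c x. x \<in> ncar E \<Longrightarrow> \<phi> (nscale E c x) = c * \<phi> x"
  using assms operators_ext operators_add operators_scale unfolding dual_space_def by fastforce+

lemma dual_sub:
  "\<lbrakk>\<phi> \<in> dual E; x \<in> ncar E; y \<in> ncar E; pre_normed E\<rbrakk> \<Longrightarrow> \<phi> (nsub E x y) = \<phi> x - \<phi> y"
  unfolding dual_space_def by (subst operators_sub) auto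

lemma dual_bound:
  "\<lbrakk>pre_normed E; \<phi> \<in> dual E; x \<in> ncar E\<rbrakk> \<Longrightarrow> \<bar>\<phi> x\<bar> \<le> nnorm (dual_space E) \<phi> * nnorm E x"
  using op_norm_bound[OF _ real_line_normed, of E \<phi> x] by (simp add: dual_simps(4)) (simp add: dual_space_def)

lemma dual_norm_le:
  "\<lbrakk>pre_normed E; 0 \<le> C; \<And>x. x \<in> ncar E \<Longrightarrow> \<bar>\<phi> x\<bar> \<le> C * nnorm E x\<rbrakk> \<Longrightarrow> nnorm (dual_space E) \<phi> \<le> C"
  unfolding dual_simps by (rule op_norm_le) auto

lemma dual_norm_nonneg: "\<lbrakk>pre_normed E; \<phi> \<in> dual E\<rbrakk> \<Longrightarrow> 0 \<le> nnorm (dual_space E) \<phi>"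
  using op_norm_nonneg[OF _ real_line_normed, of E \<phi>] by (simp add: dual_simps(4)) (simp add: dual_space_def)

lemma dual_eqI:
  "\<lbrakk>\<phi> \<in> dual E; \<psi> \<in> dual E; \<And>x. x \<in> ncar E \<Longrightarrow> \<phi> x = \<psi> x\<rbrakk> \<Longrightarrow> \<phi> = \<psi>"
  using dual_ext extensionalityI by metis

lemma dual_normed:
  assumes E: "pre_normed E"
  shows "normed_space (dual_space E)"
proof -
  interpret pre_normed E by fact
  let ?D = "dual_space E"
  note bound = dual_bound[OF E] and nn = dual_norm_nonneg[OF E]
  have zero: "nzero ?D \<in> ncar ?D"
    by (rule dualI[where C = 0]) (auto simp: dual_simps add_closed scale_closed)
  have add: "nadd ?D \<phi> \<psi> \<in> ncar ?D \<and> nnorm ?D (nadd ?D \<phi> \<psi>) \<le> nnorm ?D \<phi> + nnorm ?D \<psi>"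
    if "\<phi> \<in> ncar ?D" "\<psi> \<in> ncar ?D" for \<phi> \<psi>
  proof -
    have le: "\<bar>nadd ?D \<phi> \<psi> x\<bar> \<le> (nnorm ?D \<phi> + nnorm ?D \<psi>) * nnorm E x" if x: "x \<in> ncar E" for x
      using bound[OF \<open>\<phi> \<in> ncar ?D\<close> x] bound[OF \<open>\<psi> \<in> ncar ?D\<close> x] x
      by (simp add: dual_simps algebra_simps)
    have "nadd ?D \<phi> \<psi> \<in> ncar ?D"
    proof (rule dualI[OF _ _ _ le])
    qed (use that in \<open>auto simp: dual_simps extensional_def add_closed scale_closed dual_add dual_scale algebra_simps\<close>)
    moreover have "nnorm ?D (nadd ?D \<phi> \<psi>) \<le> nnorm ?D \<phi> + nnorm ?D \<psi>"
      by (intro dual_norm_le[OF E] add_nonneg_nonneg nn that le)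
    ultimately show ?thesis ..
  qed
  have scale_le: "nscale ?D c \<phi> \<in> ncar ?D \<and> nnorm ?D (nscale ?D c \<phi>) \<le> \<bar>c\<bar> * nnorm ?D \<phi>"
    if "\<phi> \<in> ncar ?D" for c \<phi>
  proof -
    have le: "\<bar>nscale ?D c \<phi> x\<bar> \<le> (\<bar>c\<bar> * nnorm ?D \<phi>) * nnorm E x" if x: "x \<in> ncar E" for x
      using mult_left_mono[OF bound[OF \<open>\<phi> \<in> ncar ?D\<close> x], of "\<bar>c\<bar>"] x
      by (simp add: dual_simps abs_mult mult.assoc)
    have "nscale ?D c \<phi> \<in> ncar ?D"
    proof (rule dualI[OF _ _ _ le])
    qed (use that in \<open>auto simp: dual_simps extensional_def add_closed scale_closed dual_add dual_scale algebra_simps\<close>)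
    moreover have "nnorm ?D (nscale ?D c \<phi>) \<le> \<bar>c\<bar> * nnorm ?D \<phi>"
      by (intro dual_norm_le[OF E] mult_nonneg_nonneg nn that le) auto
    ultimately show ?thesis ..
  qed
  have ss: "nscale ?D c (nscale ?D d \<phi>) = nscale ?D (c * d) \<phi>" for c d \<phi>
    by (auto simp: dual_simps)
  have one: "nscale ?D 1 \<phi> = \<phi>" if "\<phi> \<in> ncar ?D" for \<phi>
    using dual_ext[OF that] by (auto simp: dual_simps extensional_def)
  have scale: "nnorm ?D (nscale ?D c \<phi>) = \<bar>c\<bar> * nnorm ?D \<phi>" if \<phi>: "\<phi> \<in> ncar ?D" for c \<phi>
  proof (cases "c = 0")
    case True
    then show ?thesis using scale_le[OF \<phi>, of 0] nn[of "nscale ?D 0 \<phi>"] by simp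
  next
    case False
    have "nnorm ?D (nscale ?D (inverse c) (nscale ?D c \<phi>)) \<le> \<bar>inverse c\<bar> * nnorm ?D (nscale ?D c \<phi>)"
      using scale_le[of "nscale ?D c \<phi>"] scale_le[OF \<phi>] by blast
    then have "nnorm ?D \<phi> \<le> \<bar>inverse c\<bar> * nnorm ?D (nscale ?D c \<phi>)"
      using False one[OF \<phi>] by (simp add: ss)
    then have "\<bar>c\<bar> * nnorm ?D \<phi> \<le> nnorm ?D (nscale ?D c \<phi>)"
      using False by (simp add: field_simps)
    then show ?thesis using scale_le[OF \<phi>, of c] by simp
  qed
  have eq0: "nnorm ?D \<phi> = 0 \<longleftrightarrow> \<phi> = nzero ?D" if \<phi>: "\<phi> \<in> ncar ?D" for \<phi>
  proof
    assume "nnorm ?D \<phi> = 0"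
    then have "\<phi> x = nzero ?D x" if "x \<in> ncar E" for x
      using bound[OF \<phi> that] that by (simp add: dual_simps)
    then show "\<phi> = nzero ?D" by (rule dual_eqI[OF \<phi> zero])
  next
    assume "\<phi> = nzero ?D"
    moreover have "nnorm ?D (nzero ?D) \<le> 0"
      by (rule dual_norm_le[OF E]) (auto simp: dual_simps)
    ultimately show "nnorm ?D \<phi> = 0" using nn[OF \<phi>] by simp
  qed
  show ?thesis
  proof unfold_locales
    fix \<phi> assume "\<phi> \<in> ncar ?D"
    then show "nadd ?D \<phi> (nzero ?D) = \<phi>"
      using dual_ext by (fastforce simp: dual_simps extensional_def)
  qed (use zero add scale_le ss one scale eq0 nn in \<open>auto simp: dual_simps algebra_simps\<close>)
qed

text \<open>A Cauchy sequence of functionals converges pointwise; the estimate of its differences passes to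
  the limit, which is therefore bounded and is the limit in norm.\<close>

lemma dual_banach:
  assumes E: "pre_normed E"
  shows "banach_space (dual_space E)"
proof -
  interpret pre_normed E by fact
  let ?D = "dual_space E"
  interpret D: normed_space ?D by (rule dual_normed[OF E])
  interpret M: Metric_space "ncar ?D" "ndist ?D" by (rule D.metric)
  have "M.mcomplete"
    unfolding M.mcomplete_def
  proof (intro allI impI)
    fix s assume s: "M.MCauchy s"
    then have sD: "s n \<in> ncar ?D" for n by (auto simp: M.MCauchy_def)
    have cauchy: "\<exists>N. \<forall>m\<ge>N. \<forall>n\<ge>N. \<forall>x\<in>ncar E. \<bar>s m x - s n x\<bar> \<le> e * nnorm E x" if "e > 0" for e
    proof -
      obtain N where N: "\<And>m n. \<lbrakk>N \<le> m; N \<le> n\<rbrakk> \<Longrightarrow> ndist ?D (s m) (s n) < e"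
        using s \<open>e > 0\<close> unfolding M.MCauchy_def by meson
      have "\<bar>s m x - s n x\<bar> \<le> e * nnorm E x" if mn: "m \<ge> N" "n \<ge> N" and x: "x \<in> ncar E" for m n x
      proof -
        have "\<bar>nsub ?D (s m) (s n) x\<bar> \<le> nnorm ?D (nsub ?D (s m) (s n)) * nnorm E x"
          using dual_bound[OF E] D.sub_closed sD x by blast
        also have "\<dots> \<le> e * nnorm E x"
          using N[OF mn] x by (intro mult_right_mono norm_nonneg) (auto simp: D.ndist_eq sD)
        finally show ?thesis using x by (simp add: dual_nsub[OF E])
      qed
      then show ?thesis by blast
    qed
    define l where "l = (\<lambda>x\<in>ncar E. lim (\<lambda>n. s n x))"
    have lim: "(\<lambda>n. s n x) \<longlonglongrightarrow> l x" if x: "x \<in> ncar E" for x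
    proof -
      have "Cauchy (\<lambda>n. s n x)"
      proof (rule CauchyI)
        fix e :: real assume e: "e > 0"
        define d where "d = e / (nnorm E x + 1)"
        have nx: "0 \<le> nnorm E x" using norm_nonneg[OF x] .
        have d: "d > 0" using e nx by (simp add: d_def)
        have "d * nnorm E x < d * (nnorm E x + 1)" using d by simp
        also have "\<dots> = e" using nx by (simp add: d_def)
        finally have "d * nnorm E x < e" .
        with cauchy[OF d] x show "\<exists>N. \<forall>m\<ge>N. \<forall>n\<ge>N. norm (s m x - s n x) < e"
          by (metis le_less_trans real_norm_def)
      qed
      then show ?thesis using x by (simp add: l_def Cauchy_convergent_iff convergent_LIMSEQ_iff)
    qed
    have close: "\<exists>N. \<forall>n\<ge>N. \<forall>x\<in>ncar E. \<bar>s n x - l x\<bar> \<le> e * nnorm E x" if "e > 0" for e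
    proof -
      obtain N where N: "\<And>m n x. \<lbrakk>m \<ge> N; n \<ge> N; x \<in> ncar E\<rbrakk> \<Longrightarrow> \<bar>s m x - s n x\<bar> \<le> e * nnorm E x"
        using cauchy[OF \<open>e > 0\<close>] by blast
      have "\<bar>s n x - l x\<bar> \<le> e * nnorm E x" if "n \<ge> N" "x \<in> ncar E" for n x
      proof (rule tendsto_le[OF _ tendsto_const])
        show "(\<lambda>m. \<bar>s n x - s m x\<bar>) \<longlonglongrightarrow> \<bar>s n x - l x\<bar>"
          by (intro tendsto_intros lim that)
        show "\<forall>\<^sub>F m in sequentially. \<bar>s n x - s m x\<bar> \<le> e * nnorm E x"
          using N that by (auto simp: eventually_sequentially)
      qed simp
      then show ?thesis by blast
    qed
    obtain N where N: "\<And>x. x \<in> ncar E \<Longrightarrow> \<bar>s N x - l x\<bar> \<le> nnorm E x"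
      using close[of 1] by auto
    have l: "l \<in> ncar ?D"
    proof (rule dualI)
      show "l \<in> extensional (ncar E)" by (simp add: l_def)
      show "l (nadd E x y) = l x + l y" if "x \<in> ncar E" "y \<in> ncar E" for x y
      proof (rule LIMSEQ_unique[OF lim])
        show "(\<lambda>n. s n (nadd E x y)) \<longlonglongrightarrow> l x + l y"
          using tendsto_add[OF lim[OF that(1)] lim[OF that(2)]] that
          by (simp add: dual_add[OF sD])
      qed (simp add: add_closed that)
      show "l (nscale E c x) = c * l x" if "x \<in> ncar E" for c x
      proof (rule LIMSEQ_unique[OF lim])
        show "(\<lambda>n. s n (nscale E c x)) \<longlonglongrightarrow> c * l x"
          using tendsto_mult_left[OF lim[OF that], of c] that by (simp add: dual_scale[OF sD])
      qed (simp add: scale_closed that)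
      show "\<bar>l x\<bar> \<le> (nnorm ?D (s N) + 1) * nnorm E x" if x: "x \<in> ncar E" for x
        using N[OF x] dual_bound[OF E sD x, of N] by (simp add: algebra_simps)
    qed
    have "limitin (ntop ?D) s l sequentially"
      unfolding D.limit_iff
    proof (intro conjI allI impI l)
      fix e :: real assume "e > 0"
      then obtain N where N: "\<And>n x. \<lbrakk>n \<ge> N; x \<in> ncar E\<rbrakk> \<Longrightarrow> \<bar>s n x - l x\<bar> \<le> e/2 * nnorm E x"
        using close[of "e/2"] by auto
      have "nnorm ?D (nsub ?D (s n) l) \<le> e/2" if "n \<ge> N" for n
        by (rule dual_norm_le[OF E]) (use N[OF that] \<open>e > 0\<close> in \<open>auto simp: dual_nsub[OF E]\<close>)
      then show "\<forall>\<^sub>F n in sequentially. s n \<in> ncar ?D \<and> nnorm ?D (nsub ?D (s n) l) < e"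
        unfolding eventually_sequentially using \<open>e > 0\<close> sD by (intro exI[of _ N]) force
    qed
    then show "\<exists>l. limitin M.mtopology s l sequentially" by (auto simp: ntop_def)
  qed
  then show ?thesis by (simp add: banach_space_def D.normed_space_axioms)
qed

text \<open>The kernel of a functional on a closed subspace \<open>G\<close> is closed in the whole space. This is used for
  \<open>G = \<FF>(X)\<close>, whose span is closed up in \<open>Lip\<^sub>0(X)\<^sup>*\<close>, and for \<open>\<FF>(M)\<close>, whose span is closed up in
  \<open>G = \<FF>(X)\<close> itself.\<close>

lemma functional_vanishes_on_closed_span:
  assumes V: "normed_space V" and G: "lin_subspace V G" "closedin (ntop V) G" and S: "S \<subseteq> G"
    and \<phi>: "\<phi> \<in> dual (sub_space V G)" and zero: "\<And>s. s \<in> S \<Longrightarrow> \<phi> s = 0"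
    and v: "v \<in> closed_span V S"
  shows "\<phi> v = 0"
proof -
  interpret normed_space V by fact
  interpret G: normed_space "sub_space V G" by (rule sub_space_normed[OF G(1)])
  let ?K = "{v \<in> G. \<phi> v = 0}"
  have GV: "G \<subseteq> ncar V" using G by (simp add: lin_subspace_def)
  have "closed_span V S \<subseteq> ?K"
  proof (rule closed_span_minimal)
    show "lin_subspace V ?K"
      unfolding lin_subspace_def
    proof (intro conjI ballI allI)
      have "nscale V 0 (nzero V) = nzero V" by (rule scale_zero_right)
      then show "nzero V \<in> ?K" using G(1) dual_scale[OF \<phi>, of "nzero V" 0] by (simp add: lin_subspace_def)
    qed (use G(1) dual_add[OF \<phi>] dual_scale[OF \<phi>] in \<open>auto simp: lin_subspace_def\<close>)
    show "closedin (ntop V) ?K"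
    proof (subst closedin_iff)
      show "\<forall>x\<in>ncar V. (\<forall>e>0. \<exists>y\<in>?K. nnorm V (nsub V x y) < e) \<longrightarrow> x \<in> ?K"
      proof (intro ballI impI)
        fix x assume x: "x \<in> ncar V" and near: "\<forall>e>0. \<exists>y\<in>?K. nnorm V (nsub V x y) < e"
        then have xG: "x \<in> G" using G(2) unfolding closedin_iff[OF GV] by blast
        let ?n = "nnorm (dual_space (sub_space V G)) \<phi>"
        have "\<bar>\<phi> x\<bar> \<le> e" if "e > 0" for e
        proof -
          have n0: "?n \<ge> 0" by (rule dual_norm_nonneg[OF G.pre_normed \<phi>])
          then have "e / (?n + 1) > 0" using that by simp
          then obtain y where y: "y \<in> G" "\<phi> y = 0" "nnorm V (nsub V x y) < e / (?n + 1)"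
            using near by blast
          have sub: "nsub V x y \<in> G" using G.sub_closed xG y(1) by simp
          have "\<bar>\<phi> x\<bar> = \<bar>\<phi> (nsub V x y)\<bar>"
            using dual_sub[OF \<phi>, of x y] xG y G.pre_normed by simp
          also have "\<dots> \<le> ?n * nnorm V (nsub V x y)"
            using dual_bound[OF G.pre_normed \<phi>] sub by simp
          also have "\<dots> \<le> (?n + 1) * nnorm V (nsub V x y)"
            using norm_nonneg sub GV by (simp add: mult_right_mono subset_iff)
          also have "\<dots> \<le> e" using y(3) n0 by (simp add: pos_less_divide_eq mult.commute)
          finally show ?thesis .
        qed
        then have "\<bar>\<phi> x\<bar> \<le> 0" by (rule field_le_epsilon[of _ 0, simplified])
        then show "x \<in> ?K" using xG by simp
      qed
    qed (use GV in auto)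
  qed (use S zero in auto)
  with v show ?thesis by blast
qed

lemma adjoint_apply:
  "\<lbrakk>\<phi> \<in> dual F; x \<in> ncar E\<rbrakk> \<Longrightarrow> adjoint_op E F T \<phi> x = \<phi> (T x)"
  by (simp add: adjoint_op_def)

lemma functional_compose:
  assumes E: "pre_normed E" and F: "pre_normed F" and T: "T \<in> ops E F"
    and \<phi>: "\<phi> \<in> dual F"
  shows "(\<lambda>x\<in>ncar E. \<phi> (T x)) \<in> dual E"
  using compose_operators[OF E F real_line_normed T \<phi>[unfolded dual_space_def]]
  by (simp add: compose_def dual_space_def)

lemma adjoint_operator:
  assumes E: "pre_normed E" and F: "normed_space F" and T: "T \<in> ops E F"
  shows "adjoint_op E F T \<in> ops (dual_space F) (dual_space E)"
proof -
  interpret F: normed_space F by fact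
  interpret FD: normed_space "dual_space F" by (rule dual_normed[OF F.pre_normed])
  note T0 = operators_closed[OF T]
  have cl: "adjoint_op E F T \<phi> \<in> dual E" if "\<phi> \<in> dual F" for \<phi>
    using functional_compose[OF E F.pre_normed T that] that by (simp add: adjoint_op_def)
  show ?thesis
  proof (rule operatorsI[where C = "op_norm E F T"])
    show "nnorm (dual_space E) (adjoint_op E F T \<phi>) \<le> op_norm E F T * nnorm (dual_space F) \<phi>"
      if \<phi>: "\<phi> \<in> dual F" for \<phi>
    proof (rule dual_norm_le[OF E])
      show "0 \<le> op_norm E F T * nnorm (dual_space F) \<phi>"
        by (intro mult_nonneg_nonneg op_norm_nonneg[OF E F T] FD.norm_nonneg \<phi>)
      fix x assume x: "x \<in> ncar E"
      have "\<bar>\<phi> (T x)\<bar> \<le> nnorm (dual_space F) \<phi> * nnorm F (T x)"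
        by (rule dual_bound[OF F.pre_normed \<phi> T0[OF x]])
      also have "\<dots> \<le> nnorm (dual_space F) \<phi> * (op_norm E F T * nnorm E x)"
        by (intro mult_left_mono op_norm_bound[OF E F T x] FD.norm_nonneg \<phi>)
      finally show "\<bar>adjoint_op E F T \<phi> x\<bar> \<le> op_norm E F T * nnorm (dual_space F) \<phi> * nnorm E x"
        using x \<phi> by (simp add: adjoint_apply mult_ac)
    qed
    show "adjoint_op E F T (nadd (dual_space F) \<phi> \<psi>)
        = nadd (dual_space E) (adjoint_op E F T \<phi>) (adjoint_op E F T \<psi>)"
      if "\<phi> \<in> dual F" "\<psi> \<in> dual F" for \<phi> \<psi>
      using that FD.add_closed[OF that] T0 by (auto simp: adjoint_op_def dual_simps)
    show "adjoint_op E F T (nscale (dual_space F) c \<phi>) = nscale (dual_space E) c (adjoint_op E F T \<phi>)"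
      if "\<phi> \<in> dual F" for c \<phi>
      using that FD.scale_closed[OF that] T0 by (auto simp: adjoint_op_def dual_simps)
  qed (use cl in \<open>auto simp: adjoint_op_def\<close>)
qed

section \<open>The Hahn-Banach theorem\<close>

definition sublinear :: "'a nspace \<Rightarrow> ('a \<Rightarrow> real) \<Rightarrow> bool" where
  "sublinear E q \<longleftrightarrow> q \<in> extensional (ncar E) \<and>
     (\<forall>x\<in>ncar E. \<forall>y\<in>ncar E. q (nadd E x y) \<le> q x + q y) \<and>
     (\<forall>x\<in>ncar E. \<forall>c\<ge>0. q (nscale E c x) = c * q x) \<and>
     (\<forall>x\<in>ncar E. q x \<le> nnorm E x)"

text \<open>The largest sublinear functional below \<open>q\<close> that is at most \<open>- q y\<close> at \<open>- y\<close>. It serves twice: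
  it starts the construction with a functional that forces \<open>\<phi> y = \<parallel>y\<parallel>\<close>, and it shows that a minimal
  sublinear functional is additive.\<close>

definition tilt :: "'a nspace \<Rightarrow> 'a \<Rightarrow> ('a \<Rightarrow> real) \<Rightarrow> 'a \<Rightarrow> real" where
  "tilt E y q = (\<lambda>x\<in>ncar E. INF t\<in>{0..}. q (nadd E x (nscale E t y)) - t * q y)"

context normed_space
begin

lemma sublinear_lower:
  assumes q: "sublinear E q" and x: "x \<in> ncar E"
  shows "- nnorm E x \<le> q x"
proof -
  have "q (nadd E x (nscale E (-1) x)) \<le> q x + q (nscale E (-1) x)"
    using q x scale_closed by (simp add: sublinear_def)
  moreover have "q (nzero E) = 0"
    using q x zero_closed scale_zero_left[OF x] by (metis mult_zero_left order_refl sublinear_def)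
  moreover have "q (nscale E (-1) x) \<le> nnorm E x"
    using q scale_closed[OF x, of "-1"] norm_scale[OF x, of "-1"] by (fastforce simp: sublinear_def)
  ultimately show ?thesis by (simp add: add_neg x)
qed

lemma tilt_lower:
  assumes q: "sublinear E q" and x: "x \<in> ncar E" and y: "y \<in> ncar E" and t: "t \<ge> 0"
  shows "- nnorm E x \<le> q (nadd E x (nscale E t y)) - t * q y"
proof -
  have ty: "nscale E t y \<in> ncar E" using y by (rule scale_closed)
  have "nscale E t y = nadd E (nadd E x (nscale E t y)) (nscale E (-1) x)"
    using x ty by (metis add_assoc add_commute add_neg add_zero scale_closed)
  then have "q (nscale E t y) \<le> q (nadd E x (nscale E t y)) + q (nscale E (-1) x)"
    using q x ty add_closed scale_closed unfolding sublinear_def by metis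
  moreover have "q (nscale E t y) = t * q y" using q y t by (simp add: sublinear_def)
  moreover have "q (nscale E (-1) x) \<le> nnorm E x"
    using q scale_closed[OF x, of "-1"] norm_scale[OF x, of "-1"] by (fastforce simp: sublinear_def)
  ultimately show ?thesis by linarith
qed

lemma tilt_le:
  assumes q: "sublinear E q" and x: "x \<in> ncar E" and y: "y \<in> ncar E" and t: "t \<ge> 0"
  shows "tilt E y q x \<le> q (nadd E x (nscale E t y)) - t * q y"
proof -
  have "(INF t\<in>{0..}. q (nadd E x (nscale E t y)) - t * q y) \<le> q (nadd E x (nscale E t y)) - t * q y"
    by (rule cINF_lower[OF bdd_belowI2[where m = "- nnorm E x"]]) (use tilt_lower[OF q x y] t in auto)
  then show ?thesis using x by (simp add: tilt_def)
qed

lemma le_tilt: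
  assumes "x \<in> ncar E" and "\<And>t. t \<ge> 0 \<Longrightarrow> a \<le> q (nadd E x (nscale E t y)) - t * q y"
  shows "a \<le> tilt E y q x"
  using assms by (auto simp: tilt_def intro!: cINF_greatest)

lemma tilt_le_self:
  assumes "sublinear E q" "x \<in> ncar E" "y \<in> ncar E"
  shows "tilt E y q x \<le> q x"
  using tilt_le[OF assms, of 0] assms by (simp add: scale_zero_left add_zero)

lemma sublinear_tilt:
  assumes q: "sublinear E q" and y: "y \<in> ncar E"
  shows "sublinear E (tilt E y q)"
  unfolding sublinear_def
proof (intro conjI ballI allI impI)
  show "tilt E y q \<in> extensional (ncar E)" by (simp add: tilt_def)
  show "tilt E y q x \<le> nnorm E x" if "x \<in> ncar E" for x
    using tilt_le_self[OF q that y] q that by (force simp: sublinear_def)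
next
  fix a b assume ab: "a \<in> ncar E" "b \<in> ncar E"
  have 1: "tilt E y q (nadd E a b) \<le> (q (nadd E a (nscale E s y)) - s * q y) + (q (nadd E b (nscale E t y)) - t * q y)"
    if st: "s \<ge> 0" "t \<ge> 0" for s t
  proof -
    have sy: "nscale E s y \<in> ncar E" and ty: "nscale E t y \<in> ncar E" using y by (auto intro: scale_closed)
    have "nadd E (nadd E a b) (nscale E (s + t) y) = nadd E (nadd E a (nscale E s y)) (nadd E b (nscale E t y))"
      using ab y sy ty by (simp add: scale_add_left add_assoc add_closed add_left_commute)
    then have "q (nadd E (nadd E a b) (nscale E (s + t) y)) \<le> q (nadd E a (nscale E s y)) + q (nadd E b (nscale E t y))"
      using q ab sy ty by (simp add: sublinear_def add_closed)
    then show ?thesis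
      using tilt_le[OF q add_closed[OF ab] y, of "s + t"] st by (simp add: algebra_simps)
  qed
  have 2: "tilt E y q (nadd E a b) - (q (nadd E b (nscale E t y)) - t * q y) \<le> tilt E y q a"
    if "t \<ge> 0" for t
    by (rule le_tilt[OF ab(1)]) (use 1 that in \<open>fastforce simp: algebra_simps\<close>)
  have "tilt E y q (nadd E a b) - tilt E y q a \<le> tilt E y q b"
    by (rule le_tilt[OF ab(2)]) (use 2 in \<open>fastforce simp: algebra_simps\<close>)
  then show "tilt E y q (nadd E a b) \<le> tilt E y q a + tilt E y q b" by simp
next
  fix x c assume x: "x \<in> ncar E" and c: "(0::real) \<le> c"
  have le: "tilt E y q (nscale E d z) \<le> d * tilt E y q z" if z: "z \<in> ncar E" and d: "d > 0" for z d
  proof -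
    have "tilt E y q (nscale E d z) / d \<le> tilt E y q z"
    proof (rule le_tilt[OF z])
      fix t :: real assume t: "t \<ge> 0"
      have "nadd E (nscale E d z) (nscale E (d * t) y) = nscale E d (nadd E z (nscale E t y))"
        using z y by (simp add: scale_add_right scale_closed scale_scale)
      then have "tilt E y q (nscale E d z) \<le> d * q (nadd E z (nscale E t y)) - d * t * q y"
        using tilt_le[OF q scale_closed[OF z, of d] y, of "d * t"] d t q add_closed[OF z scale_closed[OF y, of t]]
        by (simp add: sublinear_def)
      also have "\<dots> = d * (q (nadd E z (nscale E t y)) - t * q y)" by (simp add: algebra_simps)
      finally show "tilt E y q (nscale E d z) / d \<le> q (nadd E z (nscale E t y)) - t * q y"
        using d by (simp add: field_simps)
    qed
    then show ?thesis using d by (simp add: field_simps)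
  qed
  show "tilt E y q (nscale E c x) = c * tilt E y q x"
  proof (cases "c = 0")
    case True
    have z0: "q (nzero E) = 0"
      using q x scale_zero_left[OF x] by (metis mult_zero_left order_refl sublinear_def)
    have "0 \<le> tilt E y q (nzero E)"
      by (rule le_tilt[OF zero_closed]) (use q y in \<open>simp add: zero_add scale_closed sublinear_def\<close>)
    moreover have "tilt E y q (nzero E) \<le> 0"
      using tilt_le_self[OF q zero_closed y] z0 by simp
    ultimately show ?thesis using True x by (simp add: scale_zero_left)
  next
    case False
    then have c: "c > 0" using c by simp
    have "tilt E y q (nscale E (inverse c) (nscale E c x)) \<le> inverse c * tilt E y q (nscale E c x)"
      using c by (intro le scale_closed x) auto
    then have "c * tilt E y q x \<le> tilt E y q (nscale E c x)"
      using c x by (simp add: scale_scale scale_one field_simps)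
    then show ?thesis using le[OF x c] by simp
  qed
qed

text \<open>Zorn's lemma. The infimum of a chain exists because every member is at least \<open>- \<parallel>x\<parallel>\<close> at \<open>x\<close>, and it is
  subadditive because any two members of the chain have a common lower bound among them.\<close>

lemma minimal_sublinear_below:
  assumes p: "sublinear E p"
  obtains q where "sublinear E q" "\<And>x. x \<in> ncar E \<Longrightarrow> q x \<le> p x"
    "\<And>r. \<lbrakk>sublinear E r; \<And>x. x \<in> ncar E \<Longrightarrow> r x \<le> q x\<rbrakk> \<Longrightarrow> r = q"
proof -
  let ?A = "{q. sublinear E q \<and> (\<forall>x\<in>ncar E. q x \<le> p x)}"
  let ?P = "\<lambda>f g. \<forall>x\<in>ncar E. g x \<le> (f x :: real)"
  have ext: "f = g" if "sublinear E f" "sublinear E g" "\<And>x. x \<in> ncar E \<Longrightarrow> f x = g x" for f g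
    using that by (auto simp: sublinear_def intro: extensionalityI)
  have "\<exists>m\<in>?A. \<forall>a\<in>?A. ?P m a \<longrightarrow> a = m"
  proof (rule predicate_Zorn)
    show "partial_order_on ?A (relation_of ?P ?A)"
      unfolding partial_order_on_def preorder_on_def
    proof (intro conjI)
      show "relation_of ?P ?A \<subseteq> ?A \<times> ?A" by (auto simp: relation_of_def)
      show "refl_on ?A (relation_of ?P ?A)" by (auto simp: refl_on_def relation_of_def)
      show "trans (relation_of ?P ?A)"
        by (rule transI) (auto simp: relation_of_def intro: order_trans)
      show "antisym (relation_of ?P ?A)"
        by (rule antisymI, rule ext) (auto simp: relation_of_def intro: order.antisym)
    qed
  next
    fix C assume C: "C \<in> Chains (relation_of ?P ?A)"
    then have CA: "C \<subseteq> ?A" by (auto simp: Chains_def relation_of_def)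
    have chain: "(\<forall>x\<in>ncar E. f x \<le> g x) \<or> (\<forall>x\<in>ncar E. g x \<le> f x)" if "f \<in> C" "g \<in> C" for f g
      using C that by (auto simp: Chains_def relation_of_def)
    show "\<exists>u\<in>?A. \<forall>a\<in>C. ?P a u"
    proof (cases "C = {}")
      case True
      then show ?thesis using p by auto
    next
      case False
      define u where "u = (\<lambda>x\<in>ncar E. INF f\<in>C. f x)"
      have u_le: "u x \<le> f x" if "f \<in> C" "x \<in> ncar E" for f x
      proof -
        have "(INF f\<in>C. f x) \<le> f x"
          by (rule cINF_lower[OF bdd_belowI2[where m = "- nnorm E x"]])
            (use CA sublinear_lower that in auto)
        then show ?thesis using that by (simp add: u_def)
      qed
      have le_u: "a \<le> u x" if "x \<in> ncar E" "\<And>f. f \<in> C \<Longrightarrow> a \<le> f x" for a x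
        using that False by (auto simp: u_def intro!: cINF_greatest)
      have sl: "sublinear E f" if "f \<in> C" for f using CA that by blast
      have "sublinear E u"
        unfolding sublinear_def
      proof (intro conjI ballI allI impI)
        show "u \<in> extensional (ncar E)" by (simp add: u_def)
        obtain f where "f \<in> C" using False by blast
        then have "f x \<le> nnorm E x" "u x \<le> f x" if "x \<in> ncar E" for x
          using u_le sl that by (auto simp: sublinear_def)
        then show "u x \<le> nnorm E x" if "x \<in> ncar E" for x
          using that by (meson order_trans)
      next
        fix x y assume xy: "x \<in> ncar E" "y \<in> ncar E"
        have fg: "u (nadd E x y) \<le> f x + g y" if "f \<in> C" "g \<in> C" for f g
        proof -
          obtain h where h: "h \<in> C" "h x \<le> f x" "h y \<le> g y"
            using chain[OF \<open>f \<in> C\<close> \<open>g \<in> C\<close>] \<open>f \<in> C\<close> \<open>g \<in> C\<close> xy by (metis order_refl)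
          have "u (nadd E x y) \<le> h (nadd E x y)" by (rule u_le[OF h(1) add_closed[OF xy]])
          also have "\<dots> \<le> h x + h y" using sl[OF h(1)] xy by (simp add: sublinear_def)
          finally show ?thesis using h by linarith
        qed
        have "u (nadd E x y) - g y \<le> u x" if "g \<in> C" for g
          by (rule le_u[OF xy(1)]) (use fg that in \<open>fastforce simp: algebra_simps\<close>)
        then have "u (nadd E x y) - u x \<le> u y"
          by (intro le_u[OF xy(2)]) (fastforce simp: algebra_simps)
        then show "u (nadd E x y) \<le> u x + u y" by simp
      next
        fix x c assume x: "x \<in> ncar E" and c: "(0::real) \<le> c"
        have hom: "f (nscale E c x) = c * f x" if "f \<in> C" for f
          using sl[OF that] x c by (simp add: sublinear_def)
        show "u (nscale E c x) = c * u x"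
        proof (rule antisym)
          show "c * u x \<le> u (nscale E c x)"
            by (rule le_u[OF scale_closed[OF x]]) (simp add: hom u_le x c mult_left_mono)
          show "u (nscale E c x) \<le> c * u x"
          proof (cases "c = 0")
            case True
            obtain f where "f \<in> C" using False by blast
            then show ?thesis using hom[of f] u_le[OF _ scale_closed[OF x, of c], of f] True by simp
          next
            case False
            then have c: "c > 0" using c by simp
            have "u (nscale E c x) / c \<le> u x"
            proof (rule le_u[OF x])
              fix f assume "f \<in> C"
              then show "u (nscale E c x) / c \<le> f x"
                using u_le[OF _ scale_closed[OF x], of f c] hom c by (simp add: field_simps)
            qed
            then show ?thesis using c by (simp add: field_simps)
          qed
        qed
      qed
      moreover have "u x \<le> p x" if "x \<in> ncar E" for x
      proof -
        obtain f where "f \<in> C" using False by blast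
        then have "u x \<le> f x" "f x \<le> p x" using u_le CA that by auto
        then show ?thesis by linarith
      qed
      ultimately show ?thesis using u_le by blast
    qed
  qed
  then obtain m where m: "m \<in> ?A" "\<And>a. \<lbrakk>a \<in> ?A; ?P m a\<rbrakk> \<Longrightarrow> a = m" by blast
  show thesis
  proof (rule that[of m])
    show "r = m" if "sublinear E r" "\<And>x. x \<in> ncar E \<Longrightarrow> r x \<le> m x" for r
      using m(1) that by (intro m(2)) force+
  qed (use m in auto)
qed

text \<open>Tilting a minimal \<open>q\<close> in the direction \<open>y\<close> does not change it, and \<open>t = 1\<close> in the infimum that defines
  the tilt then gives \<open>q x + q y \<le> q (x + y)\<close>.\<close>

lemma minimal_sublinear_linear:
  assumes q: "sublinear E q" and min: "\<And>r. \<lbrakk>sublinear E r; \<And>x. x \<in> ncar E \<Longrightarrow> r x \<le> q x\<rbrakk> \<Longrightarrow> r = q"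
  shows "q \<in> dual E" and "\<And>x. x \<in> ncar E \<Longrightarrow> \<bar>q x\<bar> \<le> nnorm E x"
proof -
  have add: "q (nadd E x y) = q x + q y" if "x \<in> ncar E" "y \<in> ncar E" for x y
  proof (rule antisym)
    show "q (nadd E x y) \<le> q x + q y" using q that by (simp add: sublinear_def)
    have "tilt E y q = q"
      by (rule min) (use sublinear_tilt tilt_le_self q that in auto)
    then show "q x + q y \<le> q (nadd E x y)"
      using tilt_le[OF q that, of 1] that by (simp add: scale_one)
  qed
  have zero: "q (nzero E) = 0"
    using add[OF zero_closed zero_closed] by (simp add: zero_add zero_closed)
  have neg: "q (nscale E (-1) x) = - q x" if "x \<in> ncar E" for x
    using add[OF that scale_closed[OF that], of "-1"] zero that by (simp add: add_neg)
  show abs: "\<bar>q x\<bar> \<le> nnorm E x" if "x \<in> ncar E" for x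
    using sublinear_lower[OF q that] q that by (fastforce simp: sublinear_def)
  show "q \<in> dual E"
  proof (rule dualI[where C = 1])
    fix c x assume x: "x \<in> ncar E"
    show "q (nscale E c x) = c * q x"
    proof (cases "c \<ge> 0")
      case True
      then show ?thesis using q x by (simp add: sublinear_def)
    next
      case False
      then have "q (nscale E (-c) x) = (-c) * q x" using q x unfolding sublinear_def by auto
      moreover have "q (nscale E (-1) (nscale E (-c) x)) = - q (nscale E (-c) x)"
        by (rule neg[OF scale_closed[OF x]])
      ultimately show ?thesis using x by (simp add: scale_scale)
    qed
  qed (use q add abs in \<open>auto simp: sublinear_def\<close>)
qed

lemma norming_functional:
  assumes y: "y \<in> ncar E"
  obtains \<phi> where "\<phi> \<in> dual E" "\<phi> y = nnorm E y"
    "\<And>x. x \<in> ncar E \<Longrightarrow> \<bar>\<phi> x\<bar> \<le> nnorm E x"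
proof -
  let ?p = "\<lambda>x\<in>ncar E. nnorm E x"
  have p: "sublinear E ?p"
    using norm_triangle by (simp add: sublinear_def add_closed scale_closed norm_scale)
  obtain q where q: "sublinear E q" "\<And>x. x \<in> ncar E \<Longrightarrow> q x \<le> tilt E y ?p x"
    "\<And>r. \<lbrakk>sublinear E r; \<And>x. x \<in> ncar E \<Longrightarrow> r x \<le> q x\<rbrakk> \<Longrightarrow> r = q"
    using minimal_sublinear_below[OF sublinear_tilt[OF p y]] by blast
  have lin: "q \<in> dual E" "\<And>x. x \<in> ncar E \<Longrightarrow> \<bar>q x\<bar> \<le> nnorm E x"
    using minimal_sublinear_linear[OF q(1)] q(3) by blast+
  have my: "nscale E (-1) y \<in> ncar E" using y by (rule scale_closed)
  have "q (nscale E (-1) y) \<le> ?p (nadd E (nscale E (-1) y) (nscale E 1 y)) - 1 * ?p y"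
    using q(2)[OF my] tilt_le[OF p my y, of 1] by linarith
  also have "nadd E (nscale E (-1) y) (nscale E 1 y) = nzero E"
    using y my by (simp add: scale_one add_commute add_neg)
  finally have "- q y \<le> - nnorm E y"
    using y my zero_closed dual_scale[OF lin(1) y, of "-1"] by (simp add: norm_zero)
  then have "q y = nnorm E y" using lin(2)[OF y] by simp
  then show thesis using that lin by blast
qed

lemma functionals_separate_points:
  assumes "x \<in> ncar E" "y \<in> ncar E" and "\<And>\<phi>. \<phi> \<in> dual E \<Longrightarrow> \<phi> x = \<phi> y"
  shows "x = y"
proof -
  obtain \<phi> where \<phi>: "\<phi> \<in> dual E" "\<phi> (nsub E x y) = nnorm E (nsub E x y)"
    using norming_functional[OF sub_closed[OF assms(1,2)]] by blast
  have "\<phi> (nsub E x y) = 0"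
    using dual_sub[OF \<phi>(1) assms(1,2) pre_normed] assms(3)[OF \<phi>(1)] by simp
  then show ?thesis using \<phi> assms norm_sub_eq_zero_iff by simp
qed

end

section \<open>Lipschitz-free spaces\<close>

lemma Lip0_simps:
  "nzero (Lip0 E F) = (\<lambda>x\<in>ncar E. nzero F)"
  "nadd (Lip0 E F) f g = (\<lambda>x\<in>ncar E. nadd F (f x) (g x))"
  "nscale (Lip0 E F) c f = (\<lambda>x\<in>ncar E. nscale F c (f x))"
  "nnorm (Lip0 E F) = lip_norm E F"
  by (simp_all add: Lip0_def map_space_def)

lemma Lip0I:
  assumes "f \<in> extensional (ncar E)" "\<And>x. x \<in> ncar E \<Longrightarrow> f x \<in> ncar F" "f (nzero E) = nzero F"
    and "\<And>x y. \<lbrakk>x \<in> ncar E; y \<in> ncar E\<rbrakk> \<Longrightarrow> nnorm F (nsub F (f x) (f y)) \<le> C * nnorm E (nsub E x y)"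
  shows "f \<in> ncar (Lip0 E F)"
  using assms by (auto simp: Lip0_def map_space_def PiE_def intro!: exI[of _ C])

lemma Lip0D:
  assumes "f \<in> ncar (Lip0 E F)"
  shows Lip0_closed: "\<And>x. x \<in> ncar E \<Longrightarrow> f x \<in> ncar F"
    and Lip0_zero: "f (nzero E) = nzero F"
    and Lip0_lipschitz: "\<exists>C. \<forall>x\<in>ncar E. \<forall>y\<in>ncar E. nnorm F (nsub F (f x) (f y)) \<le> C * nnorm E (nsub E x y)"
  using assms by (auto simp: Lip0_def map_space_def PiE_def)

context normed_space
begin

lemma lip_norm_le:
  assumes "0 \<le> C"
    and le: "\<And>x y. \<lbrakk>x \<in> ncar E; y \<in> ncar E\<rbrakk> \<Longrightarrow> nnorm F (nsub F (f x) (f y)) \<le> C * nnorm E (nsub E x y)"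
  shows "lip_norm E F f \<le> C"
  unfolding lip_norm_def
proof (rule cSup_least)
  show "{nnorm F (nsub F (f x) (f y)) / nnorm E (nsub E x y) |x y. x \<in> ncar E \<and> y \<in> ncar E} \<noteq> {}"
    using zero_closed by blast
  fix r assume "r \<in> {nnorm F (nsub F (f x) (f y)) / nnorm E (nsub E x y) |x y. x \<in> ncar E \<and> y \<in> ncar E}"
  then obtain x y where xy: "x \<in> ncar E" "y \<in> ncar E"
    and r: "r = nnorm F (nsub F (f x) (f y)) / nnorm E (nsub E x y)" by blast
  show "r \<le> C"
    using le[OF xy] norm_nonneg[OF sub_closed[OF xy]] \<open>0 \<le> C\<close> unfolding r
    by (cases "nnorm E (nsub E x y) = 0") (auto simp: field_simps)
qed

lemma lip_norm_upper:
  assumes f: "f \<in> ncar (Lip0 E F)" and xy: "x \<in> ncar E" "y \<in> ncar E"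
  shows "nnorm F (nsub F (f x) (f y)) / nnorm E (nsub E x y) \<le> lip_norm E F f"
proof -
  obtain C where C: "\<And>x y. \<lbrakk>x \<in> ncar E; y \<in> ncar E\<rbrakk> \<Longrightarrow> nnorm F (nsub F (f x) (f y)) \<le> C * nnorm E (nsub E x y)"
    using Lip0_lipschitz[OF f] by blast
  have "nnorm F (nsub F (f u) (f v)) / nnorm E (nsub E u v) \<le> \<bar>C\<bar>"
    if "u \<in> ncar E" "v \<in> ncar E" for u v
  proof (cases "nnorm E (nsub E u v) = 0")
    case False
    then have pos: "nnorm E (nsub E u v) > 0" using norm_nonneg[OF sub_closed[OF that]] by simp
    have "C * nnorm E (nsub E u v) \<le> \<bar>C\<bar> * nnorm E (nsub E u v)" using pos by (simp add: mult_right_mono)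
    then have "nnorm F (nsub F (f u) (f v)) \<le> \<bar>C\<bar> * nnorm E (nsub E u v)" using C[OF that] by linarith
    then show ?thesis using pos by (simp add: divide_le_eq)
  qed simp
  then show ?thesis
    unfolding lip_norm_def by (intro cSup_upper bdd_aboveI[of _ "\<bar>C\<bar>"]) (use xy in blast)+
qed

lemma lip_norm_nonneg:
  assumes f: "f \<in> ncar (Lip0 E F)"
  shows "0 \<le> lip_norm E F f"
  using lip_norm_upper[OF f zero_closed zero_closed] sub_self[OF zero_closed] by (simp add: norm_zero)

lemma lip_norm_bound:
  assumes F: "normed_space F" and f: "f \<in> ncar (Lip0 E F)" and xy: "x \<in> ncar E" "y \<in> ncar E"
  shows "nnorm F (nsub F (f x) (f y)) \<le> lip_norm E F f * nnorm E (nsub E x y)"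
proof (cases "x = y")
  case True
  interpret F: normed_space F by fact
  show ?thesis
    using True xy Lip0_closed[OF f] by (simp add: sub_self F.sub_self norm_zero F.norm_zero)
next
  case False
  then have "nnorm E (nsub E x y) > 0"
    using norm_nonneg[OF sub_closed[OF xy]] norm_sub_eq_zero_iff[OF xy] by simp
  then show ?thesis using lip_norm_upper[OF f xy] by (simp add: divide_le_eq)
qed

abbreviation Lip :: "('a \<Rightarrow> real) nspace" where "Lip \<equiv> Lip0 E real_line"
abbreviation Free :: "(('a \<Rightarrow> real) \<Rightarrow> real) nspace" where "Free \<equiv> free_space E"

lemma Lip_bound:
  "\<lbrakk>f \<in> ncar Lip; x \<in> ncar E; y \<in> ncar E\<rbrakk> \<Longrightarrow> \<bar>f x - f y\<bar> \<le> nnorm Lip f * nnorm E (nsub E x y)"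
  using lip_norm_bound[OF real_line_normed, of f x y] by (simp add: Lip0_simps)

lemma LipI:
  assumes "f \<in> extensional (ncar E)" "f (nzero E) = 0"
    and "\<And>x y. \<lbrakk>x \<in> ncar E; y \<in> ncar E\<rbrakk> \<Longrightarrow> \<bar>f x - f y\<bar> \<le> C * nnorm E (nsub E x y)"
  shows "f \<in> ncar Lip"
  by (rule Lip0I) (use assms in auto)

lemma Lip_norm_le:
  "\<lbrakk>0 \<le> C; \<And>x y. \<lbrakk>x \<in> ncar E; y \<in> ncar E\<rbrakk> \<Longrightarrow> \<bar>f x - f y\<bar> \<le> C * nnorm E (nsub E x y)\<rbrakk> \<Longrightarrow> nnorm Lip f \<le> C"
  unfolding Lip0_simps by (rule lip_norm_le) auto

lemma Lip_pre_normed: "pre_normed Lip"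
proof unfold_locales
  show "nzero Lip \<in> ncar Lip"
    by (rule LipI[where C = 0]) (auto simp: Lip0_simps zero_closed)
  show "nnorm Lip (nzero Lip) = 0"
  proof (rule antisym)
    show "nnorm Lip (nzero Lip) \<le> 0" by (rule Lip_norm_le) (auto simp: Lip0_simps)
    show "0 \<le> nnorm Lip (nzero Lip)"
      using lip_norm_nonneg[of _ real_line] \<open>nzero Lip \<in> ncar Lip\<close> by (simp add: Lip0_simps)
  qed
  show "0 \<le> nnorm Lip f" if "f \<in> ncar Lip" for f
    using lip_norm_nonneg[OF that] by (simp add: Lip0_simps)
  show "nadd Lip f g \<in> ncar Lip" if fg: "f \<in> ncar Lip" "g \<in> ncar Lip" for f g
  proof (rule LipI[where C = "nnorm Lip f + nnorm Lip g"])
    show "\<bar>nadd Lip f g x - nadd Lip f g y\<bar> \<le> (nnorm Lip f + nnorm Lip g) * nnorm E (nsub E x y)"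
      if "x \<in> ncar E" "y \<in> ncar E" for x y
      using Lip_bound[OF fg(1) that] Lip_bound[OF fg(2) that] that
      by (simp add: Lip0_simps(1-3) algebra_simps)
  qed (use Lip0_zero[OF fg(1)] Lip0_zero[OF fg(2)] in \<open>auto simp: Lip0_simps zero_closed\<close>)
  fix f c assume f: "f \<in> ncar Lip"
  have le: "\<bar>nscale Lip c f x - nscale Lip c f y\<bar> \<le> (\<bar>c\<bar> * nnorm Lip f) * nnorm E (nsub E x y)"
    if "x \<in> ncar E" "y \<in> ncar E" for x y
  proof -
    have "\<bar>nscale Lip c f x - nscale Lip c f y\<bar> = \<bar>c\<bar> * \<bar>f x - f y\<bar>"
      using that by (simp add: Lip0_simps(1-3) abs_mult[symmetric] algebra_simps)
    then show ?thesis
      using mult_left_mono[OF Lip_bound[OF f that], of "\<bar>c\<bar>"] by (simp add: mult.assoc)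
  qed
  show "nscale Lip c f \<in> ncar Lip"
    by (rule LipI[OF _ _ le]) (use Lip0_zero[OF f] in \<open>auto simp: Lip0_simps zero_closed extensional_def\<close>)
  show "nnorm Lip (nscale Lip c f) \<le> \<bar>c\<bar> * nnorm Lip f"
    by (rule Lip_norm_le[OF _ le]) (use lip_norm_nonneg[OF f] in \<open>simp add: Lip0_simps\<close>)
qed

lemma dual_subset_Lip:
  assumes \<phi>: "\<phi> \<in> dual E"
  shows "\<phi> \<in> ncar Lip" and "nnorm Lip \<phi> \<le> nnorm (dual_space E) \<phi>"
proof -
  have le: "\<bar>\<phi> x - \<phi> y\<bar> \<le> nnorm (dual_space E) \<phi> * nnorm E (nsub E x y)"
    if "x \<in> ncar E" "y \<in> ncar E" for x y
    using dual_bound[OF pre_normed \<phi> sub_closed[OF that]] dual_sub[OF \<phi> that pre_normed] by simp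
  have "\<phi> (nscale E 0 (nzero E)) = 0 * \<phi> (nzero E)" by (rule dual_scale[OF \<phi> zero_closed])
  then have "\<phi> (nzero E) = 0" by (simp add: scale_zero_right)
  then show "\<phi> \<in> ncar Lip" using le by (intro LipI[OF dual_ext[OF \<phi>]])
  show "nnorm Lip \<phi> \<le> nnorm (dual_space E) \<phi>"
    by (rule Lip_norm_le[OF dual_norm_nonneg[OF pre_normed \<phi>] le])
qed

lemma delta_closed:
  assumes x: "x \<in> ncar E"
  shows "delta E x \<in> dual Lip"
proof (rule dualI[where C = "nnorm E x"])
  interpret L: pre_normed Lip by (rule Lip_pre_normed)
  show "\<bar>delta E x f\<bar> \<le> nnorm E x * nnorm Lip f" if f: "f \<in> ncar Lip" for f
    using Lip_bound[OF f x zero_closed] Lip0_zero[OF f] f x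
    by (simp add: delta_def sub_zero mult.commute)
  show "delta E x (nadd Lip f g) = delta E x f + delta E x g" if "f \<in> ncar Lip" "g \<in> ncar Lip" for f g
    using L.add_closed[OF that] that x by (simp add: delta_def) (simp add: Lip0_simps)
  show "delta E x (nscale Lip c f) = c * delta E x f" if "f \<in> ncar Lip" for c f
    using L.scale_closed[OF that] that x by (simp add: delta_def) (simp add: Lip0_simps)
qed (simp add: delta_def)

lemma normed_dual_Lip: "normed_space (dual_space Lip)"
  by (rule dual_normed[OF Lip_pre_normed])

lemma deltas_subset: "delta E ` ncar E \<subseteq> dual Lip"
  using delta_closed by blast

lemma lin_subspace_Free: "lin_subspace (dual_space Lip) (ncar Free)"
  using normed_space.lin_subspace_closed_span[OF normed_dual_Lip deltas_subset]
  by (simp add: free_space_def)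

lemma closedin_Free: "closedin (ntop (dual_space Lip)) (ncar Free)"
  using normed_space.closedin_closed_span[OF normed_dual_Lip]
  by (simp add: free_space_def)

lemma Free_eq: "Free = sub_space (dual_space Lip) (ncar Free)"
  by (simp add: free_space_def)

lemma Free_normed: "normed_space Free"
  using normed_space.sub_space_normed[OF normed_dual_Lip lin_subspace_Free] by (metis Free_eq)

lemma Free_simps:
  "nzero Free = nzero (dual_space Lip)" "nadd Free = nadd (dual_space Lip)"
  "nscale Free = nscale (dual_space Lip)" "nnorm Free = nnorm (dual_space Lip)"
  by (simp_all add: free_space_def)

lemma Free_subset: "\<mu> \<in> ncar Free \<Longrightarrow> \<mu> \<in> dual Lip"
  using lin_subspace_Free by (auto simp: lin_subspace_def)

lemma delta_Free: "x \<in> ncar E \<Longrightarrow> delta E x \<in> ncar Free"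
  using normed_space.closed_span_superset[OF normed_dual_Lip deltas_subset]
  by (auto simp: free_space_def)

lemma Free_bound:
  "\<lbrakk>\<mu> \<in> ncar Free; f \<in> ncar Lip\<rbrakk> \<Longrightarrow> \<bar>\<mu> f\<bar> \<le> nnorm Lip f * nnorm Free \<mu>"
  using dual_bound[OF Lip_pre_normed Free_subset] by (simp add: Free_simps mult.commute)

lemma evaluation_functional:
  assumes f: "f \<in> ncar Lip"
  shows "(\<lambda>\<mu>\<in>ncar Free. \<mu> f) \<in> dual Free"
    and "nnorm (dual_space Free) (\<lambda>\<mu>\<in>ncar Free. \<mu> f) \<le> nnorm Lip f"
proof -
  interpret F: normed_space Free by (rule Free_normed)
  show "(\<lambda>\<mu>\<in>ncar Free. \<mu> f) \<in> dual Free"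
    by (rule dualI[where C = "nnorm Lip f"])
      (use Free_bound f F.add_closed F.scale_closed in \<open>auto simp: Free_simps(1-3) dual_simps(1-3)\<close>)
  show "nnorm (dual_space Free) (\<lambda>\<mu>\<in>ncar Free. \<mu> f) \<le> nnorm Lip f"
    by (rule dual_norm_le[OF F.pre_normed pre_normed.norm_nonneg[OF Lip_pre_normed f]])
      (use Free_bound f in auto)
qed

text \<open>Equations between functionals on free spaces are checked at the \<open>\<delta>\<^sub>x\<close> by means of the next two
  lemmas.\<close>

lemma functional_vanishes_on_Free:
  assumes \<phi>: "\<phi> \<in> dual Free" and "\<And>x. x \<in> ncar E \<Longrightarrow> \<phi> (delta E x) = 0"
    and \<mu>: "\<mu> \<in> ncar Free"
  shows "\<phi> \<mu> = 0"
proof (rule functional_vanishes_on_closed_span[where \<phi> = \<phi> and v = \<mu>,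
      OF normed_dual_Lip lin_subspace_Free closedin_Free])
  show "\<phi> \<in> dual (sub_space (dual_space Lip) (ncar Free))"
    using \<phi> by (simp only: Free_eq[symmetric])
  show "\<mu> \<in> closed_span (dual_space Lip) (delta E ` ncar E)"
    using \<mu> by (simp add: free_space_def)
qed (use assms delta_Free in auto)

lemma functional_vanishes_on_free_sub:
  assumes M: "M \<subseteq> ncar E" and \<phi>: "\<phi> \<in> dual Free"
    and zero: "\<And>x. x \<in> M \<Longrightarrow> \<phi> (delta E x) = 0" and \<mu>: "\<mu> \<in> free_sub E M"
  shows "\<phi> \<mu> = 0"
proof -
  interpret F: normed_space Free by (rule Free_normed)
  have "sub_space Free (ncar Free) = Free" by (simp add: sub_space_def)
  then have \<phi>': "\<phi> \<in> dual (sub_space Free (ncar Free))" using \<phi> by metis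
  have cl: "closedin (ntop Free) (ncar Free)"
    using closedin_topspace[of "ntop Free"] by (simp add: F.topspace_ntop)
  show ?thesis
    by (rule functional_vanishes_on_closed_span[where S = "delta E ` M" and \<phi> = \<phi> and v = \<mu>,
          OF Free_normed F.lin_subspace_carrier cl _ \<phi>'])
      (use M zero \<mu> delta_Free in \<open>auto simp: free_sub_def\<close>)
qed

lemma free_sub_lin_subspace: "M \<subseteq> ncar E \<Longrightarrow> lin_subspace Free (free_sub E M)"
  unfolding free_sub_def
  by (rule normed_space.lin_subspace_closed_span[OF Free_normed]) (use delta_Free in auto)

lemma delta_free_sub: "\<lbrakk>M \<subseteq> ncar E; x \<in> M\<rbrakk> \<Longrightarrow> delta E x \<in> free_sub E M"
  unfolding free_sub_def
  using normed_space.closed_span_superset[OF Free_normed, of "delta E ` M"] delta_Free by blast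

lemma lip_compose_functional:
  assumes F: "normed_space F" and f: "f \<in> ncar (Lip0 E F)" and \<phi>: "\<phi> \<in> dual F"
  shows "(\<lambda>x\<in>ncar E. \<phi> (f x)) \<in> ncar Lip"
    and "nnorm Lip (\<lambda>x\<in>ncar E. \<phi> (f x)) \<le> nnorm (dual_space F) \<phi> * lip_norm E F f"
proof -
  interpret F: normed_space F by fact
  have n0: "0 \<le> nnorm (dual_space F) \<phi>" by (rule dual_norm_nonneg[OF F.pre_normed \<phi>])
  have le: "\<bar>\<phi> (f x) - \<phi> (f y)\<bar> \<le> (nnorm (dual_space F) \<phi> * lip_norm E F f) * nnorm E (nsub E x y)"
    if "x \<in> ncar E" "y \<in> ncar E" for x y
  proof -
    note fxy = Lip0_closed[OF f that(1)] Lip0_closed[OF f that(2)]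
    have "\<bar>\<phi> (f x) - \<phi> (f y)\<bar> = \<bar>\<phi> (nsub F (f x) (f y))\<bar>"
      by (simp add: dual_sub[OF \<phi> fxy F.pre_normed])
    also have "\<dots> \<le> nnorm (dual_space F) \<phi> * nnorm F (nsub F (f x) (f y))"
      by (rule dual_bound[OF F.pre_normed \<phi> F.sub_closed[OF fxy]])
    also have "\<dots> \<le> nnorm (dual_space F) \<phi> * (lip_norm E F f * nnorm E (nsub E x y))"
      by (intro mult_left_mono lip_norm_bound[OF F f that] n0)
    finally show ?thesis by (simp add: mult.assoc)
  qed
  have "\<phi> (nzero F) = 0"
    using normed_space.dual_subset_Lip(1)[OF F \<phi>] Lip0_zero by fastforce
  then show "(\<lambda>x\<in>ncar E. \<phi> (f x)) \<in> ncar Lip"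
    by (intro LipI[where C = "nnorm (dual_space F) \<phi> * lip_norm E F f"])
      (use le Lip0_zero[OF f] zero_closed in auto)
  show "nnorm Lip (\<lambda>x\<in>ncar E. \<phi> (f x)) \<le> nnorm (dual_space F) \<phi> * lip_norm E F f"
    by (rule Lip_norm_le) (use le n0 lip_norm_nonneg[OF f] in auto)
qed

text \<open>Every \<open>\<mu>\<close> in the free space is represented in \<open>F\<close>: the representable \<open>\<mu>\<close> form a subspace that
  contains all \<open>\<delta>\<^sub>x\<close>, and it is closed because norming functionals bound the distance between
  representing vectors by the distance between the represented functionals, and \<open>F\<close> is complete.\<close>

lemma represented_in_target:
  assumes F: "banach_space F" and f: "f \<in> ncar (Lip0 E F)" and \<mu>: "\<mu> \<in> ncar Free"
  shows "\<exists>y\<in>ncar F. \<forall>\<phi>\<in>dual F. \<phi> y = \<mu> (\<lambda>x\<in>ncar E. \<phi> (f x))"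
proof -
  interpret F: normed_space F using F by (simp add: banach_space_def)
  interpret V: normed_space "dual_space Lip" by (rule normed_dual_Lip)
  let ?pull = "\<lambda>\<phi>. \<lambda>x\<in>ncar E. \<phi> (f x)"
  let ?V = "dual_space Lip"
  note pull = lip_compose_functional[OF F.normed_space_axioms f]
  let ?c = "lip_norm E F f"
  have c: "0 \<le> ?c" by (rule lip_norm_nonneg[OF f])
  define R where "R \<mu> y \<longleftrightarrow> y \<in> ncar F \<and> (\<forall>\<phi>\<in>dual F. \<phi> y = \<mu> (?pull \<phi>))" for \<mu> y
  define D where "D = {\<mu> \<in> ncar ?V. \<exists>y. R \<mu> y}"
  have dist: "nnorm F (nsub F y z) \<le> ?c * nnorm ?V (nsub ?V \<mu> \<nu>)"
    if R: "R \<mu> y" "R \<nu> z" and V: "\<mu> \<in> ncar ?V" "\<nu> \<in> ncar ?V" for \<mu> \<nu> y z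
  proof -
    have yz: "y \<in> ncar F" "z \<in> ncar F" using R by (auto simp: R_def)
    obtain \<phi> where \<phi>: "\<phi> \<in> dual F" "\<phi> (nsub F y z) = nnorm F (nsub F y z)"
      "\<And>x. x \<in> ncar F \<Longrightarrow> \<bar>\<phi> x\<bar> \<le> nnorm F x"
      using F.norming_functional[OF F.sub_closed[OF yz]] by metis
    have n1: "nnorm (dual_space F) \<phi> \<le> 1"
      by (rule dual_norm_le[OF F.pre_normed]) (use \<phi>(3) in auto)
    have "nnorm F (nsub F y z) = \<phi> y - \<phi> z"
      using dual_sub[OF \<phi>(1) yz F.pre_normed] \<phi>(2) by simp
    also have "\<dots> = nsub ?V \<mu> \<nu> (?pull \<phi>)"
      using R \<phi>(1) pull(1)[OF \<phi>(1)] by (simp add: R_def dual_nsub[OF Lip_pre_normed])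
    also have "\<dots> \<le> nnorm ?V (nsub ?V \<mu> \<nu>) * nnorm Lip (?pull \<phi>)"
      using dual_bound[OF Lip_pre_normed V.sub_closed[OF V] pull(1)[OF \<phi>(1)]] by linarith
    also have "\<dots> \<le> nnorm ?V (nsub ?V \<mu> \<nu>) * ?c"
      using pull(2)[OF \<phi>(1)] mult_right_mono[OF n1 c] V.norm_nonneg[OF V.sub_closed[OF V]]
      by (intro mult_left_mono) auto
    finally show ?thesis by (simp add: mult.commute)
  qed
  have "closed_span ?V (delta E ` ncar E) \<subseteq> D"
  proof (rule V.closed_span_minimal)
    show "lin_subspace ?V D"
      unfolding lin_subspace_def
    proof (intro conjI ballI allI)
      show "D \<subseteq> ncar ?V" by (auto simp: D_def)
      have "R (nzero ?V) (nzero F)"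
        unfolding R_def
        using pull(1) F.zero_closed Lip0_zero[OF normed_space.dual_subset_Lip(1)[OF F.normed_space_axioms]]
        by (simp add: dual_simps)
      then show "nzero ?V \<in> D" using V.zero_closed by (auto simp: D_def)
      show "nadd ?V \<mu> \<nu> \<in> D" if mn: "\<mu> \<in> D" "\<nu> \<in> D" for \<mu> \<nu>
      proof -
        obtain y z where "R \<mu> y" "R \<nu> z" using mn by (auto simp: D_def)
        then have "R (nadd ?V \<mu> \<nu>) (nadd F y z)"
          using pull(1) by (simp add: R_def dual_simps F.add_closed dual_add)
        then show ?thesis using mn V.add_closed by (auto simp: D_def)
      qed
      show "nscale ?V a \<mu> \<in> D" if m: "\<mu> \<in> D" for a \<mu>
      proof -
        obtain y where "R \<mu> y" using m by (auto simp: D_def)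
        then have "R (nscale ?V a \<mu>) (nscale F a y)"
          using pull(1) by (simp add: R_def dual_simps F.scale_closed dual_scale)
        then show ?thesis using m V.scale_closed by (auto simp: D_def)
      qed
    qed
    show "delta E ` ncar E \<subseteq> D"
    proof (rule image_subsetI)
      fix x assume x: "x \<in> ncar E"
      have "R (delta E x) (f x)"
        using pull(1) x Lip0_closed[OF f x] by (simp add: R_def delta_def)
      then show "delta E x \<in> D" using delta_closed[OF x] by (auto simp: D_def)
    qed
    show "closedin (ntop ?V) D"
    proof (subst V.closedin_iff)
      show "D \<subseteq> ncar ?V" by (auto simp: D_def)
      show "\<forall>\<mu>\<in>ncar ?V. (\<forall>e>0. \<exists>\<nu>\<in>D. nnorm ?V (nsub ?V \<mu> \<nu>) < e) \<longrightarrow> \<mu> \<in> D"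
      proof (intro ballI impI)
        fix \<mu> assume \<mu>: "\<mu> \<in> ncar ?V" and near: "\<forall>e>0. \<exists>\<nu>\<in>D. nnorm ?V (nsub ?V \<mu> \<nu>) < e"
        have "\<forall>n. \<exists>\<nu>. \<exists>y. \<nu> \<in> ncar ?V \<and> R \<nu> y \<and> nnorm ?V (nsub ?V \<mu> \<nu>) < inverse (real (Suc n))"
        proof
          fix n
          have "inverse (real (Suc n)) > 0" by simp
          with near obtain \<nu> where "\<nu> \<in> D" "nnorm ?V (nsub ?V \<mu> \<nu>) < inverse (real (Suc n))" by blast
          then show "\<exists>\<nu>. \<exists>y. \<nu> \<in> ncar ?V \<and> R \<nu> y \<and> nnorm ?V (nsub ?V \<mu> \<nu>) < inverse (real (Suc n))"
            by (auto simp: D_def)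
        qed
        then obtain s y where s: "\<And>n. s n \<in> ncar ?V" and y: "\<And>n. R (s n) (y n)"
          and close: "\<And>n. nnorm ?V (nsub ?V \<mu> (s n)) < inverse (real (Suc n))"
          by metis
        have yF: "y n \<in> ncar F" for n using y by (simp add: R_def)
        have ss: "nnorm ?V (nsub ?V (s m) (s n)) < inverse (real (Suc m)) + inverse (real (Suc n))" for m n
          using V.norm_sub_triangle[OF s \<mu> s, of m n] close[of m] close[of n]
            V.norm_sub_commute[OF s \<mu>, of m] by linarith
        interpret FM: Metric_space "ncar F" "ndist F" by (rule F.metric)
        have "FM.MCauchy y"
          unfolding FM.MCauchy_def
        proof (intro conjI allI impI)
          show "range y \<subseteq> ncar F" using yF by blast
          fix e :: real assume e: "e > 0"
          define d where "d = e / (2 * (?c + 1))"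
          have d: "d > 0" "(?c + 1) * (2 * d) = e" using e c by (auto simp: d_def divide_simps)
          obtain N where N: "inverse (real (Suc N)) < d" using reals_Archimedean[OF d(1)] by blast
          have "ndist F (y m) (y n) < e" if "N \<le> m" "N \<le> n" for m n
          proof -
            have "inverse (real (Suc m)) \<le> inverse (real (Suc N))"
              "inverse (real (Suc n)) \<le> inverse (real (Suc N))" using that by simp_all
            then have lt: "nnorm ?V (nsub ?V (s m) (s n)) < 2 * d"
              using ss[of m n] N by linarith
            have "nnorm F (nsub F (y m) (y n)) \<le> (?c + 1) * nnorm ?V (nsub ?V (s m) (s n))"
              using dist[OF y y s s, of m n] V.norm_nonneg[OF V.sub_closed[OF s s], of m n]
              by (simp add: distrib_right)
            also have "\<dots> < (?c + 1) * (2 * d)"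
              using lt c by (intro mult_strict_left_mono) auto
            also have "\<dots> = e" by (rule d(2))
            finally show ?thesis by (simp add: F.ndist_eq yF)
          qed
          then show "\<exists>N. \<forall>n n'. N \<le> n \<longrightarrow> N \<le> n' \<longrightarrow> ndist F (y n) (y n') < e" by blast
        qed
        then obtain l where "limitin (ntop F) y l sequentially"
          using F unfolding banach_space_def FM.mcomplete_def ntop_def by blast
        then have l: "l \<in> ncar F"
          and lim: "\<And>e. e > 0 \<Longrightarrow> \<forall>\<^sub>F n in sequentially. nnorm F (nsub F (y n) l) < e"
          by (auto simp: F.limit_iff elim: eventually_mono)
        have "(\<lambda>n. nnorm F (nsub F (y n) l)) \<longlonglongrightarrow> 0"
          using lim by (intro tendstoI) (auto simp: F.norm_nonneg F.sub_closed yF l)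
        moreover have "(\<lambda>n. nnorm ?V (nsub ?V \<mu> (s n))) \<longlonglongrightarrow> 0"
          by (rule real_tendsto_sandwich[OF _ _ tendsto_const LIMSEQ_inverse_real_of_nat])
            (use close V.norm_nonneg[OF V.sub_closed[OF \<mu> s]] in \<open>auto intro!: always_eventually less_imp_le\<close>)
        ultimately have lims: "(\<lambda>n. nnorm F (nsub F (y n) l)) \<longlonglongrightarrow> 0"
          "(\<lambda>n. nnorm ?V (nsub ?V \<mu> (s n))) \<longlonglongrightarrow> 0" .
        have "R \<mu> l"
          unfolding R_def
        proof (intro conjI l ballI)
          fix \<phi> assume \<phi>: "\<phi> \<in> dual F"
          have "(\<lambda>n. \<phi> (y n) - \<phi> l) \<longlonglongrightarrow> 0"
          proof (rule Lim_null_comparison)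
            show "\<forall>\<^sub>F n in sequentially. norm (\<phi> (y n) - \<phi> l)
                \<le> nnorm (dual_space F) \<phi> * nnorm F (nsub F (y n) l)"
              using dual_bound[OF F.pre_normed \<phi> F.sub_closed[OF yF l]] dual_sub[OF \<phi> yF l F.pre_normed] by simp
            show "(\<lambda>n. nnorm (dual_space F) \<phi> * nnorm F (nsub F (y n) l)) \<longlonglongrightarrow> 0"
              by (rule tendsto_mult_right_zero[OF lims(1)])
          qed
          then have 1: "(\<lambda>n. s n (?pull \<phi>)) \<longlonglongrightarrow> \<phi> l"
            using y \<phi> LIM_zero_cancel by (fastforce simp: R_def)
          have "(\<lambda>n. \<mu> (?pull \<phi>) - s n (?pull \<phi>)) \<longlonglongrightarrow> 0"
          proof (rule Lim_null_comparison)
            show "\<forall>\<^sub>F n in sequentially. norm (\<mu> (?pull \<phi>) - s n (?pull \<phi>))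
                \<le> nnorm ?V (nsub ?V \<mu> (s n)) * nnorm Lip (?pull \<phi>)"
              using dual_bound[OF Lip_pre_normed V.sub_closed[OF \<mu> s] pull(1)[OF \<phi>]] pull(1)[OF \<phi>]
              by (simp add: dual_nsub[OF Lip_pre_normed])
            show "(\<lambda>n. nnorm ?V (nsub ?V \<mu> (s n)) * nnorm Lip (?pull \<phi>)) \<longlonglongrightarrow> 0"
              by (rule tendsto_mult_left_zero[OF lims(2)])
          qed
          then have "(\<lambda>n. s n (?pull \<phi>)) \<longlonglongrightarrow> \<mu> (?pull \<phi>)"
            using tendsto_diff[OF tendsto_const, of _ 0 sequentially "\<mu> (?pull \<phi>)"] by fastforce
          with 1 show "\<phi> l = \<mu> (?pull \<phi>)" by (rule LIMSEQ_unique)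
        qed
        then show "\<mu> \<in> D" using \<mu> by (auto simp: D_def)
      qed
    qed
  qed
  then have "\<mu> \<in> D" using \<mu> by (auto simp: free_space_def)
  then show ?thesis by (auto simp: D_def R_def)
qed

text \<open>Functionals separate the points of \<open>F\<close>, which makes the representing vector unique and hence linear
  in \<open>\<mu>\<close>. The case \<open>f = id\<close> gives \<open>\<beta>\<close>.\<close>

lemma linearization_exists:
  assumes F: "banach_space F" and f: "f \<in> ncar (Lip0 E F)"
  shows "\<exists>L\<in>ops Free F. \<forall>\<mu>\<in>ncar Free. \<forall>\<phi>\<in>dual F.
    \<phi> (L \<mu>) = \<mu> (\<lambda>x\<in>ncar E. \<phi> (f x))"
proof -
  interpret F: normed_space F using F by (simp add: banach_space_def)
  interpret Z: normed_space Free by (rule Free_normed)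
  note pull = lip_compose_functional[OF F.normed_space_axioms f]
  have "\<forall>\<mu>\<in>ncar Free. \<exists>y. y \<in> ncar F \<and> (\<forall>\<phi>\<in>dual F. \<phi> y = \<mu> (\<lambda>x\<in>ncar E. \<phi> (f x)))"
    using represented_in_target[OF F f] by blast
  then obtain L0 where L0: "\<And>\<mu>. \<mu> \<in> ncar Free \<Longrightarrow> L0 \<mu> \<in> ncar F"
    "\<And>\<mu> \<phi>. \<lbrakk>\<mu> \<in> ncar Free; \<phi> \<in> dual F\<rbrakk> \<Longrightarrow> \<phi> (L0 \<mu>) = \<mu> (\<lambda>x\<in>ncar E. \<phi> (f x))"
    by metis
  let ?L = "restrict L0 (ncar Free)"
  have "?L \<in> ops Free F"
  proof (rule operatorsI[where C = "lip_norm E F f"])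
    show "?L (nadd Free \<mu> \<nu>) = nadd F (?L \<mu>) (?L \<nu>)" if "\<mu> \<in> ncar Free" "\<nu> \<in> ncar Free" for \<mu> \<nu>
      by (rule F.functionals_separate_points)
        (use that L0(1) F.add_closed Z.add_closed[OF that] in \<open>simp_all add: dual_add L0(2)\<close>,
          simp add: Free_simps dual_simps pull(1))
    show "?L (nscale Free c \<mu>) = nscale F c (?L \<mu>)" if "\<mu> \<in> ncar Free" for c \<mu>
      by (rule F.functionals_separate_points)
        (use that L0(1) F.scale_closed Z.scale_closed[OF that] in \<open>simp_all add: dual_scale L0(2)\<close>,
          simp add: Free_simps dual_simps pull(1))
    show "nnorm F (?L \<mu>) \<le> lip_norm E F f * nnorm Free \<mu>" if \<mu>: "\<mu> \<in> ncar Free" for \<mu>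
    proof -
      obtain \<phi> where \<phi>: "\<phi> \<in> dual F" "\<phi> (L0 \<mu>) = nnorm F (L0 \<mu>)"
        "\<And>x. x \<in> ncar F \<Longrightarrow> \<bar>\<phi> x\<bar> \<le> nnorm F x"
        using F.norming_functional[OF L0(1)[OF \<mu>]] by metis
      have "nnorm (dual_space F) \<phi> \<le> 1"
        by (rule dual_norm_le[OF F.pre_normed]) (use \<phi>(3) in auto)
      then have "nnorm Lip (\<lambda>x\<in>ncar E. \<phi> (f x)) \<le> lip_norm E F f"
        using pull(2)[OF \<phi>(1)] lip_norm_nonneg[OF f] mult_right_mono[of "nnorm (dual_space F) \<phi>" 1 "lip_norm E F f"]
        by linarith
      then have "nnorm Lip (\<lambda>x\<in>ncar E. \<phi> (f x)) * nnorm Free \<mu> \<le> lip_norm E F f * nnorm Free \<mu>"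
        by (rule mult_right_mono) (rule Z.norm_nonneg[OF \<mu>])
      moreover have "nnorm F (L0 \<mu>) \<le> nnorm Lip (\<lambda>x\<in>ncar E. \<phi> (f x)) * nnorm Free \<mu>"
        using Free_bound[OF \<mu> pull(1)[OF \<phi>(1)]] L0(2)[OF \<mu> \<phi>(1)] \<phi>(2) by linarith
      ultimately show ?thesis using \<mu> by simp
    qed
  qed (use L0 in auto)
  then show ?thesis using L0 by (intro bexI[of _ ?L]) auto
qed

lemma lin_ext_props:
  assumes F: "banach_space F" and f: "f \<in> ncar (Lip0 E F)"
  shows "lin_ext E F f \<in> ops Free F"
    and "\<And>x. x \<in> ncar E \<Longrightarrow> lin_ext E F f (delta E x) = f x"
proof -
  interpret F: normed_space F using F by (simp add: banach_space_def)
  interpret Z: normed_space Free by (rule Free_normed)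
  interpret ZD: normed_space "dual_space Free" by (rule dual_normed[OF Z.pre_normed])
  let ?P = "\<lambda>L. L \<in> ops Free F \<and> (\<forall>x\<in>ncar E. L (delta E x) = f x)"
  obtain L where L: "L \<in> ops Free F"
    and rep: "\<And>\<mu> \<phi>. \<lbrakk>\<mu> \<in> ncar Free; \<phi> \<in> dual F\<rbrakk> \<Longrightarrow> \<phi> (L \<mu>) = \<mu> (\<lambda>x\<in>ncar E. \<phi> (f x))"
    using linearization_exists[OF F f] by blast
  have "L (delta E x) = f x" if "x \<in> ncar E" for x
    by (rule F.functionals_separate_points)
      (use that operators_closed[OF L delta_Free] Lip0_closed[OF f] rep[OF delta_Free]
        lip_compose_functional(1)[OF F.normed_space_axioms f] in \<open>auto simp: delta_def\<close>)
  with L have PL: "?P L" by blast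
  have "K = L" if "?P K" for K
  proof (rule extensionalityI)
    from that have K: "K \<in> ops Free F" by blast
    show "K \<in> extensional (ncar Free)" "L \<in> extensional (ncar Free)"
      by (rule operators_ext[OF K], rule operators_ext[OF L])
    fix \<mu> assume \<mu>: "\<mu> \<in> ncar Free"
    show "K \<mu> = L \<mu>"
    proof (rule F.functionals_separate_points)
      fix \<phi> assume \<phi>: "\<phi> \<in> dual F"
      let ?d = "nsub (dual_space Free) (\<lambda>\<nu>\<in>ncar Free. \<phi> (K \<nu>)) (\<lambda>\<nu>\<in>ncar Free. \<phi> (L \<nu>))"
      have "?d \<in> dual Free"
        by (intro ZD.sub_closed functional_compose[OF Z.pre_normed F.pre_normed _ \<phi>] K L)
      then have "?d \<mu> = 0"
        by (rule functional_vanishes_on_Free[OF _ _ \<mu>])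
          (use that PL delta_Free in \<open>simp add: dual_nsub[OF Z.pre_normed]\<close>)
      then show "\<phi> (K \<mu>) = \<phi> (L \<mu>)" using \<mu> by (simp add: dual_nsub[OF Z.pre_normed])
    qed (use operators_closed[OF K \<mu>] operators_closed[OF L \<mu>] in auto)
  qed
  then have "?P (THE L. ?P L)" using PL by (intro theI[of ?P]) auto
  then show "lin_ext E F f \<in> ops Free F"
    and "\<And>x. x \<in> ncar E \<Longrightarrow> lin_ext E F f (delta E x) = f x"
    by (auto simp: lin_ext_def)
qed

lemma beta_props:
  assumes E: "banach_space E"
  shows "beta E \<in> ops Free E"
    and "\<And>\<mu> \<phi>. \<lbrakk>\<mu> \<in> ncar Free; \<phi> \<in> dual E\<rbrakk> \<Longrightarrow> \<phi> (beta E \<mu>) = \<mu> \<phi>"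
proof -
  let ?id = "\<lambda>x\<in>ncar E. x"
  have "?id \<in> ncar (Lip0 E E)"
    by (rule Lip0I[where C = 1]) (auto simp: zero_closed)
  from linearization_exists[OF E this] obtain L where L: "L \<in> ops Free E"
    "\<And>\<mu> \<phi>. \<lbrakk>\<mu> \<in> ncar Free; \<phi> \<in> dual E\<rbrakk> \<Longrightarrow> \<phi> (L \<mu>) = \<mu> (\<lambda>x\<in>ncar E. \<phi> (?id x))"
    by blast
  have "(\<lambda>x\<in>ncar E. \<phi> (?id x)) = \<phi>" if "\<phi> \<in> dual E" for \<phi>
    using dual_ext[OF that] by (auto simp: extensional_def)
  then have "\<exists>T. T \<in> ops Free E \<and>
     (\<forall>\<mu>\<in>ncar Free. \<forall>\<phi>\<in>dual E. \<phi> (T \<mu>) = \<mu> \<phi>)"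
    using L by metis
  from someI_ex[OF this] show "beta E \<in> ops Free E"
    and "\<And>\<mu> \<phi>. \<lbrakk>\<mu> \<in> ncar Free; \<phi> \<in> dual E\<rbrakk> \<Longrightarrow> \<phi> (beta E \<mu>) = \<mu> \<phi>"
    unfolding beta_def by blast+
qed

text \<open>McShane's extension \<open>x \<mapsto> inf (g m + C \<parallel>x - m\<parallel>)\<close>: an infimum of functions with Lipschitz constant \<open>C\<close> has
  this constant too, and at a point of \<open>M\<close> it is attained at that point.\<close>

lemma mcshane_extension:
  assumes M: "M \<subseteq> ncar E" "nzero E \<in> M" and C: "0 \<le> C" and g0: "g (nzero E) = 0"
    and g: "\<And>x y. \<lbrakk>x \<in> M; y \<in> M\<rbrakk> \<Longrightarrow> \<bar>g x - g y\<bar> \<le> C * nnorm E (nsub E x y)"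
  obtains G where "G \<in> ncar Lip" "nnorm Lip G \<le> C" "\<And>m. m \<in> M \<Longrightarrow> G m = g m"
proof -
  define G where "G = (\<lambda>x\<in>ncar E. INF m\<in>M. g m + C * nnorm E (nsub E x m))"
  have C_tri: "C * nnorm E (nsub E x z) \<le> C * nnorm E (nsub E x y) + C * nnorm E (nsub E y z)"
    if "x \<in> ncar E" "y \<in> ncar E" "z \<in> ncar E" for x y z
    using mult_left_mono[OF norm_sub_triangle[OF that] C] by (simp add: distrib_left)
  have lower: "g k - C * nnorm E (nsub E x k) \<le> g m + C * nnorm E (nsub E x m)"
    if x: "x \<in> ncar E" and km: "k \<in> M" "m \<in> M" for x k m
  proof -
    have kmE: "k \<in> ncar E" "m \<in> ncar E" using M km by auto
    show ?thesis
      using g[OF km] C_tri[OF kmE(1) x kmE(2)] norm_sub_commute[OF x kmE(1)] by simp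
  qed
  have G_le: "G x \<le> g m + C * nnorm E (nsub E x m)" if "x \<in> ncar E" "m \<in> M" for x m
  proof -
    have "(INF m\<in>M. g m + C * nnorm E (nsub E x m)) \<le> g m + C * nnorm E (nsub E x m)"
      by (rule cINF_lower[OF bdd_belowI2 that(2)]) (rule lower[OF that(1) M(2)])
    then show ?thesis using that by (simp add: G_def)
  qed
  have le_G: "a \<le> G x" if "x \<in> ncar E" "\<And>m. m \<in> M \<Longrightarrow> a \<le> g m + C * nnorm E (nsub E x m)" for a x
    using that M by (auto simp: G_def intro!: cINF_greatest)
  have Gg: "G m = g m" if m: "m \<in> M" for m
  proof (rule antisym)
    have mE: "m \<in> ncar E" using M m by auto
    show "G m \<le> g m" using G_le[OF mE m] mE by (simp add: sub_self norm_zero)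
    show "g m \<le> G m"
      using lower[OF mE m] mE by (intro le_G) (auto simp: sub_self norm_zero)
  qed
  have one: "G x - G y \<le> C * nnorm E (nsub E x y)" if xy: "x \<in> ncar E" "y \<in> ncar E" for x y
  proof -
    have "G x - C * nnorm E (nsub E x y) \<le> G y"
    proof (rule le_G[OF xy(2)])
      fix m assume m: "m \<in> M"
      then have "m \<in> ncar E" using M by auto
      then show "G x - C * nnorm E (nsub E x y) \<le> g m + C * nnorm E (nsub E y m)"
        using G_le[OF xy(1) m] C_tri[OF xy, of m] by linarith
    qed
    then show ?thesis by simp
  qed
  have lip: "\<bar>G x - G y\<bar> \<le> C * nnorm E (nsub E x y)" if "x \<in> ncar E" "y \<in> ncar E" for x y
    using one[OF that] one[OF that(2,1)] norm_sub_commute[OF that] by simp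
  have "G \<in> ncar Lip"
    by (rule LipI[OF _ _ lip]) (use Gg M g0 in \<open>auto simp: G_def extensional_def\<close>)
  then show thesis using that Lip_norm_le[OF C lip] Gg by blast
qed

end

section \<open>Isometric copies and operator ideals\<close>

lemma isometric_isoD:
  assumes "isometric_iso E F i"
  shows iso_ext: "i \<in> extensional (ncar E)"
    and iso_closed: "\<And>x. x \<in> ncar E \<Longrightarrow> i x \<in> ncar F"
    and iso_add: "\<And>x y. \<lbrakk>x \<in> ncar E; y \<in> ncar E\<rbrakk> \<Longrightarrow> i (nadd E x y) = nadd F (i x) (i y)"
    and iso_scale: "\<And>c x. x \<in> ncar E \<Longrightarrow> i (nscale E c x) = nscale F c (i x)"
    and iso_norm: "\<And>x. x \<in> ncar E \<Longrightarrow> nnorm F (i x) = nnorm E x"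
    and iso_image: "i ` ncar E = ncar F"
  using assms by (auto simp: isometric_iso_def linear_maps_def PiE_def)

lemma iso_operator: "isometric_iso E F i \<Longrightarrow> i \<in> ops E F"
  by (rule operatorsI[where C = 1])
    (auto simp: iso_ext iso_closed iso_add iso_scale iso_norm)

lemma iso_inverse:
  assumes E: "normed_space E" and i: "isometric_iso E F i"
  obtains k where "isometric_iso F E k" "\<And>x. x \<in> ncar E \<Longrightarrow> k (i x) = x" "\<And>y. y \<in> ncar F \<Longrightarrow> i (k y) = y"
proof -
  interpret E: normed_space E by fact
  note [simp] = iso_closed[OF i] E.add_closed E.scale_closed
  have "inj_on i (ncar E)"
  proof (rule inj_onI)
    fix x y assume xy: "x \<in> ncar E" "y \<in> ncar E" and eq: "i x = i y"
    have "i (nsub E x y) = i (nsub E x x)"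
      using xy eq by (simp add: nsub_def iso_add[OF i] iso_scale[OF i])
    then have "nnorm E (nsub E x y) = nnorm E (nsub E x x)"
      using iso_norm[OF i] xy E.sub_closed by metis
    then show "x = y" using E.norm_sub_eq_zero_iff xy by metis
  qed
  define k where "k = restrict (inv_into (ncar E) i) (ncar F)"
  have ki: "k (i x) = x" if "x \<in> ncar E" for x
    using that \<open>inj_on i (ncar E)\<close> by (simp add: k_def)
  have ik: "i (k y) = y" and kE: "k y \<in> ncar E" if "y \<in> ncar F" for y
    using that iso_image[OF i] by (auto simp: k_def f_inv_into_f inv_into_into)
  have FE: "\<exists>x\<in>ncar E. y = i x" if "y \<in> ncar F" for y
    using that iso_image[OF i] by blast
  have "isometric_iso F E k"
    unfolding isometric_iso_def
  proof (intro conjI ballI)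
    show "k \<in> linear_maps F E"
      unfolding linear_maps_def
    proof (intro CollectI conjI ballI allI)
      show "k \<in> ncar F \<rightarrow>\<^sub>E ncar E" using kE by (auto simp: k_def)
      show "k (nadd F x y) = nadd E (k x) (k y)" if xy: "x \<in> ncar F" "y \<in> ncar F" for x y
      proof -
        obtain a b where "a \<in> ncar E" "b \<in> ncar E" "x = i a" "y = i b" using FE xy by metis
        then show ?thesis using ki by (simp flip: iso_add[OF i])
      qed
      show "k (nscale F c x) = nscale E c (k x)" if x: "x \<in> ncar F" for c x
      proof -
        obtain a where "a \<in> ncar E" "x = i a" using FE x by metis
        then show ?thesis using ki by (simp flip: iso_scale[OF i])
      qed
    qed
    show "k ` ncar F = ncar E"
      using ki by (simp add: image_image flip: iso_image[OF i])
    show "nnorm E (k y) = nnorm F y" if "y \<in> ncar F" for y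
      using iso_norm[OF i kE[OF that]] ik[OF that] by simp
  qed
  then show thesis using that ki ik by blast
qed

text \<open>Only the cardinality of the carrier matters: the structure is carried over along an injection.\<close>

lemma has_copy_if_injects:
  assumes E: "banach_space E" and h: "inj_on (h :: 'a \<Rightarrow> 'u) (ncar E)"
  shows "has_copy TYPE('u) E"
proof -
  interpret E: normed_space E using E by (simp add: banach_space_def)
  note [simp] = E.add_closed E.scale_closed E.zero_closed
  let ?k = "inv_into (ncar E) h"
  define E' where "E' = \<lparr>ncar = h ` ncar E, nzero = h (nzero E),
    nadd = (\<lambda>u v. h (nadd E (?k u) (?k v))), nscale = (\<lambda>c u. h (nscale E c (?k u))),
    nnorm = (\<lambda>u. nnorm E (?k u))\<rparr>"
  have k: "?k (h x) = x" if "x \<in> ncar E" for x using h that by simp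
  have sim: "ncar E' = h ` ncar E" "nzero E' = h (nzero E)"
    "\<And>x y. \<lbrakk>x \<in> ncar E; y \<in> ncar E\<rbrakk> \<Longrightarrow> nadd E' (h x) (h y) = h (nadd E x y)"
    "\<And>c x. x \<in> ncar E \<Longrightarrow> nscale E' c (h x) = h (nscale E c x)"
    "\<And>x. x \<in> ncar E \<Longrightarrow> nnorm E' (h x) = nnorm E x"
    using k by (simp_all add: E'_def)
  have inj: "h x = h y \<longleftrightarrow> x = y" if "x \<in> ncar E" "y \<in> ncar E" for x y
    using h that by (auto simp: inj_on_def)
  interpret E': normed_space E'
    by unfold_locales
      (auto simp: sim inj E.add_assoc E.add_zero E.add_neg E.scale_one E.scale_scale E.scale_add_left
        E.scale_add_right E.norm_nonneg E.norm_eq_zero E.norm_scale E.norm_triangle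
        intro!: arg_cong[where f = h] E.add_commute)
  have dist: "ndist E' (h x) (h y) = ndist E x y" if "x \<in> ncar E" "y \<in> ncar E" for x y
    using that by (simp add: ndist_def nsub_def sim)
  interpret M: Metric_space "ncar E" "ndist E" by (rule E.metric)
  interpret M': Metric_space "ncar E'" "ndist E'" by (rule E'.metric)
  have "M'.mcomplete"
    unfolding M'.mcomplete_def
  proof (intro allI impI)
    fix s assume s: "M'.MCauchy s"
    then have "range s \<subseteq> ncar E'" unfolding M'.MCauchy_def by blast
    then have "range s \<subseteq> h ` ncar E" by (simp only: sim(1))
    then have "\<forall>n. \<exists>x. x \<in> ncar E \<and> s n = h x" by blast
    then obtain t where t: "\<And>n. t n \<in> ncar E" "\<And>n. s n = h (t n)" by metis
    have "M.MCauchy t"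
      using s t unfolding M'.MCauchy_def M.MCauchy_def by (auto simp: dist)
    then obtain l where "limitin M.mtopology t l sequentially"
      using E by (auto simp: banach_space_def M.mcomplete_def)
    then have "limitin M'.mtopology s (h l) sequentially"
      using t unfolding M.limit_metric_sequentially M'.limit_metric_sequentially by (simp add: dist sim)
    then show "\<exists>l. limitin M'.mtopology s l sequentially" ..
  qed
  then have "banach_space E'" by (simp add: banach_space_def E'.normed_space_axioms)
  moreover have "isometric_iso E E' (restrict h (ncar E))"
    by (auto simp: isometric_iso_def linear_maps_def sim)
  ultimately show ?thesis unfolding has_copy_def by blast
qed

lemma copy_injection:
  assumes E: "normed_space E" and "has_copy TYPE('u) E"
  obtains h :: "'a \<Rightarrow> 'u" where "inj_on h (ncar (E :: 'a nspace))"
proof -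
  obtain E' :: "'u nspace" and i where i: "isometric_iso E E' i" using assms by (auto simp: has_copy_def)
  obtain k where "\<And>x. x \<in> ncar E \<Longrightarrow> k (i x) = x" using iso_inverse[OF E i] by metis
  then have "inj_on i (ncar E)" by (metis inj_onI)
  then show thesis by (rule that)
qed

lemma ideal_comp:
  assumes "operator_ideal A" "banach_space E0" "banach_space E" "banach_space F" "banach_space F0"
    "S \<in> ops E0 E" "T \<in> A E F" "R \<in> ops F F0"
  shows "compose (ncar E0) R (compose (ncar E0) T S) \<in> A E0 F0"
  using assms unfolding operator_ideal_def by blast

lemma ideal_ops_operator: "T \<in> ideal_ops A E F \<Longrightarrow> T \<in> ops E F"
  by (simp add: ideal_ops_def)

text \<open>Membership in \<open>ideal_ops\<close> asserts membership in the ideal for one choice of copies; composing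
  with the isometries between two copies shows that every choice gives the same result.\<close>

lemma ideal_ops_between_copies:
  assumes A: "operator_ideal A" and T: "T \<in> ideal_ops A E F"
    and E: "normed_space E" and F: "normed_space F"
    and E1: "banach_space E1" and F1: "banach_space F1"
    and a: "a \<in> ops E1 E" and b: "b \<in> ops F F1"
  shows "compose (ncar E1) b (compose (ncar E1) T a) \<in> A E1 F1"
proof -
  obtain E' F' i j where E': "banach_space E'" and F': "banach_space F'"
    and i: "isometric_iso E' E i" and j: "isometric_iso F F' j"
    and TA: "compose (ncar E') j (compose (ncar E') T i) \<in> A E' F'"
    using T by (auto simp: ideal_ops_def)
  have E'n: "normed_space E'" and F'n: "normed_space F'" and E1n: "normed_space E1" and F1n: "normed_space F1"
    using E' F' E1 F1 by (auto simp: banach_space_def)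
  note pre = E'n[THEN normed_space.pre_normed] F'n[THEN normed_space.pre_normed]
    E[THEN normed_space.pre_normed] F[THEN normed_space.pre_normed] E1n[THEN normed_space.pre_normed]
  obtain i' where i': "isometric_iso E E' i'" "\<And>y. y \<in> ncar E \<Longrightarrow> i (i' y) = y"
    using iso_inverse[OF E'n i] by metis
  obtain j' where j': "isometric_iso F' F j'" "\<And>x. x \<in> ncar F \<Longrightarrow> j' (j x) = x"
    using iso_inverse[OF F j] by metis
  have S: "compose (ncar E1) i' a \<in> ops E1 E'"
    by (rule compose_operators[OF pre(5,3) E'n a iso_operator[OF i'(1)]])
  have R: "compose (ncar F') b j' \<in> ops F' F1"
    by (rule compose_operators[OF pre(2,4) F1n iso_operator[OF j'(1)] b])
  have "compose (ncar E1) (compose (ncar F') b j')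
      (compose (ncar E1) (compose (ncar E') j (compose (ncar E') T i)) (compose (ncar E1) i' a)) \<in> A E1 F1"
    by (rule ideal_comp[OF A E1 E' F' F1 S TA R])
  also have "compose (ncar E1) (compose (ncar F') b j')
      (compose (ncar E1) (compose (ncar E') j (compose (ncar E') T i)) (compose (ncar E1) i' a))
    = compose (ncar E1) b (compose (ncar E1) T a)"
  proof
    fix x
    show "compose (ncar E1) (compose (ncar F') b j')
      (compose (ncar E1) (compose (ncar E') j (compose (ncar E') T i)) (compose (ncar E1) i' a)) x
      = compose (ncar E1) b (compose (ncar E1) T a) x"
    proof (cases "x \<in> ncar E1")
      case True
      then have "a x \<in> ncar E" by (rule operators_closed[OF a])
      then show ?thesis
        using True iso_closed[OF i'(1)] i'(2) j'(2) iso_closed[OF j] operators_closed[OF ideal_ops_operator[OF T]]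
        by (simp add: compose_def)
    qed (simp add: compose_def)
  qed
  finally show ?thesis .
qed

lemma ideal_ops_compose:
  fixes A :: "'u op_class"
  assumes A: "operator_ideal A" and T: "T \<in> ideal_ops A E F"
    and E: "normed_space E" and F: "normed_space F" and E0: "normed_space E0" and F0: "normed_space F0"
    and cE0: "has_copy TYPE('u) E0" and cF0: "has_copy TYPE('u) F0"
    and S: "S \<in> ops E0 E" and R: "R \<in> ops F F0"
  shows "compose (ncar E0) R (compose (ncar E0) T S) \<in> ideal_ops A E0 F0"
proof -
  obtain E1 :: "'u nspace" and i where E1: "banach_space E1" and i: "isometric_iso E0 E1 i"
    using cE0 by (auto simp: has_copy_def)
  obtain F1 :: "'u nspace" and j where F1: "banach_space F1" and j: "isometric_iso F0 F1 j"
    using cF0 by (auto simp: has_copy_def)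
  obtain k where k: "isometric_iso E1 E0 k" using iso_inverse[OF E0 i] by metis
  have E1n: "normed_space E1" and F1n: "normed_space F1" using E1 F1 by (auto simp: banach_space_def)
  have T': "T \<in> ops E F" by (rule ideal_ops_operator[OF T])
  note pre = E[THEN normed_space.pre_normed] F[THEN normed_space.pre_normed]
    E0[THEN normed_space.pre_normed] F0[THEN normed_space.pre_normed] E1n[THEN normed_space.pre_normed]
  let ?RTS = "compose (ncar E0) R (compose (ncar E0) T S)"
  have RTS: "?RTS \<in> ops E0 F0"
    by (intro compose_operators[OF pre(3,2) F0] compose_operators[OF pre(3,1) F] S T' R)
  have "compose (ncar E1) (compose (ncar F) j R) (compose (ncar E1) T (compose (ncar E1) S k)) \<in> A E1 F1"
    by (intro ideal_ops_between_copies[OF A T E F E1 F1] compose_operators[OF pre(5,3) E]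
        compose_operators[OF pre(2,4) F1n] iso_operator k j S R)
  also have "compose (ncar E1) (compose (ncar F) j R) (compose (ncar E1) T (compose (ncar E1) S k))
    = compose (ncar E1) j (compose (ncar E1) ?RTS k)"
    using iso_closed[OF k] operators_closed[OF T'] operators_closed[OF S]
    by (auto simp: compose_def fun_eq_iff)
  finally show ?thesis
    unfolding ideal_ops_def using RTS E1 F1 k j by blast
qed

lemma ideal_ops_add:
  fixes A :: "'u op_class"
  assumes A: "operator_ideal A" and T1: "T1 \<in> ideal_ops A E F" and T2: "T2 \<in> ideal_ops A E F"
    and E: "normed_space E" and F: "normed_space F"
    and sum: "nadd (operators E F) T1 T2 \<in> ops E F"
  shows "nadd (operators E F) T1 T2 \<in> ideal_ops A E F"
proof -
  obtain E' F' :: "'u nspace" and i j where E': "banach_space E'" and F': "banach_space F'"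
    and i: "isometric_iso E' E i" and j: "isometric_iso F F' j"
    using T1 unfolding ideal_ops_def by blast
  let ?c = "\<lambda>T. compose (ncar E') j (compose (ncar E') T i)"
  have "?c T1 \<in> A E' F'" "?c T2 \<in> A E' F'"
    by (intro ideal_ops_between_copies[OF A _ E F E' F'] iso_operator i j T1 T2)+
  moreover have "lin_subspace (operators E' F') (A E' F')"
    using A E' F' by (auto simp: operator_ideal_def)
  ultimately have "nadd (operators E' F') (?c T1) (?c T2) \<in> A E' F'"
    by (simp add: lin_subspace_def)
  also have "nadd (operators E' F') (?c T1) (?c T2) = ?c (nadd (operators E F) T1 T2)"
    using iso_closed[OF i] iso_add[OF j] operators_closed[OF ideal_ops_operator[OF T1]]
      operators_closed[OF ideal_ops_operator[OF T2]]
    by (auto simp: compose_def operators_simps fun_eq_iff)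
  finally show ?thesis
    unfolding ideal_ops_def using sum E' F' i j by blast
qed

text \<open>The adjoint of a surjection is injective, so the dual of the target has room where the dual of the
  source has.\<close>

lemma dual_has_copy_of_image:
  assumes E: "normed_space E" and F: "normed_space F" and T: "T \<in> ops E F" and surj: "T ` ncar E = ncar F"
    and c: "has_copy TYPE('u) (dual_space E)"
  shows "has_copy TYPE('u) (dual_space F)"
proof -
  note pre = E[THEN normed_space.pre_normed] F[THEN normed_space.pre_normed]
  obtain h :: "_ \<Rightarrow> 'u" where h: "inj_on h (dual E)"
    using copy_injection[OF dual_normed[OF pre(1)] c] by blast
  let ?a = "adjoint_op E F T"
  have "inj_on ?a (dual F)"
  proof (rule inj_onI)
    fix \<phi> \<psi> assume p: "\<phi> \<in> dual F" "\<psi> \<in> dual F" and eq: "?a \<phi> = ?a \<psi>"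
    show "\<phi> = \<psi>"
    proof (rule dual_eqI[OF p])
      fix y assume "y \<in> ncar F"
      then obtain x where x: "x \<in> ncar E" "y = T x" using surj by blast
      have "?a \<phi> x = ?a \<psi> x" using eq by simp
      then show "\<phi> y = \<psi> y" using x p by (simp add: adjoint_apply)
    qed
  qed
  moreover have "?a ` dual F \<subseteq> dual E"
    using operators_closed[OF adjoint_operator[OF pre(1) F T]] by blast
  ultimately have "inj_on (h \<circ> ?a) (dual F)"
    using h by (intro comp_inj_on) (auto intro: inj_on_subset)
  then show ?thesis by (rule has_copy_if_injects[OF dual_banach[OF pre(2)]])
qed

text \<open>Self-duality is assumed inside the universe only. It is applied to copies of \<open>E\<close> and \<open>F\<close>, whose
  duals have room there because the duals of \<open>E\<close> and \<open>F\<close> have, and the isometries are undone by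
  composing with their adjoints.\<close>

lemma ideal_ops_adjoint:
  fixes A :: "'u op_class"
  assumes A: "operator_ideal A" and sd: "self_dual_ideal A" and T: "T \<in> ideal_ops A E F"
    and E: "normed_space E" and F: "normed_space F"
    and cE: "has_copy TYPE('u) (dual_space E)" and cF: "has_copy TYPE('u) (dual_space F)"
  shows "adjoint_op E F T \<in> ideal_ops A (dual_space F) (dual_space E)"
proof -
  obtain E' F' i j where E': "banach_space E'" and F': "banach_space F'"
    and i: "isometric_iso E' E i" and j: "isometric_iso F F' j"
    and TA: "compose (ncar E') j (compose (ncar E') T i) \<in> A E' F'"
    using T by (auto simp: ideal_ops_def)
  let ?T = "compose (ncar E') j (compose (ncar E') T i)"
  have E'n: "normed_space E'" and F'n: "normed_space F'" using E' F' by (auto simp: banach_space_def)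
  note pre = E[THEN normed_space.pre_normed] F[THEN normed_space.pre_normed]
    E'n[THEN normed_space.pre_normed] F'n[THEN normed_space.pre_normed]
  obtain i' where i': "isometric_iso E E' i'" "\<And>y. y \<in> ncar E \<Longrightarrow> i (i' y) = y"
    using iso_inverse[OF E'n i] by metis
  obtain j' where j': "isometric_iso F' F j'" "\<And>x. x \<in> ncar F \<Longrightarrow> j' (j x) = x"
    using iso_inverse[OF F j] by metis
  have cE': "has_copy TYPE('u) (dual_space E')" by (rule dual_has_copy_of_image[OF E E'n iso_operator[OF i'(1)] iso_image[OF i'(1)] cE])
  have cF': "has_copy TYPE('u) (dual_space F')" by (rule dual_has_copy_of_image[OF F F'n iso_operator[OF j] iso_image[OF j] cF])
  have "?T \<in> dual_ideal A E' F'"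
    using sd TA E' F' cE' cF' unfolding self_dual_ideal_def by blast
  then have adj: "adjoint_op E' F' ?T \<in> ideal_ops A (dual_space F') (dual_space E')"
    by (simp add: dual_ideal_def)
  have "compose (dual F) (adjoint_op E E' i')
      (compose (dual F) (adjoint_op E' F' ?T) (adjoint_op F' F j'))
    \<in> ideal_ops A (dual_space F) (dual_space E)"
    by (intro ideal_ops_compose[OF A adj] dual_normed pre cE cF
        adjoint_operator[OF pre(1) E'n] adjoint_operator[OF pre(4) F] iso_operator i'(1) j'(1))
  also have "compose (dual F) (adjoint_op E E' i')
      (compose (dual F) (adjoint_op E' F' ?T) (adjoint_op F' F j')) = adjoint_op E F T"
  proof
    fix \<phi>
    show "compose (dual F) (adjoint_op E E' i')
      (compose (dual F) (adjoint_op E' F' ?T) (adjoint_op F' F j')) \<phi> = adjoint_op E F T \<phi>"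
    proof (cases "\<phi> \<in> dual F")
      case True
      have 1: "adjoint_op F' F j' \<phi> \<in> dual F'"
        by (rule operators_closed[OF adjoint_operator[OF pre(4) F iso_operator[OF j'(1)]] True])
      have 2: "adjoint_op E' F' ?T (adjoint_op F' F j' \<phi>) \<in> dual E'"
        using operators_closed[OF ideal_ops_operator[OF adj] 1] .
      note T' = operators_closed[OF ideal_ops_operator[OF T]]
      have "adjoint_op E E' i' (adjoint_op E' F' ?T (adjoint_op F' F j' \<phi>)) x = adjoint_op E F T \<phi> x" for x
      proof (cases "x \<in> ncar E")
        case x: True
        have i'x: "i' x \<in> ncar E'" by (rule iso_closed[OF i'(1) x])
        have "adjoint_op E E' i' (adjoint_op E' F' ?T (adjoint_op F' F j' \<phi>)) x
            = adjoint_op F' F j' \<phi> (?T (i' x))"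
          unfolding adjoint_apply[OF 2 x] adjoint_apply[OF 1 i'x] ..
        also have "?T (i' x) = j (T x)" using i'x i'(2)[OF x] by (simp add: compose_def)
        also have "adjoint_op F' F j' \<phi> (j (T x)) = \<phi> (T x)"
          using adjoint_apply[OF True iso_closed[OF j T'[OF x]]] j'(2)[OF T'[OF x]] by simp
        finally show ?thesis by (simp add: adjoint_apply[OF True x])
      next
        case False
        then show ?thesis using True 2 by (simp add: adjoint_op_def)
      qed
      then show ?thesis using True by (auto simp: compose_def)
    next
      case False
      then show ?thesis by (simp add: compose_def adjoint_op_def)
    qed
  qed
  finally show ?thesis .
qed

section \<open>Approximating filters and weak-star compactness\<close>

text \<open>A filter on the approximating set that converges pointwise replaces an approximating net;
  convergence at a point is \<open>\<tau>\<^sub>c\<close>-convergence on a one-point compact set.\<close>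

lemma tau_c_closure_filter:
  assumes E: "normed_space E" and F: "normed_space F" and f: "f \<in> tau_c E F closure_of S"
  obtains H where "H \<noteq> bot" "\<forall>\<^sub>F g in H. g \<in> S"
    "\<And>x. x \<in> ncar E \<Longrightarrow> ((\<lambda>g. ndist F (g x) (f x)) \<longlongrightarrow> 0) H"
proof -
  interpret E: normed_space E by fact
  interpret F: normed_space F by fact
  interpret FM: Metric_space "ncar F" "ndist F" by (rule F.metric)
  let ?T = "tau_c E F"
  have op: "openin ?T U \<longleftrightarrow> tau_c_open E F U" for U
    unfolding tau_c_def by (simp add: topology_inverse' istopology_tau_c_open)
  have fT: "f \<in> topspace ?T" using f by (simp add: in_closure_of)
  then have fc: "f \<in> cont_maps E F"
    by (metis op openin_topspace subsetD tau_c_open_def)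
  have car: "g x \<in> ncar F" if "g \<in> cont_maps E F" "x \<in> ncar E" for g x
    using that continuous_map_image_subset_topspace[of "ntop E" "ntop F" g]
    by (auto simp: cont_maps_def E.topspace_ntop F.topspace_ntop)
  let ?H = "inf (nhdsin ?T f) (principal S)"
  show thesis
  proof (rule that[of ?H])
    show "?H \<noteq> bot"
    proof
      assume "?H = bot"
      then have "eventually (\<lambda>_. False) ?H" by simp
      then have "eventually (\<lambda>g. g \<notin> S) (nhdsin ?T f)" by (simp add: eventually_inf_principal)
      then obtain U where "openin ?T U" "f \<in> U" "\<forall>g\<in>U. g \<notin> S"
        using fT by (auto simp: eventually_nhdsin)
      then show False using f by (auto simp: in_closure_of)
    qed
    show "\<forall>\<^sub>F g in ?H. g \<in> S" by (simp add: eventually_inf_principal)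
    fix x assume x: "x \<in> ncar E"
    have "\<forall>\<^sub>F g in nhdsin ?T f. ndist F (g x) (f x) < e" if e: "e > 0" for e
    proof -
      let ?U = "{g \<in> cont_maps E F. ndist F (g x) (f x) < e}"
      have "tau_c_open E F ?U"
        unfolding tau_c_open_def
      proof (intro conjI ballI)
        fix g assume g: "g \<in> ?U"
        have "compactin (ntop E) {x}" using x by (simp add: E.topspace_ntop)
        moreover have "e - ndist F (g x) (f x) > 0" using g by simp
        moreover have "{h \<in> cont_maps E F. \<forall>y\<in>{x}. ndist F (h y) (g y) < e - ndist F (g x) (f x)} \<subseteq> ?U"
        proof
          fix h assume h: "h \<in> {h \<in> cont_maps E F. \<forall>y\<in>{x}. ndist F (h y) (g y) < e - ndist F (g x) (f x)}"
          then have "ndist F (h x) (f x) \<le> ndist F (h x) (g x) + ndist F (g x) (f x)"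
            using FM.triangle car x g fc by simp
          then show "h \<in> ?U" using h by auto
        qed
        ultimately show "\<exists>K d. compactin (ntop E) K \<and> d > 0 \<and>
            {h \<in> cont_maps E F. \<forall>y\<in>K. ndist F (h y) (g y) < d} \<subseteq> ?U" by meson
      qed auto
      moreover have "f \<in> ?U" using fc e FM.mdist_zero[OF car[OF fc x]] by simp
      ultimately show ?thesis unfolding eventually_nhdsin op by blast
    qed
    then show "((\<lambda>g. ndist F (g x) (f x)) \<longlongrightarrow> 0) ?H"
    proof (intro tendstoI)
      fix e :: real assume "e > 0"
      then have "\<forall>\<^sub>F g in nhdsin ?T f. ndist F (g x) (f x) < e" by fact
      then show "\<forall>\<^sub>F g in ?H. dist (ndist F (g x) (f x)) 0 < e"
        unfolding eventually_inf_principal by eventually_elim (simp add: FM.nonneg)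
    qed
  qed
qed

text \<open>Weak-star compactness of balls of operators into a dual space. The scalars \<open>R i e f\<close> stay in compact
  intervals, so Tychonoff's theorem provides a cluster point and a finer filter that converges to it;
  linearity passes to pointwise limits.\<close>

lemma operators_into_dual_compactness:
  fixes R :: "'i \<Rightarrow> 'a \<Rightarrow> 'b \<Rightarrow> real"
  assumes E: "pre_normed E" and F: "pre_normed F" and l: "0 \<le> l" and G: "G \<noteq> bot"
    and R: "\<forall>\<^sub>F i in G. R i \<in> ops E (dual_space F)"
    and bound: "\<forall>\<^sub>F i in G. \<forall>e\<in>ncar E. \<forall>f\<in>ncar F. \<bar>R i e f\<bar> \<le> l * nnorm E e * nnorm F f"
  obtains G' U where "G' \<noteq> bot" "G' \<le> G" "U \<in> ops E (dual_space F)"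
    "\<And>e f. \<lbrakk>e \<in> ncar E; f \<in> ncar F\<rbrakk> \<Longrightarrow> ((\<lambda>i. R i e f) \<longlongrightarrow> U e f) G'"
    "\<And>e f. \<lbrakk>e \<in> ncar E; f \<in> ncar F\<rbrakk> \<Longrightarrow> \<bar>U e f\<bar> \<le> l * nnorm E e * nnorm F f"
proof -
  interpret E: pre_normed E by fact
  interpret F: pre_normed F by fact
  let ?car = "ncar E \<times> ncar F"
  define \<Phi> where "\<Phi> i p = (if p \<in> ?car then R i (fst p) (snd p) else 0)" for i p
  define b where "b p = (if p \<in> ?car then l * nnorm E (fst p) * nnorm F (snd p) else 0)" for p
  define K where "K = PiE UNIV (\<lambda>p. cball (0::real) (b p))"
  have "compactin (product_topology (\<lambda>_::'a \<times> 'b. euclidean) UNIV) K"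
    unfolding K_def compactin_PiE by auto
  then have "compact K" by (simp add: euclidean_product_topology)
  moreover have "filtermap \<Phi> G \<noteq> bot" using G by (simp add: filtermap_bot_iff)
  moreover have "\<forall>\<^sub>F g in filtermap \<Phi> G. g \<in> K"
    unfolding eventually_filtermap using bound
    by eventually_elim (auto simp: K_def \<Phi>_def b_def)
  ultimately obtain g where g: "g \<in> K" and cl: "inf (nhds g) (filtermap \<Phi> G) \<noteq> bot"
    unfolding compact_filter by blast
  define G' where "G' = inf G (filtercomap \<Phi> (nhds g))"
  have G'G: "G' \<le> G" by (simp add: G'_def)
  have G': "G' \<noteq> bot"
  proof
    assume "G' = bot"
    then have "eventually (\<lambda>_. False) G'" by simp
    then obtain P Q where P: "eventually P G" and Q: "eventually Q (filtercomap \<Phi> (nhds g))"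
      and PQ: "\<And>i. P i \<Longrightarrow> Q i \<Longrightarrow> False"
      unfolding G'_def eventually_inf by blast
    obtain Q' where Q': "eventually Q' (nhds g)" "\<And>i. Q' (\<Phi> i) \<Longrightarrow> Q i"
      using Q unfolding eventually_filtercomap by blast
    have "eventually (\<lambda>h. \<not> Q' h) (filtermap \<Phi> G)"
      unfolding eventually_filtermap using P by eventually_elim (use PQ Q' in blast)
    then have "eventually (\<lambda>_. False) (inf (nhds g) (filtermap \<Phi> G))"
      unfolding eventually_inf using Q'(1) by blast
    then show False using cl by (simp add: trivial_limit_def)
  qed
  have "filterlim \<Phi> (nhds g) G'"
    using filterlim_filtercomap filterlim_mono[OF _ order_refl] unfolding G'_def by (metis inf.cobounded2)
  then have lim0: "((\<lambda>i. \<Phi> i p) \<longlongrightarrow> g p) G'" for p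
  proof -
    have "filterlim (\<lambda>h. h p) (nhds (g p)) (nhds g)"
    proof (rule topological_tendstoI)
      fix S :: "real set" assume "open S" "g p \<in> S"
      then have "open ((\<lambda>h. h p) -` S)" "g \<in> (\<lambda>h. h p) -` S"
        by (auto intro: open_vimage continuous_on_product_coordinates)
      then show "\<forall>\<^sub>F h in nhds g. h p \<in> S" unfolding eventually_nhds by blast
    qed
    then show ?thesis using filterlim_compose \<open>filterlim \<Phi> (nhds g) G'\<close> by blast
  qed
  have lim: "((\<lambda>i. R i e f) \<longlongrightarrow> g (e, f)) G'" if "e \<in> ncar E" "f \<in> ncar F" for e f
    using lim0[of "(e, f)"] that by (simp add: \<Phi>_def)
  have gb: "\<bar>g (e, f)\<bar> \<le> l * nnorm E e * nnorm F f" if "e \<in> ncar E" "f \<in> ncar F" for e f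
  proof -
    have "g (e, f) \<in> cball 0 (b (e, f))" using g by (auto simp: K_def)
    then show ?thesis using that by (simp add: b_def)
  qed
  have RG': "\<forall>\<^sub>F i in G'. R i \<in> ops E (dual_space F)"
    using R G'G by (simp add: filter_leD)
  define U where "U = (\<lambda>e\<in>ncar E. \<lambda>f\<in>ncar F. g (e, f))"
  have uniq: "a = c" if "((\<lambda>i. s i) \<longlongrightarrow> a) G'" "((\<lambda>i. t i) \<longlongrightarrow> c) G'" "\<forall>\<^sub>F i in G'. s i = t i"
    for s t :: "'i \<Rightarrow> real" and a c
    using tendsto_unique[OF G' that(1)] tendsto_cong[OF that(3)] that(2) by blast
  have Ue: "U e \<in> dual F" if e: "e \<in> ncar E" for e
  proof (rule dualI[where C = "l * nnorm E e"])
    show "U e \<in> extensional (ncar F)" using e by (simp add: U_def)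
    show "U e (nadd F x y) = U e x + U e y" if xy: "x \<in> ncar F" "y \<in> ncar F" for x y
    proof -
      have "g (e, nadd F x y) = g (e, x) + g (e, y)"
        by (rule uniq[OF lim[OF e F.add_closed[OF xy]] tendsto_add[OF lim[OF e xy(1)] lim[OF e xy(2)]]],
            use RG' in eventually_elim)
          (use dual_add[OF operators_closed[OF _ e] xy] in blast)
      then show ?thesis using e xy F.add_closed by (simp add: U_def)
    qed
    show "U e (nscale F c x) = c * U e x" if x: "x \<in> ncar F" for c x
    proof -
      have "g (e, nscale F c x) = c * g (e, x)"
        by (rule uniq[OF lim[OF e F.scale_closed[OF x]] tendsto_mult_left[OF lim[OF e x]]],
            use RG' in eventually_elim)
          (use dual_scale[OF operators_closed[OF _ e] x] in blast)
      then show ?thesis using e x F.scale_closed by (simp add: U_def)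
    qed
    show "\<bar>U e x\<bar> \<le> l * nnorm E e * nnorm F x" if "x \<in> ncar F" for x
      using gb[OF e that] e that by (simp add: U_def)
  qed
  have "U \<in> ops E (dual_space F)"
  proof (rule operatorsI[where C = l])
    show "U \<in> extensional (ncar E)" by (simp add: U_def)
    show "U (nadd E x y) = nadd (dual_space F) (U x) (U y)" if xy: "x \<in> ncar E" "y \<in> ncar E" for x y
    proof -
      have "g (nadd E x y, f) = g (x, f) + g (y, f)" if f: "f \<in> ncar F" for f
        by (rule uniq[OF lim[OF E.add_closed[OF xy] f] tendsto_add[OF lim[OF xy(1) f] lim[OF xy(2) f]]],
            use RG' in eventually_elim)
          (simp add: operators_add xy dual_simps f)
      then show ?thesis using xy E.add_closed by (auto simp: U_def dual_simps)
    qed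
    show "U (nscale E c x) = nscale (dual_space F) c (U x)" if x: "x \<in> ncar E" for c x
    proof -
      have "g (nscale E c x, f) = c * g (x, f)" if f: "f \<in> ncar F" for f
        by (rule uniq[OF lim[OF E.scale_closed[OF x] f] tendsto_mult_left[OF lim[OF x f]]],
            use RG' in eventually_elim)
          (simp add: operators_scale x dual_simps f)
      then show ?thesis using x E.scale_closed by (auto simp: U_def dual_simps)
    qed
    show "nnorm (dual_space F) (U x) \<le> l * nnorm E x" if "x \<in> ncar E" for x
      by (rule dual_norm_le[OF F]) (use that gb l E.norm_nonneg in \<open>auto simp: U_def\<close>)
  qed (rule Ue)
  then show thesis
    using that[OF G' G'G] lim gb by (simp add: U_def)
qed

section \<open>The projective tensor product and weak-star closures\<close>

lemma alg_tensor_simps: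
  "ncar (alg_tensor E F) = tensor_sum E F ` lists (ncar E \<times> ncar F)"
  "nzero (alg_tensor E F) = (\<lambda>B\<in>bilinear_forms E F. 0)"
  "nadd (alg_tensor E F) u v = (\<lambda>B\<in>bilinear_forms E F. u B + v B)"
  "nscale (alg_tensor E F) c u = (\<lambda>B\<in>bilinear_forms E F. c * u B)"
  "nnorm (alg_tensor E F) = proj_norm E F"
  by (simp_all add: alg_tensor_def map_space_def)

definition tensor_weight :: "'a nspace \<Rightarrow> 'b nspace \<Rightarrow> ('a \<times> 'b) list \<Rightarrow> real" where
  "tensor_weight E F ps = (\<Sum>(e, f)\<leftarrow>ps. nnorm E e * nnorm F f)"

lemma tensor_weight_nonneg:
  assumes "pre_normed E" "pre_normed F" "ps \<in> lists (ncar E \<times> ncar F)"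
  shows "0 \<le> tensor_weight E F ps"
  unfolding tensor_weight_def using assms
  by (intro sum_list_nonneg) (auto intro!: mult_nonneg_nonneg pre_normed.norm_nonneg)

lemma proj_norm_le:
  assumes "pre_normed E" "pre_normed F" "ps \<in> lists (ncar E \<times> ncar F)" "tensor_sum E F ps = u"
  shows "proj_norm E F u \<le> tensor_weight E F ps"
  unfolding proj_norm_def tensor_weight_def[symmetric]
  by (rule cInf_lower) (use assms tensor_weight_nonneg in \<open>auto intro!: bdd_belowI[of _ 0]\<close>)

lemma le_proj_norm:
  assumes "u \<in> ncar (alg_tensor E F)"
    and "\<And>ps. \<lbrakk>ps \<in> lists (ncar E \<times> ncar F); tensor_sum E F ps = u\<rbrakk> \<Longrightarrow> a \<le> tensor_weight E F ps"
  shows "a \<le> proj_norm E F u"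
  unfolding proj_norm_def tensor_weight_def[symmetric]
  by (rule cInf_greatest) (use assms in \<open>auto simp: alg_tensor_simps\<close>)

lemma bilinear_scale_left:
  assumes "B \<in> bilinear_forms E F" "e \<in> ncar E" "f \<in> ncar F" "pre_normed E"
  shows "B (nscale E c e, f) = c * B (e, f)"
proof -
  have "(\<lambda>e\<in>ncar E. B (e, f)) (nscale E c e) = c * (\<lambda>e\<in>ncar E. B (e, f)) e"
    using assms by (auto simp: bilinear_forms_def linear_maps_def simp del: restrict_apply)
  then show ?thesis using assms pre_normed.scale_closed by fastforce
qed

text \<open>Concatenating representations adds tensors, and scaling the left factors of a representation scales
  the tensor by \<open>c\<close> and the weight by \<open>\<bar>c\<bar>\<close>.\<close>

lemma alg_tensor_pre_normed:
  assumes E: "normed_space E" and F: "pre_normed F"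
  shows "pre_normed (alg_tensor E F)"
proof -
  interpret E: normed_space E by fact
  interpret F: pre_normed F by fact
  note Ep = E.pre_normed
  let ?V = "alg_tensor E F" and ?L = "lists (ncar E \<times> ncar F)"
  have zero: "tensor_sum E F [] = nzero ?V" by (simp add: tensor_sum_def alg_tensor_simps)
  have scale: "\<exists>qs\<in>?L. tensor_sum E F qs = nscale ?V c (tensor_sum E F ps)
      \<and> tensor_weight E F qs = \<bar>c\<bar> * tensor_weight E F ps" if ps: "ps \<in> ?L" for c ps
  proof -
    let ?qs = "map (\<lambda>(e, f). (nscale E c e, f)) ps"
    have "?qs \<in> ?L" using ps by (auto intro!: E.scale_closed)
    moreover have "tensor_sum E F ?qs = nscale ?V c (tensor_sum E F ps)"
    proof -
      have "(\<Sum>p\<leftarrow>?qs. B p) = c * (\<Sum>p\<leftarrow>ps. B p)" if "B \<in> bilinear_forms E F" for B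
        using ps by (induction ps) (auto simp: algebra_simps bilinear_scale_left[OF that _ _ Ep])
      then show ?thesis by (auto simp: tensor_sum_def alg_tensor_simps)
    qed
    moreover have "tensor_weight E F ?qs = \<bar>c\<bar> * tensor_weight E F ps"
      using ps unfolding tensor_weight_def by (induction ps) (auto simp: algebra_simps E.norm_scale)
    ultimately show ?thesis by blast
  qed
  show ?thesis
  proof unfold_locales
    show z: "nzero ?V \<in> ncar ?V" unfolding zero[symmetric] by (auto simp: alg_tensor_simps)
    show nn: "0 \<le> nnorm ?V u" if "u \<in> ncar ?V" for u
      unfolding alg_tensor_simps by (rule le_proj_norm[OF that]) (rule tensor_weight_nonneg[OF Ep F])
    have "proj_norm E F (nzero ?V) \<le> tensor_weight E F []"
      by (rule proj_norm_le[OF Ep F _ zero]) simp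
    then show nz: "nnorm ?V (nzero ?V) = 0"
      using nn[OF z] by (simp add: alg_tensor_simps(5) tensor_weight_def)
    show "nadd ?V u v \<in> ncar ?V" if uv: "u \<in> ncar ?V" "v \<in> ncar ?V" for u v
    proof -
      obtain ps qs where "ps \<in> ?L" "qs \<in> ?L" "u = tensor_sum E F ps" "v = tensor_sum E F qs"
        using uv unfolding alg_tensor_simps(1) by blast
      moreover have "nadd ?V (tensor_sum E F ps) (tensor_sum E F qs) = tensor_sum E F (ps @ qs)"
        by (auto simp: alg_tensor_simps tensor_sum_def)
      ultimately show ?thesis by (auto simp: alg_tensor_simps(1))
    qed
    fix u c assume u: "u \<in> ncar ?V"
    then obtain ps where "ps \<in> ?L" "u = tensor_sum E F ps" by (auto simp: alg_tensor_simps)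
    with scale[of ps c] show "nscale ?V c u \<in> ncar ?V"
      unfolding alg_tensor_simps(1) by (metis image_eqI)
    show "nnorm ?V (nscale ?V c u) \<le> \<bar>c\<bar> * nnorm ?V u"
    proof (cases "c = 0")
      case True
      then have "nscale ?V c u = nzero ?V" by (simp add: alg_tensor_simps)
      then show ?thesis using nz True by simp
    next
      case False
      have "proj_norm E F (nscale ?V c u) / \<bar>c\<bar> \<le> proj_norm E F u"
      proof (rule le_proj_norm[OF u])
        fix ps assume ps: "ps \<in> ?L" "tensor_sum E F ps = u"
        obtain qs where "qs \<in> ?L" "tensor_sum E F qs = nscale ?V c u"
          "tensor_weight E F qs = \<bar>c\<bar> * tensor_weight E F ps"
          using scale[OF ps(1)] ps(2) by metis
        then have "proj_norm E F (nscale ?V c u) \<le> \<bar>c\<bar> * tensor_weight E F ps"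
          using proj_norm_le[OF Ep F] by metis
        then show "proj_norm E F (nscale ?V c u) / \<bar>c\<bar> \<le> tensor_weight E F ps"
          using False by (simp add: divide_le_eq mult.commute)
      qed
      then show ?thesis using False by (simp add: alg_tensor_simps(5) divide_le_eq mult.commute)
    qed
  qed
qed

lemma operator_bilinear_form:
  assumes E: "pre_normed E" and F: "pre_normed F" and T: "T \<in> ops E (dual_space F)"
  shows "(\<lambda>(e, f)\<in>ncar E \<times> ncar F. T e f) \<in> bilinear_forms E F"
proof -
  interpret E: pre_normed E by fact
  interpret F: pre_normed F by fact
  note Te = operators_closed[OF T]
  show ?thesis
    unfolding bilinear_forms_def linear_maps_def
    using dual_add[OF Te] dual_scale[OF Te] operators_add[OF T] operators_scale[OF T]
    by (auto simp: E.add_closed E.scale_closed F.add_closed F.scale_closed dual_simps)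
qed

lemma tensor_functional_on_sum:
  assumes E: "pre_normed E" and F: "pre_normed F" and T: "T \<in> ops E (dual_space F)"
    and ps: "ps \<in> lists (ncar E \<times> ncar F)"
  shows "tensor_functional E F T (tensor_sum E F ps) = (\<Sum>(e, f)\<leftarrow>ps. T e f)"
proof -
  let ?B = "\<lambda>(e, f)\<in>ncar E \<times> ncar F. T e f"
  have "tensor_sum E F ps \<in> ncar (alg_tensor E F)" using ps by (simp add: alg_tensor_simps)
  then have "tensor_functional E F T (tensor_sum E F ps) = tensor_sum E F ps ?B"
    unfolding tensor_functional_def by (rule restrict_apply')
  also have "\<dots> = sum_list (map ?B ps)"
    unfolding tensor_sum_def by (rule restrict_apply'[OF operator_bilinear_form[OF E F T]])
  also have "map ?B ps = map (\<lambda>(e, f). T e f) ps"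
    using ps by (intro map_cong) auto
  finally show ?thesis .
qed

lemma tensor_functional_dual:
  assumes E: "normed_space E" and F: "pre_normed F" and T: "T \<in> ops E (dual_space F)"
    and l: "0 < l" and bound: "\<And>e f. \<lbrakk>e \<in> ncar E; f \<in> ncar F\<rbrakk> \<Longrightarrow> \<bar>T e f\<bar> \<le> l * nnorm E e * nnorm F f"
  shows "tensor_functional E F T \<in> dual (alg_tensor E F)"
    and "nnorm (dual_space (alg_tensor E F)) (tensor_functional E F T) \<le> l"
proof -
  interpret E: normed_space E by fact
  note Ep = E.pre_normed
  let ?V = "alg_tensor E F"
  interpret V: pre_normed ?V by (rule alg_tensor_pre_normed[OF E F])
  note BT = operator_bilinear_form[OF Ep F T]
  have le: "\<bar>tensor_functional E F T u\<bar> \<le> l * nnorm ?V u" if u: "u \<in> ncar ?V" for u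
  proof -
    have "\<bar>tensor_functional E F T u\<bar> / l \<le> proj_norm E F u"
    proof (rule le_proj_norm[OF u])
      fix ps assume ps: "ps \<in> lists (ncar E \<times> ncar F)" "tensor_sum E F ps = u"
      have "\<bar>\<Sum>(e, f)\<leftarrow>ps. T e f\<bar> \<le> l * tensor_weight E F ps"
        using ps(1)
      proof (induction ps)
        case (Cons p ps)
        obtain e f where p: "p = (e, f)" by force
        then have "\<bar>T e f\<bar> \<le> l * nnorm E e * nnorm F f" using Cons bound by auto
        with Cons show ?case unfolding p tensor_weight_def by (auto simp: algebra_simps)
      qed (simp add: tensor_weight_def)
      then show "\<bar>tensor_functional E F T u\<bar> / l \<le> tensor_weight E F ps"
        using tensor_functional_on_sum[OF Ep F T ps(1)] ps(2) l by (simp add: divide_le_eq mult.commute)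
    qed
    then show ?thesis using l by (simp add: divide_le_eq mult.commute alg_tensor_simps(5))
  qed
  show "tensor_functional E F T \<in> dual ?V"
    by (rule dualI[OF _ _ _ le])
      (use BT V.add_closed V.scale_closed in
        \<open>auto simp: tensor_functional_def alg_tensor_simps(3,4) extensional_def\<close>)
  show "nnorm (dual_space ?V) (tensor_functional E F T) \<le> l"
    by (rule dual_norm_le[OF V.pre_normed_axioms _ le]) (use l in auto)
qed

text \<open>One representation works for all \<open>T\<close> of norm at most \<open>l\<close> at once, because the completion is a closure
  in the norm of the bidual.\<close>

lemma proj_tensor_approx:
  assumes E: "normed_space E" and F: "pre_normed F" and w: "w \<in> ncar (proj_tensor E F)"
    and l: "0 < l" and e: "0 < e"
  obtains ps where "ps \<in> lists (ncar E \<times> ncar F)"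
    "\<And>T. \<lbrakk>T \<in> ops E (dual_space F);
        \<And>e f. \<lbrakk>e \<in> ncar E; f \<in> ncar F\<rbrakk> \<Longrightarrow> \<bar>T e f\<bar> \<le> l * nnorm E e * nnorm F f\<rbrakk>
      \<Longrightarrow> \<bar>w (tensor_functional E F T) - (\<Sum>(e, f)\<leftarrow>ps. T e f)\<bar> \<le> e"
proof -
  interpret E: normed_space E by fact
  let ?V = "alg_tensor E F"
  let ?D = "dual_space ?V"
  interpret V: pre_normed ?V by (rule alg_tensor_pre_normed[OF E F])
  interpret D: normed_space ?D by (rule dual_normed[OF V.pre_normed_axioms])
  interpret DD: normed_space "dual_space ?D" by (rule dual_normed[OF D.pre_normed])
  have "e / l > 0" using e l by simp
  then obtain v where v: "v \<in> ncar ?V" and y: "(\<lambda>\<phi>\<in>ncar ?D. \<phi> v) \<in> dual ?D"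
    and close: "nnorm (dual_space ?D) (nsub (dual_space ?D) w (\<lambda>\<phi>\<in>ncar ?D. \<phi> v)) < e / l"
    and wD: "w \<in> dual ?D"
    using w unfolding proj_tensor_def completion_space_def ncar_sub_space DD.in_closure_iff by blast
  obtain ps where ps: "ps \<in> lists (ncar E \<times> ncar F)" "v = tensor_sum E F ps"
    using v by (auto simp: alg_tensor_simps)
  show thesis
  proof (rule that[OF ps(1)])
    fix T assume T: "T \<in> ops E (dual_space F)"
      and b: "\<And>e f. \<lbrakk>e \<in> ncar E; f \<in> ncar F\<rbrakk> \<Longrightarrow> \<bar>T e f\<bar> \<le> l * nnorm E e * nnorm F f"
    note tf = tensor_functional_dual[OF E F T l b]
    let ?d = "nsub (dual_space ?D) w (\<lambda>\<phi>\<in>ncar ?D. \<phi> v)"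
    have "\<bar>?d (tensor_functional E F T)\<bar> \<le> nnorm (dual_space ?D) ?d * nnorm ?D (tensor_functional E F T)"
      by (rule dual_bound[OF D.pre_normed DD.sub_closed[OF wD y] tf(1)])
    also have "\<dots> \<le> (e / l) * l"
      using close tf(2) D.norm_nonneg[OF tf(1)] DD.norm_nonneg[OF DD.sub_closed[OF wD y]]
      by (intro mult_mono) auto
    also have "\<dots> = e" using l by simp
    finally show "\<bar>w (tensor_functional E F T) - (\<Sum>(e, f)\<leftarrow>ps. T e f)\<bar> \<le> e"
      using tf(1) tensor_functional_on_sum[OF E.pre_normed F T ps(1)] ps(2)
      by (simp add: dual_nsub[OF D.pre_normed])
  qed
qed

lemma tendsto_sum_list:
  fixes g :: "'i \<Rightarrow> 'c \<Rightarrow> real"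
  assumes "\<And>p. p \<in> set ps \<Longrightarrow> ((\<lambda>i. g i p) \<longlongrightarrow> g0 p) H"
  shows "((\<lambda>i. \<Sum>p\<leftarrow>ps. g i p) \<longlongrightarrow> (\<Sum>p\<leftarrow>ps. g0 p)) H"
  using assms by (induction ps) (auto intro!: tendsto_add)

text \<open>On bounded sets, convergence at the elementary tensors suffices, because the algebraic tensor
  product is dense in its completion.\<close>

lemma weak_star_closure:
  assumes E: "normed_space E" and F: "pre_normed F" and l: "0 < l" and H: "H \<noteq> bot"
    and RS: "\<forall>\<^sub>F i in H. R i \<in> S"
    and R: "\<forall>\<^sub>F i in H. R i \<in> ops E (dual_space F)"
    and Rb: "\<forall>\<^sub>F i in H. \<forall>e\<in>ncar E. \<forall>f\<in>ncar F. \<bar>R i e f\<bar> \<le> l * nnorm E e * nnorm F f"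
    and T: "T \<in> ops E (dual_space F)"
    and Tb: "\<And>e f. \<lbrakk>e \<in> ncar E; f \<in> ncar F\<rbrakk> \<Longrightarrow> \<bar>T e f\<bar> \<le> l * nnorm E e * nnorm F f"
    and lim: "\<And>e f. \<lbrakk>e \<in> ncar E; f \<in> ncar F\<rbrakk> \<Longrightarrow> ((\<lambda>i. R i e f) \<longlongrightarrow> T e f) H"
  shows "T \<in> weak_star E F closure_of S"
proof -
  let ?P = "ncar (proj_tensor E F)"
  let ?f = "\<lambda>T. \<lambda>w\<in>?P. w (tensor_functional E F T)"
  let ?prod = "product_topology (\<lambda>_. euclideanreal) ?P"
  have "((\<lambda>i. w (tensor_functional E F (R i))) \<longlongrightarrow> w (tensor_functional E F T)) H" if w: "w \<in> ?P" for w
  proof (rule tendstoI)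
    fix e :: real assume e: "e > 0"
    then have "e / 3 > 0" by simp
    from proj_tensor_approx[OF E F w l this] obtain ps where ps: "ps \<in> lists (ncar E \<times> ncar F)"
      and app: "\<And>T. \<lbrakk>T \<in> ops E (dual_space F);
        \<And>e f. \<lbrakk>e \<in> ncar E; f \<in> ncar F\<rbrakk> \<Longrightarrow> \<bar>T e f\<bar> \<le> l * nnorm E e * nnorm F f\<rbrakk>
      \<Longrightarrow> \<bar>w (tensor_functional E F T) - (\<Sum>(e, f)\<leftarrow>ps. T e f)\<bar> \<le> e / 3" by metis
    have "((\<lambda>i. \<Sum>p\<leftarrow>ps. case p of (e, f) \<Rightarrow> R i e f) \<longlongrightarrow> (\<Sum>p\<leftarrow>ps. case p of (e, f) \<Rightarrow> T e f)) H"
      by (rule tendsto_sum_list) (use ps lim in auto)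
    then have "\<forall>\<^sub>F i in H. \<bar>(\<Sum>(e, f)\<leftarrow>ps. R i e f) - (\<Sum>(e, f)\<leftarrow>ps. T e f)\<bar> < e / 3"
      using tendstoD[OF _ \<open>e / 3 > 0\<close>] by (fastforce simp: dist_real_def)
    then show "\<forall>\<^sub>F i in H. dist (w (tensor_functional E F (R i))) (w (tensor_functional E F T)) < e"
      using R Rb
    proof eventually_elim
      case (elim i)
      have "\<bar>w (tensor_functional E F (R i)) - (\<Sum>(e, f)\<leftarrow>ps. R i e f)\<bar> \<le> e / 3"
        using elim by (intro app) auto
      moreover have "\<bar>w (tensor_functional E F T) - (\<Sum>(e, f)\<leftarrow>ps. T e f)\<bar> \<le> e / 3"
        by (intro app T Tb)
      ultimately show ?case using elim(1) unfolding dist_real_def by linarith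
    qed
  qed
  then have limf: "limitin ?prod (\<lambda>i. ?f (R i)) (?f T) H"
    by (simp add: limitin_componentwise)
  show ?thesis
    unfolding in_closure_of
  proof (intro conjI allI impI)
    show "T \<in> topspace (weak_star E F)"
      using T by (simp add: weak_star_def topspace_pullback_topology)
    fix W assume W: "T \<in> W \<and> openin (weak_star E F) W"
    then obtain V where V: "openin ?prod V" "W = ?f -` V \<inter> ops E (dual_space F)"
      by (auto simp: weak_star_def openin_pullback_topology)
    then have "\<forall>\<^sub>F i in H. ?f (R i) \<in> V" using limf W by (auto simp: limitin_def)
    then have "\<forall>\<^sub>F i in H. R i \<in> S \<and> R i \<in> W"
      using RS R by eventually_elim (use V in auto)
    then show "\<exists>y. y \<in> S \<and> y \<in> W" using eventually_happens H by blast
  qed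
qed

section \<open>Quotient spaces\<close>

locale closed_subspace = normed_space E for E :: "'a nspace" +
  fixes N :: "'a set"
  assumes subspace: "lin_subspace E N" and closed: "closedin (ntop E) N"
begin

abbreviation Q :: "'a set nspace" where "Q \<equiv> quotient_space E N"

lemma N_subset: "n \<in> N \<Longrightarrow> n \<in> ncar E"
  and N_zero: "nzero E \<in> N"
  and N_add: "\<lbrakk>m \<in> N; n \<in> N\<rbrakk> \<Longrightarrow> nadd E m n \<in> N"
  and N_scale: "n \<in> N \<Longrightarrow> nscale E c n \<in> N"
  using subspace by (auto simp: lin_subspace_def)

lemma mem_coset:
  assumes x: "x \<in> ncar E"
  shows "z \<in> coset E N x \<longleftrightarrow> z \<in> ncar E \<and> nsub E z x \<in> N"
proof
  assume "z \<in> coset E N x"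
  then obtain n where n: "n \<in> N" "z = nadd E x n" by (auto simp: coset_def)
  have nE: "n \<in> ncar E" by (rule N_subset[OF n(1)])
  have "nsub E (nadd E x n) x = nadd E n (nsub E x x)"
    using x nE by (simp add: nsub_def add_assoc add_commute add_left_commute scale_closed add_closed)
  then show "z \<in> ncar E \<and> nsub E z x \<in> N"
    using n nE x by (simp add: sub_self add_zero add_closed)
next
  assume z: "z \<in> ncar E \<and> nsub E z x \<in> N"
  then have "z = nadd E x (nsub E z x)"
    using x by (metis add_commute sub_add_cancel sub_closed)
  then show "z \<in> coset E N x" using z by (auto simp: coset_def)
qed

lemma self_mem_coset: "x \<in> ncar E \<Longrightarrow> x \<in> coset E N x"
  by (simp add: mem_coset sub_self N_zero)

lemma sub_swap: "\<lbrakk>x \<in> ncar E; y \<in> ncar E\<rbrakk> \<Longrightarrow> nsub E y x = nscale E (-1) (nsub E x y)"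
  by (simp add: nsub_def scale_add_right scale_closed scale_scale scale_one add_commute)

lemma sub_add_sub_cancel:
  "\<lbrakk>x \<in> ncar E; y \<in> ncar E; z \<in> ncar E\<rbrakk> \<Longrightarrow> nadd E (nsub E x y) (nsub E y z) = nsub E x z"
  using sub_add_cancel[of x y] by (simp add: nsub_def[of E y z] nsub_def[of E x z] scale_closed sub_closed flip: add_assoc)

lemma coset_eqI:
  assumes "x \<in> ncar E" "y \<in> ncar E" "nsub E x y \<in> N"
  shows "coset E N x = coset E N y"
proof -
  have "nsub E y x \<in> N" using assms sub_swap N_scale by metis
  then show ?thesis
    using assms mem_coset sub_add_sub_cancel N_add by (metis subsetI subset_antisym)
qed

lemma coset_zero: "coset E N (nzero E) = N"
  using N_subset zero_closed mem_coset[OF zero_closed] sub_zero by auto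

lemma quotient_simps:
  "ncar Q = coset E N ` ncar E" "nzero Q = N"
  "nnorm Q C = Inf (nnorm E ` C)"
  by (simp_all add: quotient_space_def)

lemma quotient_add:
  assumes x: "x \<in> ncar E" and y: "y \<in> ncar E"
  shows "nadd Q (coset E N x) (coset E N y) = coset E N (nadd E x y)"
proof -
  have "{nadd E a b |a b. a \<in> coset E N x \<and> b \<in> coset E N y} = coset E N (nadd E x y)"
  proof (intro equalityI subsetI)
    fix z assume "z \<in> {nadd E a b |a b. a \<in> coset E N x \<and> b \<in> coset E N y}"
    then show "z \<in> coset E N (nadd E x y)"
      using x y by (auto simp: mem_coset add_closed sub_add_sub N_add)
  next
    fix z assume z: "z \<in> coset E N (nadd E x y)"
    then have zE: "z \<in> ncar E" "nsub E z (nadd E x y) \<in> N" using x y by (auto simp: mem_coset add_closed)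
    have "nsub E (nsub E z y) x = nsub E z (nadd E x y)"
      using x y zE(1) by (simp add: nsub_def scale_add_right add_assoc add_closed scale_closed add_commute add_left_commute)
    then have "nsub E z y \<in> coset E N x" using x y zE by (simp add: mem_coset sub_closed)
    moreover have "z = nadd E (nsub E z y) y" using zE(1) y by (simp add: sub_add_cancel)
    ultimately show "z \<in> {nadd E a b |a b. a \<in> coset E N x \<and> b \<in> coset E N y}"
      using self_mem_coset[OF y] by blast
  qed
  then show ?thesis by (simp add: quotient_space_def)
qed

lemma quotient_scale:
  assumes x: "x \<in> ncar E"
  shows "nscale Q c (coset E N x) = coset E N (nscale E c x)"
proof -
  have "{nadd E (nscale E c a) n |a n. a \<in> coset E N x \<and> n \<in> N} = coset E N (nscale E c x)"
  proof (intro equalityI subsetI)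
    fix z assume "z \<in> {nadd E (nscale E c a) n |a n. a \<in> coset E N x \<and> n \<in> N}"
    then obtain a n where a: "a \<in> ncar E" "nsub E a x \<in> N" and n: "n \<in> N"
      and z: "z = nadd E (nscale E c a) n" using x by (auto simp: mem_coset)
    have nE: "n \<in> ncar E" by (rule N_subset[OF n])
    have "nsub E z (nscale E c x) = nadd E (nscale E c (nsub E a x)) n"
      using x a nE sub_add_sub[of "nscale E c a" n "nscale E c x" "nzero E"] unfolding z
      by (simp add: sub_scale scale_closed zero_closed add_zero sub_zero)
    then show "z \<in> coset E N (nscale E c x)"
      using x a n nE z by (simp add: mem_coset scale_closed add_closed N_add N_scale)
  next
    fix z assume "z \<in> coset E N (nscale E c x)"
    then obtain n where "n \<in> N" "z = nadd E (nscale E c x) n" by (auto simp: coset_def)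
    then show "z \<in> {nadd E (nscale E c a) n |a n. a \<in> coset E N x \<and> n \<in> N}"
      using self_mem_coset[OF x] by blast
  qed
  then show ?thesis by (simp add: quotient_space_def)
qed

lemma coset_closed: "x \<in> ncar E \<Longrightarrow> coset E N x \<in> ncar Q"
  by (simp add: quotient_simps)

lemma quotient_norm_le:
  assumes "x \<in> ncar E" "z \<in> coset E N x"
  shows "nnorm Q (coset E N x) \<le> nnorm E z"
  unfolding quotient_simps
  by (rule cInf_lower) (use assms norm_nonneg in \<open>auto simp: mem_coset intro!: bdd_belowI[of _ 0]\<close>)

lemma le_quotient_norm:
  assumes "x \<in> ncar E" "\<And>z. z \<in> coset E N x \<Longrightarrow> a \<le> nnorm E z"
  shows "a \<le> nnorm Q (coset E N x)"
  unfolding quotient_simps by (rule cInf_greatest) (use assms self_mem_coset in auto)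

lemma quotient_normed: "normed_space Q"
proof -
  have nn: "0 \<le> nnorm Q (coset E N x)" if "x \<in> ncar E" for x
    by (rule le_quotient_norm[OF that]) (use that norm_nonneg in \<open>simp add: mem_coset\<close>)
  have zero: "nnorm Q (coset E N x) = 0 \<longleftrightarrow> coset E N x = N" if x: "x \<in> ncar E" for x
  proof
    assume z: "nnorm Q (coset E N x) = 0"
    have "x \<in> N"
    proof -
      have "\<exists>y\<in>N. nnorm E (nsub E x y) < e" if "e > 0" for e
      proof -
        have "\<not> e \<le> nnorm Q (coset E N x)" using z that by simp
        then obtain w where "w \<in> coset E N x" "nnorm E w < e"
          using le_quotient_norm[OF x, of e] by force
        then obtain n where n: "n \<in> N" "nnorm E (nadd E x n) < e" by (auto simp: coset_def)
        then have "nsub E x (nscale E (-1) n) = nadd E x n"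
          using N_subset by (simp add: nsub_def scale_scale scale_one)
        then show ?thesis using n N_scale by metis
      qed
      moreover have "N \<subseteq> ncar E" using N_subset by blast
      ultimately show ?thesis using closed x unfolding closedin_iff[OF \<open>N \<subseteq> ncar E\<close>] by blast
    qed
    then show "coset E N x = N"
      using coset_eqI[OF x zero_closed] x by (simp add: sub_zero coset_zero)
  next
    assume "coset E N x = N"
    then show "nnorm Q (coset E N x) = 0"
      using quotient_norm_le[OF x, of "nzero E"] nn[OF x] N_zero norm_zero by simp
  qed
  have scale_le: "nnorm Q (coset E N (nscale E c x)) \<le> \<bar>c\<bar> * nnorm Q (coset E N x)"
    if x: "x \<in> ncar E" for c x
  proof (cases "c = 0")
    case True
    then show ?thesis
      using quotient_norm_le[OF zero_closed self_mem_coset[OF zero_closed]] x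
      by (simp add: scale_zero_left norm_zero)
  next
    case False
    have "nnorm Q (coset E N (nscale E c x)) / \<bar>c\<bar> \<le> nnorm Q (coset E N x)"
    proof (rule le_quotient_norm[OF x])
      fix z assume "z \<in> coset E N x"
      then have "z \<in> ncar E" "nscale E c z \<in> coset E N (nscale E c x)"
        using x by (auto simp: mem_coset scale_closed sub_scale N_scale)
      then show "nnorm Q (coset E N (nscale E c x)) / \<bar>c\<bar> \<le> nnorm E z"
        using quotient_norm_le[OF scale_closed[OF x]] False by (fastforce simp: norm_scale divide_le_eq mult.commute)
    qed
    then show ?thesis using False by (simp add: divide_le_eq mult.commute)
  qed
  have scale: "nnorm Q (coset E N (nscale E c x)) = \<bar>c\<bar> * nnorm Q (coset E N x)"
    if x: "x \<in> ncar E" for c x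
  proof (cases "c = 0")
    case True
    then show ?thesis using scale_le[OF x, of 0] nn[OF scale_closed[OF x, of 0]] by simp
  next
    case False
    have "nnorm Q (coset E N (nscale E (inverse c) (nscale E c x))) \<le> \<bar>inverse c\<bar> * nnorm Q (coset E N (nscale E c x))"
      by (rule scale_le[OF scale_closed[OF x]])
    then have "\<bar>c\<bar> * nnorm Q (coset E N x) \<le> nnorm Q (coset E N (nscale E c x))"
      using False x by (simp add: scale_scale scale_one field_simps)
    then show ?thesis using scale_le[OF x, of c] by simp
  qed
  have triangle: "nnorm Q (coset E N (nadd E x y)) \<le> nnorm Q (coset E N x) + nnorm Q (coset E N y)"
    if x: "x \<in> ncar E" and y: "y \<in> ncar E" for x y
  proof -
    have 1: "nnorm Q (coset E N (nadd E x y)) \<le> nnorm E a + nnorm E b"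
      if "a \<in> coset E N x" "b \<in> coset E N y" for a b
    proof -
      have ab: "a \<in> ncar E" "b \<in> ncar E" "nadd E a b \<in> coset E N (nadd E x y)"
        using that x y by (auto simp: mem_coset add_closed sub_add_sub N_add)
      then show ?thesis
        using quotient_norm_le[OF add_closed[OF x y] ab(3)] norm_triangle[OF ab(1,2)] by simp
    qed
    have "nnorm Q (coset E N (nadd E x y)) - nnorm E b \<le> nnorm Q (coset E N x)"
      if "b \<in> coset E N y" for b
      by (rule le_quotient_norm[OF x]) (use 1 that in \<open>fastforce simp: algebra_simps\<close>)
    then have "nnorm Q (coset E N (nadd E x y)) - nnorm Q (coset E N x) \<le> nnorm Q (coset E N y)"
      by (intro le_quotient_norm[OF y]) (fastforce simp: algebra_simps)
    then show ?thesis by simp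
  qed
  show ?thesis
  proof unfold_locales
    show "nzero Q \<in> ncar Q" using coset_closed[OF zero_closed] by (simp add: coset_zero quotient_simps)
  next
    fix C assume "C \<in> ncar Q"
    then obtain x where x: "x \<in> ncar E" "C = coset E N x" by (auto simp: quotient_simps)
    note [simp] = x quotient_add quotient_scale add_closed scale_closed zero_closed
    show "nadd Q C (nzero Q) = C"
      using quotient_add[OF x(1) zero_closed] by (simp add: coset_zero quotient_simps add_zero)
    show "nadd Q C (nscale Q (-1) C) = nzero Q"
      by (simp add: add_neg coset_zero quotient_simps(2))
    show "nscale Q 1 C = C" by (simp add: scale_one)
    show "nscale Q c C \<in> ncar Q" for c by (simp add: coset_closed)
    show "nscale Q c (nscale Q d C) = nscale Q (c * d) C" for c d by (simp add: scale_scale)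
    show "nscale Q (c + d) C = nadd Q (nscale Q c C) (nscale Q d C)" for c d by (simp add: scale_add_left)
    show "0 \<le> nnorm Q C" by (simp add: nn)
    show "nnorm Q C = 0 \<longleftrightarrow> C = nzero Q" using zero[OF x(1)] by (simp add: quotient_simps(2))
    show "nnorm Q (nscale Q c C) = \<bar>c\<bar> * nnorm Q C" for c by (simp add: scale)
    fix D assume "D \<in> ncar Q"
    then obtain y where y: "y \<in> ncar E" "D = coset E N y" by (auto simp: quotient_simps)
    note [simp] = y
    show "nadd Q C D \<in> ncar Q" by (simp add: coset_closed)
    show "nadd Q C D = nadd Q D C" by (simp add: add_commute)
    show "nscale Q c (nadd Q C D) = nadd Q (nscale Q c C) (nscale Q c D)" for c by (simp add: scale_add_right)
    show "nnorm Q (nadd Q C D) \<le> nnorm Q C + nnorm Q D" by (simp add: triangle)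
    fix G assume "G \<in> ncar Q"
    then obtain z where z: "z \<in> ncar E" "G = coset E N z" by (auto simp: quotient_simps)
    then show "nadd Q (nadd Q C D) G = nadd Q C (nadd Q D G)" by (simp add: add_assoc)
  qed
qed

abbreviation qmap :: "'a \<Rightarrow> 'a set" where "qmap \<equiv> \<lambda>x\<in>ncar E. coset E N x"

lemma qmap_operator: "qmap \<in> ops E Q"
  by (rule operatorsI[where C = 1])
    (auto simp: coset_closed add_closed scale_closed quotient_add quotient_scale quotient_norm_le self_mem_coset)

text \<open>The identification \<open>N\<^sup>\<bottom> = Q\<^sup>*\<close> with its norm estimate.\<close>

lemma annihilator_factors:
  assumes \<phi>: "\<phi> \<in> dual E" and N: "\<And>n. n \<in> N \<Longrightarrow> \<phi> n = 0"
    and c: "0 \<le> c" and bound: "\<And>x. x \<in> ncar E \<Longrightarrow> \<bar>\<phi> x\<bar> \<le> c * nnorm E x"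
  obtains \<psi> where "\<psi> \<in> dual Q" "\<And>x. x \<in> ncar E \<Longrightarrow> \<psi> (coset E N x) = \<phi> x"
    "nnorm (dual_space Q) \<psi> \<le> c"
proof -
  interpret Q: normed_space Q by (rule quotient_normed)
  have const: "\<phi> z = \<phi> x" if x: "x \<in> ncar E" and z: "z \<in> coset E N x" for x z
  proof -
    have "z \<in> ncar E" "\<phi> (nsub E z x) = 0" using x z N by (auto simp: mem_coset)
    then show ?thesis using dual_sub[OF \<phi> _ x pre_normed] by simp
  qed
  define \<psi> where "\<psi> = (\<lambda>C\<in>ncar Q. \<phi> (SOME z. z \<in> C))"
  have val: "\<psi> (coset E N x) = \<phi> x" if x: "x \<in> ncar E" for x
  proof -
    have "(SOME z. z \<in> coset E N x) \<in> coset E N x"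
      using self_mem_coset[OF x] by (rule someI)
    then show ?thesis using const[OF x] coset_closed[OF x] by (simp add: \<psi>_def)
  qed
  have le: "\<bar>\<psi> C\<bar> \<le> c * nnorm Q C" if C: "C \<in> ncar Q" for C
  proof -
    obtain x where x: "x \<in> ncar E" "C = coset E N x" using C by (auto simp: quotient_simps)
    have *: "\<bar>\<phi> x\<bar> \<le> c * nnorm E z" if "z \<in> coset E N x" for z
      using bound[of z] const[OF x(1) that] that x(1) by (simp add: mem_coset)
    show ?thesis
    proof (cases "c = 0")
      case True
      then show ?thesis using *[OF self_mem_coset[OF x(1)]] val x by simp
    next
      case False
      then have "\<bar>\<phi> x\<bar> / c \<le> nnorm Q (coset E N x)"
        using c * by (intro le_quotient_norm[OF x(1)]) (auto simp: divide_le_eq mult.commute)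
      then show ?thesis using c False val[OF x(1)] x(2) by (simp add: divide_le_eq mult.commute)
    qed
  qed
  have "\<psi> \<in> dual Q"
  proof (rule dualI[OF _ _ _ le])
    show "\<psi> \<in> extensional (ncar Q)" by (simp add: \<psi>_def)
    show "\<psi> (nadd Q C D) = \<psi> C + \<psi> D" if "C \<in> ncar Q" "D \<in> ncar Q" for C D
      using that by (auto simp: quotient_simps(1) quotient_add val add_closed dual_add[OF \<phi>])
    show "\<psi> (nscale Q a C) = a * \<psi> C" if "C \<in> ncar Q" for a C
      using that by (auto simp: quotient_simps(1) quotient_scale val scale_closed dual_scale[OF \<phi>])
  qed
  then show thesis using that val dual_norm_le[OF Q.pre_normed c le] by blast
qed

text \<open>Self-duality puts \<open>S\<^sup>*\<close> in the ideal. It is sandwiched between \<open>D\<close>, an operator into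
  \<open>Q\<^sup>* = N\<^sup>\<bottom>\<close>, and the inclusion of \<open>N\<^sup>\<bottom>\<close>, the adjoint of the quotient map. If \<open>S\<close> approximates the identity,
  \<open>R\<close> approximates \<open>D\<close> followed by this inclusion.\<close>

lemma quotient_approximant:
  fixes A :: "'u op_class"
  assumes A: "operator_ideal A" and sd: "self_dual_ideal A" and S: "S \<in> ideal_ops_le A l Q Q"
    and l: "0 \<le> l" and c: "0 \<le> c" and V: "normed_space V" and cV: "has_copy TYPE('u) V" and cE: "has_copy TYPE('u) (dual_space E)"
    and D: "D \<in> ops V (dual_space Q)"
    and Db: "\<And>v. v \<in> ncar V \<Longrightarrow> nnorm (dual_space Q) (D v) \<le> c * nnorm V v"
  shows "\<exists>R\<in>ideal_ops A V (dual_space E).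
    \<forall>v\<in>ncar V. \<forall>x\<in>ncar E. R v x = D v (S (coset E N x)) \<and> \<bar>R v x\<bar> \<le> l * c * nnorm V v * nnorm E x"
proof -
  interpret Q: normed_space Q by (rule quotient_normed)
  interpret V: normed_space V by fact
  have S': "S \<in> ideal_ops A Q Q" and Sl: "op_norm Q Q S \<le> l" using S by (auto simp: ideal_ops_le_def)
  note Sop = ideal_ops_operator[OF S']
  have "qmap ` ncar E = ncar Q" by (simp add: quotient_simps)
  then have cQ: "has_copy TYPE('u) (dual_space Q)"
    by (rule dual_has_copy_of_image[OF normed_space_axioms quotient_normed qmap_operator _ cE])
  let ?j = "adjoint_op E Q qmap"
  let ?S = "adjoint_op Q Q S"
  let ?R = "compose (ncar V) ?j (compose (ncar V) ?S D)"
  have "?S \<in> ideal_ops A (dual_space Q) (dual_space Q)"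
    by (rule ideal_ops_adjoint[OF A sd S' Q.normed_space_axioms Q.normed_space_axioms cQ cQ])
  then have "?R \<in> ideal_ops A V (dual_space E)"
    by (rule ideal_ops_compose[OF A _ dual_normed[OF Q.pre_normed] dual_normed[OF Q.pre_normed] V
          dual_normed[OF pre_normed] cV cE D adjoint_operator[OF pre_normed quotient_normed qmap_operator]])
  moreover have "?R v x = D v (S (coset E N x)) \<and> \<bar>?R v x\<bar> \<le> l * c * nnorm V v * nnorm E x"
    if v: "v \<in> ncar V" and x: "x \<in> ncar E" for v x
  proof -
    have Dv: "D v \<in> dual Q" by (rule operators_closed[OF D v])
    have SDv: "?S (D v) \<in> dual Q"
      by (rule operators_closed[OF adjoint_operator[OF Q.pre_normed quotient_normed Sop] Dv])
    have C: "coset E N x \<in> ncar Q" by (rule coset_closed[OF x])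
    have val: "?R v x = D v (S (coset E N x))"
      using v x by (simp add: compose_def adjoint_apply[OF SDv] adjoint_apply[OF Dv C])
    have "\<bar>D v (S (coset E N x))\<bar> \<le> nnorm (dual_space Q) (D v) * nnorm Q (S (coset E N x))"
      by (rule dual_bound[OF Q.pre_normed Dv operators_closed[OF Sop C]])
    also have "\<dots> \<le> (c * nnorm V v) * (l * nnorm E x)"
    proof (intro mult_mono Db v)
      have "nnorm Q (S (coset E N x)) \<le> op_norm Q Q S * nnorm Q (coset E N x)"
        by (rule op_norm_bound[OF Q.pre_normed quotient_normed Sop C])
      also have "\<dots> \<le> l * nnorm E x"
        by (intro mult_mono Sl l quotient_norm_le[OF x self_mem_coset[OF x]] Q.norm_nonneg C)
      finally show "nnorm Q (S (coset E N x)) \<le> l * nnorm E x" .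
    qed (use c V.norm_nonneg[OF v] Q.norm_nonneg[OF operators_closed[OF Sop C]] in auto)
    finally show ?thesis unfolding val by (simp add: mult_ac)
  qed
  ultimately show ?thesis by blast
qed

end

section \<open>The two halves of the approximation\<close>

text \<open>The extension operator \<open>\<FF>(M)\<^sup>* \<rightarrow> \<FF>(X)\<^sup>*\<close> sends \<open>\<psi>\<close> to \<open>P \<Psi>\<close> for any \<open>\<Psi>\<close> that agrees with \<open>\<psi>\<close> on the
  \<open>\<delta>\<^sub>x\<close> with \<open>x \<in> M\<close>: two such \<open>\<Psi>\<close> differ by an element of the kernel of \<open>P\<close>. This makes it linear,
  although McShane's extension, which provides a \<open>\<Psi>\<close> of the right norm, is not.\<close>

lemma (in normed_space) extension_operator:
  assumes M: "lin_subspace E M" and lc: "locally_complemented Free (free_sub E M)"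
  obtains \<sigma> where "\<sigma> \<in> ops (dual_space (free_space (sub_space E M))) (dual_space Free)"
    and "\<And>\<psi> x. \<lbrakk>\<psi> \<in> dual (free_space (sub_space E M)); x \<in> M\<rbrakk>
      \<Longrightarrow> \<sigma> \<psi> (delta E x) = \<psi> (delta (sub_space E M) x)"
    and "\<And>\<psi> C. \<lbrakk>\<psi> \<in> dual (free_space (sub_space E M)); 0 \<le> C;
        \<And>x y. \<lbrakk>x \<in> M; y \<in> M\<rbrakk>
          \<Longrightarrow> \<bar>\<psi> (delta (sub_space E M) x) - \<psi> (delta (sub_space E M) y)\<bar> \<le> C * nnorm E (nsub E x y)\<rbrakk>
      \<Longrightarrow> nnorm (dual_space Free) (\<sigma> \<psi>) \<le> C"
proof -
  let ?M = "sub_space E M"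
  let ?FM = "free_space ?M"
  let ?ZD = "dual_space Free" and ?MD = "dual_space ?FM"
  have ME: "M \<subseteq> ncar E" and M0: "nzero E \<in> M" using M by (auto simp: lin_subspace_def)
  interpret M: normed_space ?M by (rule sub_space_normed[OF M])
  interpret Z: normed_space Free by (rule Free_normed)
  interpret ZD: normed_space ?ZD by (rule dual_normed[OF Z.pre_normed])
  interpret FM: normed_space ?FM by (rule M.Free_normed)
  interpret MD: normed_space ?MD by (rule dual_normed[OF FM.pre_normed])
  obtain P where P: "P \<in> ops ?ZD ?ZD" and PP: "\<And>\<Phi>. \<Phi> \<in> ncar ?ZD \<Longrightarrow> P (P \<Phi>) = P \<Phi>"
    and P1: "op_norm ?ZD ?ZD P \<le> 1"
    and ker: "{\<Phi> \<in> ncar ?ZD. P \<Phi> = nzero ?ZD} = annihilator Free (free_sub E M)"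
    using lc unfolding locally_complemented_def by blast
  have Pc: "P \<Phi> \<in> ncar ?ZD" if "\<Phi> \<in> ncar ?ZD" for \<Phi> by (rule operators_closed[OF P that])
  define ext where "ext \<psi> \<Psi> \<longleftrightarrow> \<Psi> \<in> ncar ?ZD \<and> (\<forall>x\<in>M. \<Psi> (delta E x) = \<psi> (delta ?M x))" for \<psi> \<Psi>
  have ext_unique: "P \<Psi>1 = P \<Psi>2" if e: "ext \<psi> \<Psi>1" "ext \<psi> \<Psi>2" for \<psi> \<Psi>1 \<Psi>2
  proof -
    have c: "\<Psi>1 \<in> ncar ?ZD" "\<Psi>2 \<in> ncar ?ZD" using e by (auto simp: ext_def)
    have d: "nsub ?ZD \<Psi>1 \<Psi>2 \<in> ncar ?ZD" by (rule ZD.sub_closed[OF c])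
    have "nsub ?ZD \<Psi>1 \<Psi>2 \<mu> = 0" if "\<mu> \<in> free_sub E M" for \<mu>
      by (rule functional_vanishes_on_free_sub[OF ME d _ that])
        (use e ME delta_Free in \<open>auto simp: ext_def dual_nsub[OF Z.pre_normed] subset_iff\<close>)
    then have "nsub ?ZD \<Psi>1 \<Psi>2 \<in> annihilator Free (free_sub E M)" using d by (simp add: annihilator_def)
    then have "P (nsub ?ZD \<Psi>1 \<Psi>2) = nzero ?ZD" using ker by blast
    then have "nsub ?ZD (P \<Psi>1) (P \<Psi>2) = nzero ?ZD"
      using operators_sub[OF P c ZD.pre_normed] by simp
    then show ?thesis using ZD.sub_eq_zero_iff[OF Pc[OF c(1)] Pc[OF c(2)]] by simp
  qed
  have P_on_deltas: "P \<Psi> (delta E x) = \<Psi> (delta E x)" if \<Psi>: "\<Psi> \<in> ncar ?ZD" and x: "x \<in> M" for \<Psi> x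
  proof -
    have d: "nsub ?ZD (P \<Psi>) \<Psi> \<in> ncar ?ZD" by (rule ZD.sub_closed[OF Pc[OF \<Psi>] \<Psi>])
    have "P (nsub ?ZD (P \<Psi>) \<Psi>) = nzero ?ZD"
      using operators_sub[OF P Pc[OF \<Psi>] \<Psi> ZD.pre_normed] PP[OF \<Psi>] ZD.sub_self[OF Pc[OF \<Psi>]] by simp
    then have "nsub ?ZD (P \<Psi>) \<Psi> \<in> annihilator Free (free_sub E M)" using d ker by blast
    then have "nsub ?ZD (P \<Psi>) \<Psi> (delta E x) = 0"
      using delta_free_sub[OF ME x] by (simp add: annihilator_def)
    moreover have "delta E x \<in> ncar Free" using delta_Free x ME by blast
    ultimately show ?thesis by (simp add: dual_nsub[OF Z.pre_normed])
  qed
  have ext_mcshane: "\<exists>\<Psi>. ext \<psi> \<Psi> \<and> nnorm ?ZD \<Psi> \<le> C"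
    if \<psi>: "\<psi> \<in> ncar ?MD" and C: "0 \<le> C"
      and lip: "\<And>x y. \<lbrakk>x \<in> M; y \<in> M\<rbrakk> \<Longrightarrow> \<bar>\<psi> (delta ?M x) - \<psi> (delta ?M y)\<bar> \<le> C * nnorm E (nsub E x y)"
    for \<psi> C
  proof -
    have "delta ?M (nzero E) = nzero ?FM"
      using Lip0_zero by (fastforce simp: delta_def M.Free_simps dual_simps restrict_def)
    moreover have "\<psi> (nzero ?FM) = 0"
      using operators_zero[OF \<psi>[unfolded dual_space_def] FM.normed_space_axioms real_line_normed] by simp
    ultimately have g0: "\<psi> (delta ?M (nzero E)) = 0" by simp
    obtain G where G: "G \<in> ncar Lip" "nnorm Lip G \<le> C" "\<And>m. m \<in> M \<Longrightarrow> G m = \<psi> (delta ?M m)"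
      using mcshane_extension[of M C "\<lambda>x. \<psi> (delta ?M x)", OF ME M0 C g0 lip] by blast
    let ?\<Psi> = "\<lambda>\<mu>\<in>ncar Free. \<mu> G"
    have "?\<Psi> (delta E x) = G x" if "x \<in> M" for x
      using that ME delta_Free G(1) by (auto simp: delta_def subset_iff)
    then have "ext \<psi> ?\<Psi>"
      using evaluation_functional(1)[OF G(1)] G(3) by (simp add: ext_def)
    moreover have "nnorm ?ZD ?\<Psi> \<le> C" using evaluation_functional(2)[OF G(1)] G(2) by linarith
    ultimately show ?thesis by blast
  qed
  have lip_psi: "\<bar>\<psi> (delta ?M x) - \<psi> (delta ?M y)\<bar> \<le> nnorm ?MD \<psi> * nnorm E (nsub E x y)"
    if \<psi>: "\<psi> \<in> ncar ?MD" and xy: "x \<in> M" "y \<in> M" for \<psi> x y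
  proof -
    have d: "delta ?M x \<in> ncar ?FM" "delta ?M y \<in> ncar ?FM" using xy by (auto intro: M.delta_Free)
    have "nnorm ?FM (nsub ?FM (delta ?M x) (delta ?M y)) \<le> nnorm E (nsub E x y)"
    proof -
      have "nnorm (dual_space M.Lip) (nsub ?FM (delta ?M x) (delta ?M y)) \<le> nnorm E (nsub E x y)"
      proof (rule dual_norm_le[OF M.Lip_pre_normed])
        show "0 \<le> nnorm E (nsub E x y)" using norm_nonneg sub_closed xy ME by blast
        fix g assume g: "g \<in> ncar M.Lip"
        have "nsub ?FM (delta ?M x) (delta ?M y) g = g x - g y"
          using g by (simp add: nsub_def M.Free_simps dual_simps delta_def)
        then show "\<bar>nsub ?FM (delta ?M x) (delta ?M y) g\<bar> \<le> nnorm E (nsub E x y) * nnorm M.Lip g"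
          using M.Lip_bound[OF g, of x y] xy by (simp add: mult.commute)
      qed
      then show ?thesis by (simp add: M.Free_simps)
    qed
    then have "nnorm ?MD \<psi> * nnorm ?FM (nsub ?FM (delta ?M x) (delta ?M y)) \<le> nnorm ?MD \<psi> * nnorm E (nsub E x y)"
      by (rule mult_left_mono) (rule MD.norm_nonneg[OF \<psi>])
    then show ?thesis
      using dual_bound[OF FM.pre_normed \<psi> FM.sub_closed[OF d]] dual_sub[OF \<psi> d FM.pre_normed] by simp
  qed
  have ext_exists: "\<exists>\<Psi>. ext \<psi> \<Psi>" if "\<psi> \<in> ncar ?MD" for \<psi>
    using ext_mcshane[OF that MD.norm_nonneg[OF that] lip_psi[OF that]] by blast
  define \<sigma> where "\<sigma> = (\<lambda>\<psi>\<in>ncar ?MD. P (SOME \<Psi>. ext \<psi> \<Psi>))"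
  have \<sigma>_eq: "\<sigma> \<psi> = P \<Psi>" if "\<psi> \<in> ncar ?MD" "ext \<psi> \<Psi>" for \<psi> \<Psi>
    using ext_unique[OF someI[of "ext \<psi>", OF that(2)] that(2)] that(1) by (simp add: \<sigma>_def)
  have \<sigma>_bound: "nnorm ?ZD (\<sigma> \<psi>) \<le> C"
    if \<psi>: "\<psi> \<in> ncar ?MD" and C: "0 \<le> C"
      and lip: "\<And>x y. \<lbrakk>x \<in> M; y \<in> M\<rbrakk> \<Longrightarrow> \<bar>\<psi> (delta ?M x) - \<psi> (delta ?M y)\<bar> \<le> C * nnorm E (nsub E x y)"
    for \<psi> C
  proof -
    obtain \<Psi> where \<Psi>: "ext \<psi> \<Psi>" "nnorm ?ZD \<Psi> \<le> C" using ext_mcshane[OF \<psi> C lip] by blast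
    then have c: "\<Psi> \<in> ncar ?ZD" by (simp add: ext_def)
    have "nnorm ?ZD (P \<Psi>) \<le> op_norm ?ZD ?ZD P * nnorm ?ZD \<Psi>"
      by (rule op_norm_bound[OF ZD.pre_normed ZD.normed_space_axioms P c])
    also have "\<dots> \<le> 1 * C" by (intro mult_mono P1 \<Psi>(2) ZD.norm_nonneg c) auto
    finally show ?thesis by (simp add: \<sigma>_eq[OF \<psi> \<Psi>(1)])
  qed
  have deltaM: "delta ?M x \<in> ncar ?FM" if "x \<in> M" for x using that by (simp add: M.delta_Free)
  have deltaE: "delta E x \<in> ncar Free" if "x \<in> M" for x using that ME delta_Free by blast
  have \<sigma>_op: "\<sigma> \<in> ops ?MD ?ZD"
  proof (rule operatorsI[where C = 1])
    show "\<sigma> \<in> extensional (ncar ?MD)" by (simp add: \<sigma>_def)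
    show "\<sigma> \<psi> \<in> ncar ?ZD" if \<psi>: "\<psi> \<in> ncar ?MD" for \<psi>
    proof -
      obtain \<Psi> where "ext \<psi> \<Psi>" using ext_exists[OF \<psi>] by blast
      then show ?thesis using \<sigma>_eq[OF \<psi>] Pc by (simp add: ext_def)
    qed
    show "\<sigma> (nadd ?MD \<psi> \<theta>) = nadd ?ZD (\<sigma> \<psi>) (\<sigma> \<theta>)" if p: "\<psi> \<in> ncar ?MD" "\<theta> \<in> ncar ?MD" for \<psi> \<theta>
    proof -
      obtain \<Psi> \<Theta> where e: "ext \<psi> \<Psi>" "ext \<theta> \<Theta>" using ext_exists p by blast
      then have "ext (nadd ?MD \<psi> \<theta>) (nadd ?ZD \<Psi> \<Theta>)"
        using deltaM deltaE ZD.add_closed unfolding ext_def by (simp add: dual_simps)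
      then have "\<sigma> (nadd ?MD \<psi> \<theta>) = P (nadd ?ZD \<Psi> \<Theta>)" by (rule \<sigma>_eq[OF MD.add_closed[OF p]])
      then show ?thesis
        using e \<sigma>_eq p operators_add[OF P] by (simp add: ext_def)
    qed
    show "\<sigma> (nscale ?MD c \<psi>) = nscale ?ZD c (\<sigma> \<psi>)" if p: "\<psi> \<in> ncar ?MD" for c \<psi>
    proof -
      obtain \<Psi> where e: "ext \<psi> \<Psi>" using ext_exists p by blast
      then have "ext (nscale ?MD c \<psi>) (nscale ?ZD c \<Psi>)"
        using deltaM deltaE ZD.scale_closed unfolding ext_def by (simp add: dual_simps)
      then have "\<sigma> (nscale ?MD c \<psi>) = P (nscale ?ZD c \<Psi>)" by (rule \<sigma>_eq[OF MD.scale_closed[OF p]])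
      then show ?thesis
        using e \<sigma>_eq p operators_scale[OF P] by (simp add: ext_def)
    qed
    show "nnorm ?ZD (\<sigma> \<psi>) \<le> 1 * nnorm ?MD \<psi>" if "\<psi> \<in> ncar ?MD" for \<psi>
      using \<sigma>_bound[OF that MD.norm_nonneg[OF that] lip_psi[OF that]] by simp
  qed
  show thesis
  proof (rule that[OF \<sigma>_op _ \<sigma>_bound])
    show "\<sigma> \<psi> (delta E x) = \<psi> (delta ?M x)" if \<psi>: "\<psi> \<in> ncar ?MD" and x: "x \<in> M" for \<psi> x
    proof -
      obtain \<Psi> where e: "ext \<psi> \<Psi>" using ext_exists \<psi> by blast
      then show ?thesis using P_on_deltas[of \<Psi> x] x \<sigma>_eq[OF \<psi> e] by (simp add: ext_def)
    qed
  qed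
qed

text \<open>For a Lipschitz approximation \<open>f\<close> of the identity of \<open>M\<close>, the operator is \<open>\<sigma> L\<^sub>f\<^sup>*\<close> after the
  restriction \<open>X\<^sup>* \<rightarrow> M\<^sup>*\<close>. Its norm is estimated by the Lipschitz constant of \<open>f\<close> alone, because
  \<open>\<sigma>\<close> only sees the values at the \<open>\<delta>\<^sub>x\<close>.\<close>

lemma (in normed_space) lipschitz_approximant:
  fixes A :: "'u op_class"
  assumes E: "banach_space E" and M: "lin_subspace E M" and Mc: "closedin (ntop E) M"
    and lc: "locally_complemented Free (free_sub E M)"
    and A: "operator_ideal A" and sd: "self_dual_ideal A"
    and cE: "has_copy TYPE('u) (dual_space E)" and cZ: "has_copy TYPE('u) (dual_space Free)"
    and cM: "has_copy TYPE('u) (dual_space (sub_space E M))"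
    and cFM: "has_copy TYPE('u) (dual_space (free_space (sub_space E M)))"
    and f: "f \<in> lip_ideal_le A l (sub_space E M) (sub_space E M)" and l: "0 \<le> l"
  shows "\<exists>R\<in>ideal_ops A (dual_space E) (dual_space Free).
    (\<forall>\<phi>\<in>dual E. \<forall>m\<in>M. R \<phi> (delta E m) = \<phi> (f m)) \<and>
    (\<forall>\<phi>\<in>dual E. \<forall>\<mu>\<in>ncar Free. \<bar>R \<phi> \<mu>\<bar> \<le> l * nnorm (dual_space E) \<phi> * nnorm Free \<mu>)"
proof -
  let ?M = "sub_space E M"
  let ?FM = "free_space ?M"
  let ?ED = "dual_space E"
  have ME: "M \<subseteq> ncar E" using M by (auto simp: lin_subspace_def)
  have Mb: "banach_space ?M" by (rule closed_sub_space_banach[OF E M Mc])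
  interpret M: normed_space ?M by (rule sub_space_normed[OF M])
  interpret Z: normed_space Free by (rule Free_normed)
  interpret FM: normed_space ?FM by (rule M.Free_normed)
  interpret ED: normed_space ?ED by (rule dual_normed[OF pre_normed])
  have fL: "f \<in> ncar (Lip0 ?M ?M)" and fA: "lin_ext ?M ?M f \<in> ideal_ops A ?FM ?M"
    and fl: "lip_norm ?M ?M f \<le> l"
    using f by (auto simp: lip_ideal_le_def lip_ideal_def)
  let ?L = "lin_ext ?M ?M f"
  have L: "?L \<in> ops ?FM ?M" and Ld: "\<And>x. x \<in> M \<Longrightarrow> ?L (delta ?M x) = f x"
    using M.lin_ext_props[OF Mb fL] by auto
  obtain \<sigma> where \<sigma>: "\<sigma> \<in> ops (dual_space ?FM) (dual_space Free)"
    and \<sigma>d: "\<And>\<psi> x. \<lbrakk>\<psi> \<in> dual ?FM; x \<in> M\<rbrakk> \<Longrightarrow> \<sigma> \<psi> (delta E x) = \<psi> (delta ?M x)"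
    and \<sigma>b: "\<And>\<psi> C. \<lbrakk>\<psi> \<in> dual ?FM; 0 \<le> C;
        \<And>x y. \<lbrakk>x \<in> M; y \<in> M\<rbrakk> \<Longrightarrow> \<bar>\<psi> (delta ?M x) - \<psi> (delta ?M y)\<bar> \<le> C * nnorm E (nsub E x y)\<rbrakk>
      \<Longrightarrow> nnorm (dual_space Free) (\<sigma> \<psi>) \<le> C"
    using extension_operator[OF M lc] by metis
  let ?i = "\<lambda>x\<in>M. x"
  have i: "?i \<in> ops ?M E"
    by (rule operatorsI[where C = 1])
      (use ME M.add_closed M.scale_closed in auto)
  let ?r = "adjoint_op ?M E ?i" and ?La = "adjoint_op ?FM ?M ?L"
  have r: "?r \<in> ops ?ED (dual_space ?M)"
    by (rule adjoint_operator[OF M.pre_normed normed_space_axioms i])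
  have La: "?La \<in> ideal_ops A (dual_space ?M) (dual_space ?FM)"
    by (rule ideal_ops_adjoint[OF A sd fA FM.normed_space_axioms M.normed_space_axioms cFM cM])
  let ?R = "compose (ncar ?ED) \<sigma> (compose (ncar ?ED) ?La ?r)"
  have "?R \<in> ideal_ops A ?ED (dual_space Free)"
    by (rule ideal_ops_compose[OF A La dual_normed[OF M.pre_normed] dual_normed[OF FM.pre_normed]
          ED.normed_space_axioms dual_normed[OF Z.pre_normed] cE cZ r \<sigma>])
  moreover have "?R \<phi> (delta E m) = \<phi> (f m)"
    and R_norm: "nnorm (dual_space Free) (?R \<phi>) \<le> l * nnorm ?ED \<phi>"
    and R_closed: "?R \<phi> \<in> dual Free"
    if \<phi>: "\<phi> \<in> ncar ?ED" and m: "m \<in> M" for \<phi> m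
  proof -
    have r\<phi>: "?r \<phi> \<in> dual ?M" by (rule operators_closed[OF r \<phi>])
    have Lr: "?La (?r \<phi>) \<in> dual ?FM"
      by (rule operators_closed[OF ideal_ops_operator[OF La] r\<phi>])
    have R\<phi>: "?R \<phi> = \<sigma> (?La (?r \<phi>))" using \<phi> by (simp add: compose_def)
    have fM: "f x \<in> M" if "x \<in> M" for x using Lip0_closed[OF fL] that by simp
    have val: "?La (?r \<phi>) (delta ?M x) = \<phi> (f x)" if x: "x \<in> M" for x
    proof -
      have "delta ?M x \<in> ncar ?FM" using x by (simp add: M.delta_Free)
      then have "?La (?r \<phi>) (delta ?M x) = ?r \<phi> (f x)" using adjoint_apply[OF r\<phi>] Ld[OF x] by metis
      also have "\<dots> = \<phi> (f x)" using adjoint_apply[OF \<phi>, of "f x" ?M ?i] fM[OF x] by simp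
      finally show ?thesis .
    qed
    show "?R \<phi> (delta E m) = \<phi> (f m)" unfolding R\<phi> using \<sigma>d[OF Lr m] val[OF m] by simp
    show "?R \<phi> \<in> dual Free" unfolding R\<phi> by (rule operators_closed[OF \<sigma> Lr])
    show "nnorm (dual_space Free) (?R \<phi>) \<le> l * nnorm ?ED \<phi>"
      unfolding R\<phi>
    proof (rule \<sigma>b[OF Lr])
      show "0 \<le> l * nnorm ?ED \<phi>" using l ED.norm_nonneg[OF \<phi>] by simp
      fix x y assume xy: "x \<in> M" "y \<in> M"
      have fE: "f x \<in> ncar E" "f y \<in> ncar E" using fM xy ME by auto
      have n: "nnorm E (nsub E (f x) (f y)) \<le> lip_norm ?M ?M f * nnorm E (nsub E x y)"
        using M.lip_norm_bound[OF M.normed_space_axioms fL, of x y] xy by simp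
      also have "\<dots> \<le> l * nnorm E (nsub E x y)"
        using fl xy ME by (intro mult_right_mono norm_nonneg sub_closed) auto
      finally have n: "nnorm E (nsub E (f x) (f y)) \<le> l * nnorm E (nsub E x y)" .
      have "\<bar>\<phi> (f x) - \<phi> (f y)\<bar> \<le> nnorm ?ED \<phi> * nnorm E (nsub E (f x) (f y))"
        using dual_bound[OF pre_normed \<phi> sub_closed[OF fE]] dual_sub[OF \<phi> fE pre_normed] by simp
      also have "\<dots> \<le> nnorm ?ED \<phi> * (l * nnorm E (nsub E x y))"
        by (rule mult_left_mono[OF n ED.norm_nonneg[OF \<phi>]])
      finally show "\<bar>?La (?r \<phi>) (delta ?M x) - ?La (?r \<phi>) (delta ?M y)\<bar> \<le> l * nnorm ?ED \<phi> * nnorm E (nsub E x y)"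
        by (simp add: val xy mult_ac)
    qed
  qed
  moreover have "\<bar>?R \<phi> \<mu>\<bar> \<le> l * nnorm ?ED \<phi> * nnorm Free \<mu>" if \<phi>: "\<phi> \<in> ncar ?ED" and \<mu>: "\<mu> \<in> ncar Free" for \<phi> \<mu>
  proof -
    have m: "nzero E \<in> M" using M by (simp add: lin_subspace_def)
    have "\<bar>?R \<phi> \<mu>\<bar> \<le> nnorm (dual_space Free) (?R \<phi>) * nnorm Free \<mu>"
      by (rule dual_bound[OF Z.pre_normed R_closed[OF \<phi> m] \<mu>])
    also have "\<dots> \<le> (l * nnorm ?ED \<phi>) * nnorm Free \<mu>"
      by (rule mult_right_mono[OF R_norm[OF \<phi> m] Z.norm_nonneg[OF \<mu>]])
    finally show ?thesis .
  qed
  ultimately show ?thesis by blast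
qed

lemma functional_tendsto:
  assumes E: "normed_space E" and \<phi>: "\<phi> \<in> dual E" and y: "y \<in> ncar E"
    and g: "\<forall>\<^sub>F i in H. g i \<in> ncar E" and lim: "((\<lambda>i. ndist E (g i) y) \<longlongrightarrow> 0) H"
  shows "((\<lambda>i. \<phi> (g i)) \<longlongrightarrow> \<phi> y) H"
proof (rule LIM_zero_cancel, rule Lim_null_comparison)
  interpret normed_space E by fact
  show "\<forall>\<^sub>F i in H. norm (\<phi> (g i) - \<phi> y) \<le> nnorm (dual_space E) \<phi> * ndist E (g i) y"
    using g
  proof eventually_elim
    case (elim i)
    then show ?case
      using dual_bound[OF pre_normed \<phi> sub_closed[OF elim y]] dual_sub[OF \<phi> elim y pre_normed] y
      by (simp add: ndist_eq)
  qed
  show "((\<lambda>i. nnorm (dual_space E) \<phi> * ndist E (g i) y) \<longlongrightarrow> 0) H"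
    by (rule tendsto_mult_right_zero[OF lim])
qed

section \<open>The theorem\<close>

theorem theorem4p6:
  fixes X :: "'a nspace" and M :: "'a set" and A :: "'u op_class"
    and universe_embedding :: "((('a \<Rightarrow> real) \<Rightarrow> real) \<Rightarrow> real) \<Rightarrow> 'u"
  assumes "banach_space X"
    and "lin_subspace X M" and "closedin (ntop X) M"
    and "locally_complemented (free_space X) (free_sub X M)"
    and "inj universe_embedding"
    and "operator_ideal A" and "self_dual_ideal A"
    and "Lip_BAP A (sub_space X M)"
    and "BAP A (quotient_space (free_space X) (free_sub X M))"
  shows "\<exists>l\<ge>1. adjoint_op (free_space X) X (beta X) \<in>
           weak_star (dual_space X) (free_space X) closure_of
             ideal_ops_le A l (dual_space X) (dual_space (free_space X))"
proof -
  note X = assms(1) and M = assms(2) and Mc = assms(3) and lc = assms(4)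
    and emb = assms(5) and A = assms(6) and sd = assms(7)
  interpret X: normed_space X using X by (simp add: banach_space_def)
  let ?M = "sub_space X M" and ?Z = "free_space X" and ?N = "free_sub X M"
  let ?FM = "free_space ?M" and ?XD = "dual_space X" and ?ZD = "dual_space ?Z"
  let ?Q = "quotient_space ?Z ?N"
  have MX: "M \<subseteq> ncar X" using M by (simp add: lin_subspace_def)
  interpret M: normed_space ?M by (rule X.sub_space_normed[OF M])
  interpret Z: normed_space ?Z by (rule X.Free_normed)
  interpret FM: normed_space ?FM by (rule M.Free_normed)
  interpret XD: normed_space ?XD by (rule dual_normed[OF X.pre_normed])
  interpret ZD: normed_space ?ZD by (rule dual_normed[OF Z.pre_normed])
  interpret N: closed_subspace ?Z ?N
    by unfold_locales (use X.free_sub_lin_subspace[OF MX] Z.closedin_closed_span in \<open>auto simp: free_sub_def\<close>)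
  interpret Q: normed_space ?Q by (rule N.quotient_normed)

  \<comment> \<open>The duals of \<open>X\<close> and \<open>M\<close> consist of functions \<open>'a \<Rightarrow> real\<close>, which embed by evaluation into the domain
    of the given injection.\<close>
  have small: "inj (universe_embedding \<circ> (\<lambda>\<phi> \<Lambda>. \<Lambda> \<phi>))"
  proof (rule inj_compose[OF emb], rule injI)
    fix \<phi> \<psi> :: "'a \<Rightarrow> real" assume eq: "(\<lambda>\<Lambda>. \<Lambda> \<phi> :: real) = (\<lambda>\<Lambda>. \<Lambda> \<psi>)"
    have "(\<lambda>\<theta>. if \<theta> = \<phi> then 1 else 0 :: real) \<phi> = (\<lambda>\<theta>. if \<theta> = \<phi> then 1 else 0) \<psi>"
      using eq by (rule fun_cong)
    then show "\<phi> = \<psi>" by (simp split: if_splits)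
  qed
  have cX: "has_copy TYPE('u) ?XD" and cM: "has_copy TYPE('u) (dual_space ?M)"
    by (rule has_copy_if_injects[OF dual_banach inj_on_subset[OF small subset_UNIV]];
        intro X.pre_normed M.pre_normed)+
  have cZ: "has_copy TYPE('u) ?ZD" and cFM: "has_copy TYPE('u) (dual_space ?FM)"
    by (rule has_copy_if_injects[OF dual_banach inj_on_subset[OF emb subset_UNIV]];
        intro Z.pre_normed FM.pre_normed)+

  obtain l1 where l1: "l1 \<ge> 1"
    and idM: "(\<lambda>z\<in>ncar ?M. z) \<in> tau_c ?M ?M closure_of lip_ideal_le A l1 ?M ?M"
    using assms(8) unfolding Lip_BAP_def by blast
  obtain l2 where l2: "l2 \<ge> 1"
    and idQ: "(\<lambda>z\<in>ncar ?Q. z) \<in> tau_c ?Q ?Q closure_of ideal_ops_le A l2 ?Q ?Q"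
    using assms(9) unfolding BAP_def by blast
  obtain G :: "('a \<Rightarrow> 'a) filter" where G: "G \<noteq> bot" "\<forall>\<^sub>F f in G. f \<in> lip_ideal_le A l1 ?M ?M"
    and G_id: "\<And>m. m \<in> ncar ?M \<Longrightarrow> ((\<lambda>f. ndist ?M (f m) ((\<lambda>z\<in>ncar ?M. z) m)) \<longlongrightarrow> 0) G"
    using tau_c_closure_filter[OF M.normed_space_axioms M.normed_space_axioms idM] by metis
  obtain H :: "(((('a \<Rightarrow> real) \<Rightarrow> real) set) \<Rightarrow> ((('a \<Rightarrow> real) \<Rightarrow> real) set)) filter"
    where H: "H \<noteq> bot" "\<forall>\<^sub>F S in H. S \<in> ideal_ops_le A l2 ?Q ?Q"
    and H_id: "\<And>C. C \<in> ncar ?Q \<Longrightarrow> ((\<lambda>S. ndist ?Q (S C) ((\<lambda>z\<in>ncar ?Q. z) C)) \<longlongrightarrow> 0) H"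
    using tau_c_closure_filter[OF Q.normed_space_axioms Q.normed_space_axioms idQ] by metis

  define B where "B = adjoint_op ?Z X (beta X)"
  have B: "B \<in> ops ?XD ?ZD"
    unfolding B_def by (rule adjoint_operator[OF Z.pre_normed X.normed_space_axioms X.beta_props(1)[OF X]])
  have Bval: "B \<phi> \<mu> = \<mu> \<phi>" if "\<phi> \<in> ncar ?XD" "\<mu> \<in> ncar ?Z" for \<phi> \<mu>
    using that X.beta_props(2)[OF X] by (simp add: B_def adjoint_apply)
  have Bb: "\<bar>B \<phi> \<mu>\<bar> \<le> nnorm ?XD \<phi> * nnorm ?Z \<mu>" if "\<phi> \<in> ncar ?XD" "\<mu> \<in> ncar ?Z" for \<phi> \<mu>
  proof -
    have "\<bar>\<mu> \<phi>\<bar> \<le> nnorm X.Lip \<phi> * nnorm ?Z \<mu>"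
      by (rule X.Free_bound[OF that(2) X.dual_subset_Lip(1)[OF that(1)]])
    also have "\<dots> \<le> nnorm ?XD \<phi> * nnorm ?Z \<mu>"
      by (rule mult_right_mono[OF X.dual_subset_Lip(2)[OF that(1)] Z.norm_nonneg[OF that(2)]])
    finally show ?thesis by (simp add: Bval that)
  qed

  have "\<forall>f\<in>lip_ideal_le A l1 ?M ?M. \<exists>R. R \<in> ideal_ops A ?XD ?ZD \<and>
    (\<forall>\<phi>\<in>ncar ?XD. \<forall>m\<in>M. R \<phi> (delta X m) = \<phi> (f m)) \<and>
    (\<forall>\<phi>\<in>ncar ?XD. \<forall>\<mu>\<in>ncar ?Z. \<bar>R \<phi> \<mu>\<bar> \<le> l1 * nnorm ?XD \<phi> * nnorm ?Z \<mu>)"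
    using X.lipschitz_approximant[OF X M Mc lc A sd cX cZ cM cFM] l1 by fastforce
  then obtain R1 where R1: "\<And>f. f \<in> lip_ideal_le A l1 ?M ?M \<Longrightarrow> R1 f \<in> ideal_ops A ?XD ?ZD"
    and R1d: "\<And>f \<phi> m. \<lbrakk>f \<in> lip_ideal_le A l1 ?M ?M; \<phi> \<in> ncar ?XD; m \<in> M\<rbrakk> \<Longrightarrow> R1 f \<phi> (delta X m) = \<phi> (f m)"
    and R1b: "\<And>f \<phi> \<mu>. \<lbrakk>f \<in> lip_ideal_le A l1 ?M ?M; \<phi> \<in> ncar ?XD; \<mu> \<in> ncar ?Z\<rbrakk>
      \<Longrightarrow> \<bar>R1 f \<phi> \<mu>\<bar> \<le> l1 * nnorm ?XD \<phi> * nnorm ?Z \<mu>"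
    by metis

  have R1op: "\<forall>\<^sub>F f in G. R1 f \<in> ops ?XD ?ZD"
    using G(2) by eventually_elim (rule ideal_ops_operator[OF R1])
  have R1bound: "\<forall>\<^sub>F f in G. \<forall>\<phi>\<in>ncar ?XD. \<forall>\<mu>\<in>ncar ?Z. \<bar>R1 f \<phi> \<mu>\<bar> \<le> l1 * nnorm ?XD \<phi> * nnorm ?Z \<mu>"
    using G(2) by eventually_elim (use R1b in blast)
  have "0 \<le> l1" using l1 by simp
  from operators_into_dual_compactness[OF XD.pre_normed Z.pre_normed this G(1) R1op R1bound]
  obtain G' U where G': "G' \<noteq> bot" "G' \<le> G" and U: "U \<in> ops ?XD ?ZD"
    and lim1: "\<And>\<phi> \<mu>. \<lbrakk>\<phi> \<in> ncar ?XD; \<mu> \<in> ncar ?Z\<rbrakk> \<Longrightarrow> ((\<lambda>f. R1 f \<phi> \<mu>) \<longlongrightarrow> U \<phi> \<mu>) G'"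
    and Ub: "\<And>\<phi> \<mu>. \<lbrakk>\<phi> \<in> ncar ?XD; \<mu> \<in> ncar ?Z\<rbrakk> \<Longrightarrow> \<bar>U \<phi> \<mu>\<bar> \<le> l1 * nnorm ?XD \<phi> * nnorm ?Z \<mu>"
    by metis
  have G'2: "\<forall>\<^sub>F f in G'. f \<in> lip_ideal_le A l1 ?M ?M" using G(2) G'(2) by (rule filter_leD[rotated])

  \<comment> \<open>At \<open>\<delta>\<^sub>m\<close> the operators \<open>R1 f\<close> only involve \<open>f m \<rightarrow> m\<close>, so that \<open>U\<close> is known there.\<close>
  have U_on_M: "U \<phi> (delta X m) = \<phi> m" if \<phi>: "\<phi> \<in> ncar ?XD" and m: "m \<in> M" for \<phi> m
  proof -
    have \<phi>M: "(\<lambda>x\<in>M. \<phi> x) \<in> dual ?M"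
      by (rule dualI[where C = "nnorm ?XD \<phi>"])
        (use MX M.add_closed M.scale_closed dual_bound[OF X.pre_normed \<phi>] in
          \<open>auto simp: subset_iff dual_add[OF \<phi>] dual_scale[OF \<phi>]\<close>)
    have fM: "\<forall>\<^sub>F f in G'. f m \<in> M"
      using G'2 by eventually_elim (use m Lip0_closed in \<open>fastforce simp: lip_ideal_le_def lip_ideal_def\<close>)
    have "((\<lambda>f. ndist ?M (f m) m) \<longlongrightarrow> 0) G'" using G_id[of m] m tendsto_mono[OF G'(2)] by simp
    then have "((\<lambda>f. (\<lambda>x\<in>M. \<phi> x) (f m)) \<longlongrightarrow> (\<lambda>x\<in>M. \<phi> x) m) G'"
      using fM m by (intro functional_tendsto[OF M.normed_space_axioms \<phi>M]) auto
    moreover have "\<forall>\<^sub>F f in G'. (\<lambda>x\<in>M. \<phi> x) (f m) = R1 f \<phi> (delta X m)"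
      using G'2 fM by eventually_elim (simp add: R1d \<phi> m)
    ultimately have "((\<lambda>f. R1 f \<phi> (delta X m)) \<longlongrightarrow> \<phi> m) G'"
      using m by (auto dest: tendsto_cong[THEN iffD1, rotated])
    moreover have "delta X m \<in> ncar ?Z" using X.delta_Free m MX by blast
    ultimately show ?thesis using tendsto_unique[OF G'(1) lim1[OF \<phi>]] by blast
  qed

  let ?d = "\<lambda>\<phi>. nsub ?ZD (B \<phi>) (U \<phi>)"
  have dc: "?d \<phi> \<in> ncar ?ZD" if "\<phi> \<in> ncar ?XD" for \<phi>
    by (intro ZD.sub_closed operators_closed[OF B] operators_closed[OF U] that)
  have dval: "?d \<phi> \<mu> = B \<phi> \<mu> - U \<phi> \<mu>" if "\<mu> \<in> ncar ?Z" for \<phi> \<mu>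
    using that by (simp add: dual_nsub[OF Z.pre_normed])
  have dN: "?d \<phi> \<mu> = 0" if \<phi>: "\<phi> \<in> ncar ?XD" and \<mu>: "\<mu> \<in> ?N" for \<phi> \<mu>
  proof (rule X.functional_vanishes_on_free_sub[OF MX dc[OF \<phi>] _ \<mu>])
    fix m assume m: "m \<in> M"
    then have d: "delta X m \<in> ncar ?Z" using X.delta_Free MX by blast
    have "B \<phi> (delta X m) = \<phi> m"
      using Bval[OF \<phi> d] X.dual_subset_Lip(1)[OF \<phi>] by (simp add: delta_def)
    then show "?d \<phi> (delta X m) = 0" using dval[OF d] U_on_M[OF \<phi> m] by simp
  qed
  have db: "\<bar>?d \<phi> \<mu>\<bar> \<le> ((1 + l1) * nnorm ?XD \<phi>) * nnorm ?Z \<mu>" if "\<phi> \<in> ncar ?XD" "\<mu> \<in> ncar ?Z" for \<phi> \<mu>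
    using Bb[OF that] Ub[OF that] dval[OF that(2), of \<phi>] by (simp add: algebra_simps)
  \<comment> \<open>So \<open>\<beta>\<^sub>X\<^sup>* - U\<close> takes values in \<open>\<FF>(M)\<^sup>\<bottom>\<close> and factors through the dual of the quotient.\<close>
  have "\<exists>\<psi>. \<psi> \<in> dual ?Q \<and> (\<forall>\<mu>\<in>ncar ?Z. \<psi> (coset ?Z ?N \<mu>) = ?d \<phi> \<mu>) \<and>
      nnorm (dual_space ?Q) \<psi> \<le> (1 + l1) * nnorm ?XD \<phi>" if \<phi>: "\<phi> \<in> ncar ?XD" for \<phi>
  proof -
    have nn: "0 \<le> (1 + l1) * nnorm ?XD \<phi>" using l1 XD.norm_nonneg[OF \<phi>] by simp
    obtain \<psi> where "\<psi> \<in> dual ?Q" "\<And>\<mu>. \<mu> \<in> ncar ?Z \<Longrightarrow> \<psi> (coset ?Z ?N \<mu>) = ?d \<phi> \<mu>"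
      "nnorm (dual_space ?Q) \<psi> \<le> (1 + l1) * nnorm ?XD \<phi>"
      by (rule N.annihilator_factors[OF dc[OF \<phi>] dN[OF \<phi>] nn db[OF \<phi>]]) (assumption | rule that)+
    then show ?thesis by (intro exI[of _ \<psi>] conjI ballI)
  qed
  then obtain D0 where D0: "\<And>\<phi>. \<phi> \<in> ncar ?XD \<Longrightarrow> D0 \<phi> \<in> dual ?Q"
    and D0v: "\<And>\<phi> \<mu>. \<lbrakk>\<phi> \<in> ncar ?XD; \<mu> \<in> ncar ?Z\<rbrakk> \<Longrightarrow> D0 \<phi> (coset ?Z ?N \<mu>) = ?d \<phi> \<mu>"
    and D0b: "\<And>\<phi>. \<phi> \<in> ncar ?XD \<Longrightarrow> nnorm (dual_space ?Q) (D0 \<phi>) \<le> (1 + l1) * nnorm ?XD \<phi>"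
    by metis
  let ?D = "restrict D0 (ncar ?XD)"
  interpret QD: normed_space "dual_space ?Q" by (rule dual_normed[OF Q.pre_normed])
  have D: "?D \<in> ops ?XD (dual_space ?Q)"
  proof (rule operatorsI[where C = "1 + l1"])
    show "?D (nadd ?XD \<phi> \<psi>) = nadd (dual_space ?Q) (?D \<phi>) (?D \<psi>)"
      if p: "\<phi> \<in> ncar ?XD" "\<psi> \<in> ncar ?XD" for \<phi> \<psi>
    proof (rule dual_eqI)
      fix C assume "C \<in> ncar ?Q"
      then obtain \<mu> where \<mu>: "\<mu> \<in> ncar ?Z" "C = coset ?Z ?N \<mu>" by (auto simp: N.quotient_simps)
      then show "?D (nadd ?XD \<phi> \<psi>) C = nadd (dual_space ?Q) (?D \<phi>) (?D \<psi>) C"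
        using p XD.add_closed[OF p] N.coset_closed[OF \<mu>(1)]
        by (simp add: D0v dual_nsub[OF Z.pre_normed] operators_add[OF B] operators_add[OF U] dual_simps(2)[of ?Z] dual_simps(2)[of ?Q])
    qed (use p D0 XD.add_closed QD.add_closed in auto)
    show "?D (nscale ?XD c \<phi>) = nscale (dual_space ?Q) c (?D \<phi>)" if p: "\<phi> \<in> ncar ?XD" for c \<phi>
    proof (rule dual_eqI)
      fix C assume "C \<in> ncar ?Q"
      then obtain \<mu> where \<mu>: "\<mu> \<in> ncar ?Z" "C = coset ?Z ?N \<mu>" by (auto simp: N.quotient_simps)
      then show "?D (nscale ?XD c \<phi>) C = nscale (dual_space ?Q) c (?D \<phi>) C"
        using p XD.scale_closed[OF p] N.coset_closed[OF \<mu>(1)]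
        by (simp add: D0v dual_nsub[OF Z.pre_normed] operators_scale[OF B] operators_scale[OF U] dual_simps(3)[of ?Z]
            dual_simps(3)[of ?Q] right_diff_distrib)
    qed (use p D0 XD.scale_closed QD.scale_closed in auto)
  qed (use D0 D0b in auto)
  have Db: "nnorm (dual_space ?Q) (?D \<phi>) \<le> (1 + l1) * nnorm ?XD \<phi>" if "\<phi> \<in> ncar ?XD" for \<phi>
    using D0b that by simp

  have "\<forall>S\<in>ideal_ops_le A l2 ?Q ?Q. \<exists>R. R \<in> ideal_ops A ?XD ?ZD \<and> (\<forall>\<phi>\<in>ncar ?XD. \<forall>\<mu>\<in>ncar ?Z.
    R \<phi> \<mu> = ?D \<phi> (S (coset ?Z ?N \<mu>)) \<and> \<bar>R \<phi> \<mu>\<bar> \<le> l2 * (1 + l1) * nnorm ?XD \<phi> * nnorm ?Z \<mu>)"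
  proof
    fix S assume S: "S \<in> ideal_ops_le A l2 ?Q ?Q"
    have "0 \<le> l2" "0 \<le> 1 + l1" using l1 l2 by auto
    from N.quotient_approximant[OF A sd S this XD.normed_space_axioms cX cZ D Db]
    show "\<exists>R. R \<in> ideal_ops A ?XD ?ZD \<and> (\<forall>\<phi>\<in>ncar ?XD. \<forall>\<mu>\<in>ncar ?Z.
      R \<phi> \<mu> = ?D \<phi> (S (coset ?Z ?N \<mu>)) \<and> \<bar>R \<phi> \<mu>\<bar> \<le> l2 * (1 + l1) * nnorm ?XD \<phi> * nnorm ?Z \<mu>)"
      by blast
  qed
  then obtain R2 where R2: "\<And>S. S \<in> ideal_ops_le A l2 ?Q ?Q \<Longrightarrow> R2 S \<in> ideal_ops A ?XD ?ZD"
    and R2v: "\<And>S \<phi> \<mu>. \<lbrakk>S \<in> ideal_ops_le A l2 ?Q ?Q; \<phi> \<in> ncar ?XD; \<mu> \<in> ncar ?Z\<rbrakk>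
      \<Longrightarrow> R2 S \<phi> \<mu> = ?D \<phi> (S (coset ?Z ?N \<mu>))"
    and R2b: "\<And>S \<phi> \<mu>. \<lbrakk>S \<in> ideal_ops_le A l2 ?Q ?Q; \<phi> \<in> ncar ?XD; \<mu> \<in> ncar ?Z\<rbrakk>
      \<Longrightarrow> \<bar>R2 S \<phi> \<mu>\<bar> \<le> l2 * (1 + l1) * nnorm ?XD \<phi> * nnorm ?Z \<mu>"
    by metis
  have lim2: "((\<lambda>S. R2 S \<phi> \<mu>) \<longlongrightarrow> B \<phi> \<mu> - U \<phi> \<mu>) H" if \<phi>: "\<phi> \<in> ncar ?XD" and \<mu>: "\<mu> \<in> ncar ?Z" for \<phi> \<mu>
  proof -
    let ?C = "coset ?Z ?N \<mu>"
    have C: "?C \<in> ncar ?Q" by (rule N.coset_closed[OF \<mu>])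
    have HC: "((\<lambda>S. ndist ?Q (S ?C) ?C) \<longlongrightarrow> 0) H" using H_id[OF C] C by simp
    have "\<forall>\<^sub>F S in H. S ?C \<in> ncar ?Q"
      using H(2) by eventually_elim
        (use operators_closed[OF ideal_ops_operator C] in \<open>auto simp: ideal_ops_le_def\<close>)
    then have "((\<lambda>S. ?D \<phi> (S ?C)) \<longlongrightarrow> ?D \<phi> ?C) H"
      by (rule functional_tendsto[OF Q.normed_space_axioms operators_closed[OF D \<phi>] C _ HC])
    moreover have "\<forall>\<^sub>F S in H. ?D \<phi> (S ?C) = R2 S \<phi> \<mu>"
      using H(2) by eventually_elim (simp only: R2v[OF _ \<phi> \<mu>])
    moreover have "?D \<phi> ?C = B \<phi> \<mu> - U \<phi> \<mu>" using \<phi> \<mu> by (simp add: D0v dval)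
    ultimately show ?thesis by (auto dest: tendsto_cong[THEN iffD1, rotated])
  qed

  \<comment> \<open>\<open>R1 f \<rightarrow> U\<close> and \<open>R2 S \<rightarrow> \<beta>\<^sub>X\<^sup>* - U\<close>, so the sums converge to \<open>\<beta>\<^sub>X\<^sup>*\<close> along the product filter.\<close>
  define l where "l = l1 + l2 * (1 + l1)"
  have "0 \<le> l2 * (1 + l1)" using l1 l2 by simp
  then have l: "l \<ge> 1" using l1 unfolding l_def by linarith
  define R where "R p = nadd (operators ?XD ?ZD) (R1 (fst p)) (R2 (snd p))" for p
  have Rval: "R p \<phi> \<mu> = R1 (fst p) \<phi> \<mu> + R2 (snd p) \<phi> \<mu>" if "\<phi> \<in> ncar ?XD" "\<mu> \<in> ncar ?Z" for p \<phi> \<mu>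
    using that by (simp add: R_def operators_simps(2) dual_simps(2))
  let ?good = "\<lambda>p. fst p \<in> lip_ideal_le A l1 ?M ?M \<and> snd p \<in> ideal_ops_le A l2 ?Q ?Q"
  have Rb: "\<bar>R p \<phi> \<mu>\<bar> \<le> l * nnorm ?XD \<phi> * nnorm ?Z \<mu>"
    if "?good p" and \<phi>: "\<phi> \<in> ncar ?XD" and \<mu>: "\<mu> \<in> ncar ?Z" for p \<phi> \<mu>
    using R1b[of "fst p", OF _ \<phi> \<mu>] R2b[of "snd p", OF _ \<phi> \<mu>] that(1)
    unfolding Rval[OF \<phi> \<mu>] l_def by (simp add: algebra_simps)
  have Rnorm: "nnorm ?ZD (R p \<phi>) \<le> l * nnorm ?XD \<phi>" if "?good p" and \<phi>: "\<phi> \<in> ncar ?XD" for p \<phi>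
    by (rule dual_norm_le[OF Z.pre_normed]) (use Rb[OF that] l XD.norm_nonneg[OF \<phi>] in auto)
  have Rop: "R p \<in> ops ?XD ?ZD" if g: "?good p" for p
  proof (rule operatorsI[where C = l])
    have o1: "R1 (fst p) \<in> ops ?XD ?ZD" and o2: "R2 (snd p) \<in> ops ?XD ?ZD"
      using g R1 R2 ideal_ops_operator by blast+
    note ZDs = operators_closed[OF o1] operators_closed[OF o2]
    have Rp: "R p \<phi> = nadd ?ZD (R1 (fst p) \<phi>) (R2 (snd p) \<phi>)" if "\<phi> \<in> ncar ?XD" for \<phi>
      using that by (simp add: R_def operators_simps)
    show "R p \<in> extensional (ncar ?XD)" by (simp add: R_def operators_simps)
    show "R p \<phi> \<in> ncar ?ZD" if "\<phi> \<in> ncar ?XD" for \<phi>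
      using that ZDs by (simp add: Rp ZD.add_closed)
    show "R p (nadd ?XD \<phi> \<psi>) = nadd ?ZD (R p \<phi>) (R p \<psi>)" if "\<phi> \<in> ncar ?XD" "\<psi> \<in> ncar ?XD" for \<phi> \<psi>
      using that ZDs by (simp add: Rp XD.add_closed operators_add[OF o1] operators_add[OF o2]
          ZD.add_assoc ZD.add_left_commute ZD.add_closed)
    show "R p (nscale ?XD c \<phi>) = nscale ?ZD c (R p \<phi>)" if "\<phi> \<in> ncar ?XD" for c \<phi>
      using that ZDs by (simp add: Rp XD.scale_closed operators_scale[OF o1] operators_scale[OF o2]
          ZD.scale_add_right)
    show "nnorm ?ZD (R p \<phi>) \<le> l * nnorm ?XD \<phi>" if "\<phi> \<in> ncar ?XD" for \<phi>
      by (rule Rnorm[OF g that])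
  qed
  have RA: "R p \<in> ideal_ops_le A l ?XD ?ZD" if g: "?good p" for p
  proof -
    have "R p \<in> ideal_ops A ?XD ?ZD"
      using ideal_ops_add[OF A R1 R2 XD.normed_space_axioms ZD.normed_space_axioms, of "fst p" "snd p"]
        g Rop[OF g] unfolding R_def by blast
    moreover have "op_norm ?XD ?ZD (R p) \<le> l"
      by (rule op_norm_le[OF XD.pre_normed]) (use l Rnorm[OF g] in auto)
    ultimately show ?thesis by (simp add: ideal_ops_le_def)
  qed
  let ?H = "G' \<times>\<^sub>F H"
  have good: "\<forall>\<^sub>F p in ?H. ?good p"
    unfolding eventually_prod_filter using G'2 H(2) by (intro exI conjI) auto
  have lim: "((\<lambda>p. R p \<phi> \<mu>) \<longlongrightarrow> B \<phi> \<mu>) ?H" if \<phi>: "\<phi> \<in> ncar ?XD" and \<mu>: "\<mu> \<in> ncar ?Z" for \<phi> \<mu>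
  proof -
    have "((\<lambda>p. R1 (fst p) \<phi> \<mu> + R2 (snd p) \<phi> \<mu>) \<longlongrightarrow> U \<phi> \<mu> + (B \<phi> \<mu> - U \<phi> \<mu>)) ?H"
      by (intro tendsto_add filterlim_compose[OF lim1[OF \<phi> \<mu>] filterlim_fst]
          filterlim_compose[OF lim2[OF \<phi> \<mu>] filterlim_snd])
    then show ?thesis by (simp add: Rval[OF \<phi> \<mu>])
  qed
  have "B \<in> weak_star ?XD ?Z closure_of ideal_ops_le A l ?XD ?ZD"
  proof (rule weak_star_closure[OF XD.normed_space_axioms Z.pre_normed, where l = l and H = ?H and R = R])
    show "0 < l" using l by simp
    show "?H \<noteq> bot" using G'(1) H(1) by (simp add: prod_filter_eq_bot)
    show "\<forall>\<^sub>F p in ?H. R p \<in> ideal_ops_le A l ?XD ?ZD" using good by eventually_elim (rule RA)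
    show "\<forall>\<^sub>F p in ?H. R p \<in> ops ?XD ?ZD" using good by eventually_elim (rule Rop)
    show "\<forall>\<^sub>F p in ?H. \<forall>\<phi>\<in>ncar ?XD. \<forall>\<mu>\<in>ncar ?Z. \<bar>R p \<phi> \<mu>\<bar> \<le> l * nnorm ?XD \<phi> * nnorm ?Z \<mu>"
      using good by eventually_elim (use Rb in blast)
    show "\<bar>B \<phi> \<mu>\<bar> \<le> l * nnorm ?XD \<phi> * nnorm ?Z \<mu>" if "\<phi> \<in> ncar ?XD" "\<mu> \<in> ncar ?Z" for \<phi> \<mu>
    proof -
      have "1 * (nnorm ?XD \<phi> * nnorm ?Z \<mu>) \<le> l * (nnorm ?XD \<phi> * nnorm ?Z \<mu>)"
        by (intro mult_right_mono l mult_nonneg_nonneg XD.norm_nonneg Z.norm_nonneg that)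
      then show ?thesis using Bb[OF that] by (simp add: mult.assoc)
    qed
  qed (use B lim in auto)
  then show ?thesis using l unfolding B_def by blast
qed

end
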